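(* In the binary model, let $\tau\in(0,1/44)$ be a constant, let $\boldsymbol\theta^*=\boldsymbol\theta^*_n$ satisfy $\|\boldsymbol\theta^*\|_\infty\le\tau\log n$, and let $A\sim\mathbb{P}_{\boldsymbol\theta^*}$. Then for every fixed $k\ge1$, as $n\to\infty$, the vector consisting of the first $k$ coordinates of $\hat{\boldsymbol\theta}-\boldsymbol\theta^*$ is asymptotically multivariate normal with mean $\mathbf{0}$ and covariance matrix equal to the upper-left $k\times k$ block $S_{[k]}$ of $S$; that is, $S_{[k]}^{-1/2}(\hat{\boldsymbol\theta}-\boldsymbol\theta^* )_{1:k}\to N(0,I_k)$ in distribution.
   Context: Binary model: Let $n\ge2$. For $\boldsymbol\theta=(\alpha_1,\dots,\alpha_n,\beta_1,\dots,\beta_{n-1})^\top\in\mathbb{R}^{2n-1}$ set $\beta_n=0$, and let $\mathbb{P}_{\boldsymbol\theta}$ be the law of a random $n\times n$ matrix $A=(a_{i,j})$ with $a_{i,i}=0$ and $a_{i,j}$ ($i\ne j$) mutually independent Bernoulli with $\mathbb{P}(a_{i,j}=1)=e^{\alpha_i+\beta_j}/(1+e^{\alpha_i+\beta_j})$. $d_i=\sum_{j\ne i}a_{i,j}$, $b_j=\sum_{i\ne j}a_{i,j}$. The MLE $\hat{\boldsymbol\theta}$ (with $\hat\beta_n=0$) solves $d_i=\sum_{k\ne i}\frac{e^{\hat\alpha_i+\hat\beta_k}}{1+e^{\hat\alpha_i+\hat\beta_k}}$ ($i\le n$), $b_j=\sum_{k\ne j}\frac{e^{\hat\alpha_k+\hat\beta_j}}{1+e^{\hat\alpha_k+\hat\beta_j}}$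 ($j\le n-1$); it exists with probability tending to one under the stated assumptions. Fisher information: with $u(x)=e^x/(1+e^x)^2$, $V=(v_{i,j})$ is the $(2n-1)\times(2n-1)$ symmetric matrix (at $\boldsymbol\theta^*$, $\beta_n^*=0$) with $v_{i,i}=\sum_{k\ne i}u(\alpha_i^*+\beta_k^* )$ ($i\le n$), $v_{n+j,n+j}=\sum_{k\ne j}u(\alpha_k^*+\beta_j^* )$ ($j\le n-1$), $v_{i,n+j}=v_{n+j,i}=u(\alpha_i^*+\beta_j^* )$ for $i\ne j$, other off-diagonal entries zero. $v_{2n,i}:=v_{i,i}-\sum_{j\le2n-1,j\ne i}v_{i,j}$, $v_{2n,2n}:=\sum_{i=1}^{2n-1}v_{2n,i}$. $S=(s_{i,j})$ with $s_{i,j}=\delta_{i,j}/v_{i,i}+1/v_{2n,2n}$ if $i,j\in\{1,\dots,n\}$ or $i,j\in\{n+1,\dots,2n-1\}$, and $s_{i,j}=-1/v_{2n,2n}$ otherwise. *)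

theory Defs
  imports "HOL-Probability.Probability"
begin

(* Parameter vectors theta are functions nat => real, meaningful on indices 1..2n-1:
   theta i = alpha_i (1 <= i <= n), theta (n+j) = beta_j (1 <= j <= n-1); beta_n = 0. *)

definition alpha :: "nat \<Rightarrow> (nat \<Rightarrow> real) \<Rightarrow> nat \<Rightarrow> real" where
  "alpha n \<theta> i = \<theta> i"

definition beta :: "nat \<Rightarrow> (nat \<Rightarrow> real) \<Rightarrow> nat \<Rightarrow> real" where
  "beta n \<theta> j = (if j = n then 0 else \<theta> (n + j))"

definition logistic :: "real \<Rightarrow> real" where
  "logistic x = exp x / (1 + exp x)"

definition u_fun :: "real \<Rightarrow> real" where
  "u_fun x = exp x / (1 + exp x)^2"

definition offdiag :: "nat \<Rightarrow> (nat \<times> nat) set" where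
  "offdiag n = {(i, j). i \<in> {1..n} \<and> j \<in> {1..n} \<and> i \<noteq> j}"

definition binary_model :: "nat \<Rightarrow> (nat \<Rightarrow> real) \<Rightarrow> (nat \<times> nat \<Rightarrow> bool) pmf" where
  "binary_model n \<theta> = Pi_pmf (offdiag n) False
     (\<lambda>(i, j). bernoulli_pmf (logistic (alpha n \<theta> i + beta n \<theta> j)))"

definition out_deg :: "nat \<Rightarrow> (nat \<times> nat \<Rightarrow> bool) \<Rightarrow> nat \<Rightarrow> real" where
  "out_deg n A i = (\<Sum>j\<in>{1..n} - {i}. of_bool (A (i, j)))"

definition in_deg :: "nat \<Rightarrow> (nat \<times> nat \<Rightarrow> bool) \<Rightarrow> nat \<Rightarrow> real" where
  "in_deg n A j = (\<Sum>i\<in>{1..n} - {j}. of_bool (A (i, j)))"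

definition mle_eqs :: "nat \<Rightarrow> (nat \<times> nat \<Rightarrow> bool) \<Rightarrow> (nat \<Rightarrow> real) \<Rightarrow> bool" where
  "mle_eqs n A \<theta> \<longleftrightarrow>
     (\<forall>i. i \<notin> {1..2*n-1} \<longrightarrow> \<theta> i = 0) \<and>
     (\<forall>i\<in>{1..n}. out_deg n A i =
        (\<Sum>k\<in>{1..n} - {i}. logistic (alpha n \<theta> i + beta n \<theta> k))) \<and>
     (\<forall>j\<in>{1..n-1}. in_deg n A j =
        (\<Sum>k\<in>{1..n} - {j}. logistic (alpha n \<theta> k + beta n \<theta> j)))"

(* the MLE (unique when it exists); arbitrary value 0 when it does not exist *)
definition mle :: "nat \<Rightarrow> (nat \<times> nat \<Rightarrow> bool) \<Rightarrow> nat \<Rightarrow> real" where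
  "mle n A = (if \<exists>\<theta>. mle_eqs n A \<theta> then (SOME \<theta>. mle_eqs n A \<theta>) else (\<lambda>_. 0))"

definition fisherV :: "nat \<Rightarrow> (nat \<Rightarrow> real) \<Rightarrow> nat \<Rightarrow> nat \<Rightarrow> real" where
  "fisherV n \<theta> i j =
    (if i \<in> {1..n} \<and> j = i then (\<Sum>k\<in>{1..n} - {i}. u_fun (alpha n \<theta> i + beta n \<theta> k))
     else if i \<in> {n+1..2*n-1} \<and> j = i then
       (\<Sum>k\<in>{1..n} - {i - n}. u_fun (alpha n \<theta> k + beta n \<theta> (i - n)))
     else if i \<in> {1..n} \<and> j \<in> {n+1..2*n-1} \<and> i \<noteq> j - n then
       u_fun (alpha n \<theta> i + beta n \<theta> (j - n))
     else if j \<in> {1..n} \<and> i \<in> {n+1..2*n-1} \<and> j \<noteq> i - n then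
       u_fun (alpha n \<theta> j + beta n \<theta> (i - n))
     else 0)"

definition v2n :: "nat \<Rightarrow> (nat \<Rightarrow> real) \<Rightarrow> nat \<Rightarrow> real" where
  "v2n n \<theta> i = fisherV n \<theta> i i - (\<Sum>j\<in>{1..2*n-1} - {i}. fisherV n \<theta> i j)"

definition v2n2n :: "nat \<Rightarrow> (nat \<Rightarrow> real) \<Rightarrow> real" where
  "v2n2n n \<theta> = (\<Sum>i\<in>{1..2*n-1}. v2n n \<theta> i)"

definition S_mat :: "nat \<Rightarrow> (nat \<Rightarrow> real) \<Rightarrow> nat \<Rightarrow> nat \<Rightarrow> real" where
  "S_mat n \<theta> i j =
    (if (i \<in> {1..n} \<and> j \<in> {1..n}) \<or> (i \<in> {n+1..2*n-1} \<and> j \<in> {n+1..2*n-1})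
     then (if i = j then 1 / fisherV n \<theta> i i else 0) + 1 / v2n2n n \<theta>
     else - 1 / v2n2n n \<theta>)"

definition kmat :: "nat \<Rightarrow> (nat \<Rightarrow> nat \<Rightarrow> real) \<Rightarrow> bool" where
  "kmat k M \<longleftrightarrow> (\<forall>i j. (i \<notin> {1..k} \<or> j \<notin> {1..k}) \<longrightarrow> M i j = 0)"

definition kmul :: "nat \<Rightarrow> (nat \<Rightarrow> nat \<Rightarrow> real) \<Rightarrow> (nat \<Rightarrow> nat \<Rightarrow> real) \<Rightarrow> nat \<Rightarrow> nat \<Rightarrow> real" where
  "kmul k M N i j = (if i \<in> {1..k} \<and> j \<in> {1..k} then (\<Sum>l\<in>{1..k}. M i l * N l j) else 0)"

definition kid :: "nat \<Rightarrow> nat \<Rightarrow> nat \<Rightarrow> real" where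
  "kid k i j = (if i \<in> {1..k} \<and> j = i then 1 else 0)"

definition ksym_posdef :: "nat \<Rightarrow> (nat \<Rightarrow> nat \<Rightarrow> real) \<Rightarrow> bool" where
  "ksym_posdef k M \<longleftrightarrow> kmat k M \<and> (\<forall>i j. M i j = M j i) \<and>
     (\<forall>x. (\<exists>i\<in>{1..k}. x i \<noteq> 0) \<longrightarrow> (\<Sum>i\<in>{1..k}. \<Sum>j\<in>{1..k}. x i * M i j * x j) > 0)"

definition ksqrt :: "nat \<Rightarrow> (nat \<Rightarrow> nat \<Rightarrow> real) \<Rightarrow> nat \<Rightarrow> nat \<Rightarrow> real" where
  "ksqrt k M = (THE R. ksym_posdef k R \<and> kmul k R R = M)"

definition kinv :: "nat \<Rightarrow> (nat \<Rightarrow> nat \<Rightarrow> real) \<Rightarrow> nat \<Rightarrow> nat \<Rightarrow> real" where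
  "kinv k M = (THE N. kmat k N \<and> kmul k M N = kid k \<and> kmul k N M = kid k)"

definition kinvsqrt :: "nat \<Rightarrow> (nat \<Rightarrow> nat \<Rightarrow> real) \<Rightarrow> nat \<Rightarrow> nat \<Rightarrow> real" where
  "kinvsqrt k M = kinv k (ksqrt k M)"

definition block :: "nat \<Rightarrow> (nat \<Rightarrow> nat \<Rightarrow> real) \<Rightarrow> nat \<Rightarrow> nat \<Rightarrow> real" where
  "block k M i j = (if i \<in> {1..k} \<and> j \<in> {1..k} then M i j else 0)"

definition std_normal_k :: "nat \<Rightarrow> (nat \<Rightarrow> real) measure" where
  "std_normal_k k = PiM {1..k} (\<lambda>_. density lborel std_normal_density)"

(* convergence in distribution of random vectors X n (defined on the pmf P n, values
   extensional on {1..k}) to the law mu: E f(X_n) -> E_mu f for every bounded continuous f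
   on R^{1..k} (product topology) *)
definition conv_distr_k ::
  "nat \<Rightarrow> (nat \<Rightarrow> 'a pmf) \<Rightarrow> (nat \<Rightarrow> 'a \<Rightarrow> nat \<Rightarrow> real) \<Rightarrow> (nat \<Rightarrow> real) measure \<Rightarrow> bool" where
  "conv_distr_k k P X \<mu> \<longleftrightarrow>
     (\<forall>f :: (nat \<Rightarrow> real) \<Rightarrow> real.
        continuous_on (PiE {1..k} (\<lambda>_. UNIV)) f \<longrightarrow>
        (\<exists>B. \<forall>x\<in>PiE {1..k} (\<lambda>_. UNIV). \<bar>f x\<bar> \<le> B) \<longrightarrow>
        (\<lambda>n. measure_pmf.expectation (P n) (\<lambda>\<omega>. f (X n \<omega>)))
          \<longlonglongrightarrow> integral\<^sup>L \<mu> f)"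

end

theory Submission
  imports Defs "HOL-Computational_Algebra.Formal_Power_Series"
    "HOL-Analysis.Generalised_Binomial_Theorem" "HOL-Real_Asymp.Real_Asymp"
begin

text \<open>
  Write \<open>x\<close> and \<open>y\<close> for the errors in \<open>\<alpha>\<close> and \<open>\<beta>\<close> (with \<open>y n = 0\<close>), \<open>g i\<close> and \<open>h j\<close> for
  the centred degrees, \<open>v i\<close> and \<open>v' j\<close> for the row and column sums of the edge variances. The score
  equations are a bipartite system \<open>\<Sum>j. w i j * (x i + y j) = g i\<close>, \<open>\<Sum>i. w i j * (x i + y j) = h j\<close>.
  Solving for \<open>x\<close> writes it as weighted averages of \<open>- y\<close> and vice versa; since averaging
  contracts oscillations, the system is stable in the supremum norm. Stability is used
  twice. Applied to a maximiser of the likelihood over a small box, it shows that the maximiser is,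
  up to a gauge shift, interior, so the MLE exists and is uniformly close to the truth. Applied to the
  linearised equations for \<open>x i - g i / v i - h n / v' n\<close>, whose right-hand side consists of a quadratic
  Taylor remainder and of the mixed sums \<open>\<Sum>j. u i j * h j / v' j\<close> (small by Hoeffding), it shows that
  \<open>x i = g i / v i + h n / v' n\<close> up to \<open>o(n powr (-1/2))\<close>.

  This leading term is a sum of independent centred edge variables whose covariance matrix is
  \<open>S\<close> up to a negligible contribution of the edges \<open>(i, n)\<close>. After whitening, every linear functional
  \<open>t\<close> therefore has a characteristic function converging to \<open>exp (- |t|\<^sup>2 / 2)\<close>, and a multivariate
  continuity theorem concludes.
\<close>

section \<open>Stability of bipartite linear systems\<close>

text \<open>The score equations determine \<open>x\<close> and \<open>y\<close> only up to
  \<open>(x + s, y - s)\<close>, so stability can be stated only for the gauge-invariant sums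
  \<open>x i + y j\<close>; fixing \<open>y n = 0\<close> at the end is what brings
  \<open>h n / v' n\<close> into the leading term. Comparing rows with each other, instead of
  inverting the Fisher matrix, keeps every loss a power of the smallest edge variance
  \<open>m\<close>: each use of stability multiplies the right-hand side by a constant times 1/(n
  m^2). Two uses must leave an error below n^(-1/2), and this fixes the powers of n chosen in the
  final proof. The matrix \<open>S\<close> varies with n and need not converge, even after
  rescaling. All estimates are therefore made at fixed n and depend on the direction
  \<open>s\<close> only through the quadratic form of \<open>S\<close>, which for a whitened
  direction equals |t|^2 for every n. Since \<open>ksqrt\<close> and \<open>kinv\<close> are
  definite descriptions, a root and its inverse have to be exhibited and shown unique; a binomial
  series does the former without spectral theory.\<close>

lemma logistic_has_derivative:
  "(logistic has_real_derivative u_fun x) (at x)"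
proof -
  have p: "1 + exp x \<noteq> 0" by (smt (verit) exp_gt_zero)
  show ?thesis
    unfolding logistic_def[abs_def] u_fun_def using p
    by (auto intro!: derivative_eq_intros simp: power2_eq_square algebra_simps)
qed

lemma u_fun_alt: "u_fun x = logistic x * (1 - logistic x)"
proof -
  have p: "1 + exp x \<noteq> 0" by (smt (verit) exp_gt_zero)
  then show ?thesis
    by (simp add: u_fun_def logistic_def power2_eq_square divide_simps) 
qed

lemma logistic_bounds: "0 < logistic x" "logistic x < 1"
  by (auto simp: logistic_def divide_simps add_pos_pos)

lemma u_fun_pos: "0 < u_fun x"
  using logistic_bounds[of x] by (simp add: u_fun_alt)

lemma u_fun_le: "u_fun x \<le> 1/4"
proof -
  have "0 \<le> (logistic x - 1/2)^2" by simp
  then show ?thesis by (simp add: u_fun_alt power2_eq_square algebra_simps)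
qed

text \<open>Since 1 / \<open>u_fun x\<close> is 2 + e^x + e^(-x), it is at most 4 e^|x|. This is how
  a bound on the log-odds becomes the floor \<open>m\<close> on the edge variances.\<close>

lemma u_fun_ge: "exp (- \<bar>x\<bar>) / 4 \<le> u_fun x"
proof -
  have 1: "u_fun x = 1 / ((1 + exp x) * (1 + exp (- x)))"
    by (simp add: u_fun_def power2_eq_square exp_minus divide_simps add_pos_pos)
  have "(1 + exp x) * (1 + exp (- x)) = 2 + exp x + exp (- x)"
    by (simp add: algebra_simps exp_minus)
  also have "\<dots> \<le> 4 * exp \<bar>x\<bar>"
  proof -
    have "exp x \<le> exp \<bar>x\<bar>" "exp (- x) \<le> exp \<bar>x\<bar>" "1 \<le> exp \<bar>x\<bar>" by auto
    then show ?thesis by linarith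
  qed
  finally have "1 / (4 * exp \<bar>x\<bar>) \<le> 1 / ((1 + exp x) * (1 + exp (- x)))"
    by (intro divide_left_mono) (auto simp: add_pos_pos)
  then show ?thesis unfolding 1 by (simp add: exp_minus field_simps)
qed

text \<open>Allowing \<open>z\<close> of either sign lets a nonlinear score difference be read as an
  exactly linear one with weights \<open>u_fun \<xi>\<close>, to which the linear stability theory
  applies.\<close>

lemma logistic_mean_value:
  "\<exists>\<xi>. \<bar>\<xi> - c\<bar> \<le> \<bar>z\<bar> \<and> logistic (c + z) - logistic c = u_fun \<xi> * z"
proof (cases "z = 0")
  case True
  then show ?thesis by auto
next
  case False
  let ?a = "min c (c + z)" and ?b = "max c (c + z)"
  have "?a < ?b" using False by auto
  then obtain \<xi> where \<xi>: "\<xi> > ?a" "\<xi> < ?b"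
      "logistic ?b - logistic ?a = (?b - ?a) * u_fun \<xi>"
    using MVT2[of ?a ?b logistic u_fun] logistic_has_derivative by blast
  show ?thesis
  proof (intro exI[of _ \<xi>] conjI)
    show "\<bar>\<xi> - c\<bar> \<le> \<bar>z\<bar>" using \<xi>(1,2) by auto
    show "logistic (c + z) - logistic c = u_fun \<xi> * z"
    proof (cases "z > 0")
      case True
      then have "?a = c" "?b = c + z" by auto
      then show ?thesis using \<xi>(3) by (simp add: mult.commute)
    next
      case F: False
      then have "?a = c + z" "?b = c" using False by auto
      then show ?thesis using \<xi>(3) by (simp add: algebra_simps)
    qed
  qed
qed

lemma u_fun_lipschitz: "\<bar>u_fun x - u_fun y\<bar> \<le> \<bar>x - y\<bar>"
proof -
  have L: "\<bar>logistic x - logistic y\<bar> \<le> \<bar>x - y\<bar> / 4"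
  proof -
    obtain \<xi> where "logistic (y + (x - y)) - logistic y = u_fun \<xi> * (x - y)"
      using logistic_mean_value by blast
    then show ?thesis
      using u_fun_le[of \<xi>] u_fun_pos[of \<xi>] mult_right_mono[of "u_fun \<xi>" "1/4" "\<bar>x-y\<bar>"]
      by (simp add: abs_mult)
  qed
  have "u_fun x - u_fun y = (logistic x - logistic y) * (1 - logistic x - logistic y)"
    by (simp add: u_fun_alt algebra_simps)
  moreover have "\<bar>1 - logistic x - logistic y\<bar> \<le> 1"
    using logistic_bounds[of x] logistic_bounds[of y] by auto
  ultimately have "\<bar>u_fun x - u_fun y\<bar> \<le> \<bar>logistic x - logistic y\<bar> * 1"
    by (simp only: abs_mult) (intro mult_left_mono, auto)
  also have "\<dots> \<le> \<bar>x - y\<bar> / 4" using L by simp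
  finally have "\<bar>u_fun x - u_fun y\<bar> \<le> \<bar>x - y\<bar> / 4" .
  moreover have "a \<le> b" if "a \<le> b / 4" "0 \<le> b" for a b :: real using that by linarith
  ultimately show ?thesis by (metis abs_ge_zero)
qed

lemma logistic_second_order:
  "\<bar>logistic (c + z) - logistic c - u_fun c * z\<bar> \<le> z^2"
proof -
  obtain \<xi> where \<xi>: "\<bar>\<xi> - c\<bar> \<le> \<bar>z\<bar>" "logistic (c + z) - logistic c = u_fun \<xi> * z"
    using logistic_mean_value by blast
  have "\<bar>logistic (c + z) - logistic c - u_fun c * z\<bar> = \<bar>u_fun \<xi> - u_fun c\<bar> * \<bar>z\<bar>"
    unfolding \<xi>(2) abs_mult[symmetric] by (simp add: algebra_simps)
  also have "\<dots> \<le> \<bar>z\<bar> * \<bar>z\<bar>"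
    using u_fun_lipschitz[of \<xi> c] \<xi>(1) by (intro mult_right_mono) auto
  finally show ?thesis by (simp add: power2_eq_square)
qed

section \<open>Contraction of oscillations by weighted averaging\<close>

lemma row_oscillation:
  fixes w :: "nat \<Rightarrow> nat \<Rightarrow> real" and x y :: "nat \<Rightarrow> real"
  assumes n: "n \<ge> 3" and m: "0 < m" and G: "0 \<le> G"
    and w: "\<And>i j. i \<in> {1..n} \<Longrightarrow> j \<in> {1..n} \<Longrightarrow> i \<noteq> j \<Longrightarrow> m \<le> w i j \<and> w i j \<le> 1/4"
    and row: "\<And>i. i \<in> {1..n} \<Longrightarrow> \<bar>\<Sum>j\<in>{1..n} - {i}. w i j * (x i + y j)\<bar> \<le> G"
    and y: "\<And>j. j \<in> {1..n} \<Longrightarrow> c \<le> - y j \<and> - y j \<le> d"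
    and i: "i \<in> {1..n}"
  shows "x i \<le> d + G / ((real n - 1) * m) - 4 * m / (real n - 1) * (\<Sum>j\<in>{1..n} - {i}. d + y j)"
proof -
  let ?J = "{1..n} - {i}"
  define W where "W = (\<Sum>j\<in>?J. w i j)"
  have card: "real (card ?J) = real n - 1" using i by (simp add: of_nat_diff)
  have W1: "(real n - 1) * m \<le> W"
    unfolding W_def card[symmetric] using w[OF i] by (intro sum_bounded_below) auto
  have W2: "W \<le> (real n - 1) * (1/4)"
    unfolding W_def card[symmetric] using w[OF i] by (intro sum_bounded_above) auto
  have n1: "real n - 1 > 0" using n by simp
  have Wpos: "W > 0" using W1 m n1 by (smt (verit) mult_pos_pos)
  have D: "0 \<le> (\<Sum>j\<in>?J. d + y j)" using y by (intro sum_nonneg) (smt (verit) DiffE)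
  \<comment> \<open>Up to the error \<open>G / W\<close>, \<open>x i\<close> is the weighted mean of
    the values \<open>- y j\<close>. Measured from the top value \<open>d\<close>, each shortfall
    \<open>d + y j\<close> counts with weight at least \<open>m\<close> against a total weight of at
    most (n - 1)/4.\<close>
  have "(\<Sum>j\<in>?J. w i j * (x i + y j)) = W * (x i - d) + (\<Sum>j\<in>?J. w i j * (d + y j))"
    unfolding W_def sum_distrib_right sum.distrib[symmetric] by (intro sum.cong) (auto simp: algebra_simps)
  moreover have "(\<Sum>j\<in>?J. w i j * (d + y j)) \<ge> (\<Sum>j\<in>?J. m * (d + y j))"
    using w[OF i] y by (intro sum_mono mult_right_mono) (auto, smt (verit) atLeastAtMost_iff)
  ultimately have "W * (x i - d) \<le> G - m * (\<Sum>j\<in>?J. d + y j)"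
    using row[OF i] by (simp add: sum_distrib_left)
  then have "x i - d \<le> (G - m * (\<Sum>j\<in>?J. d + y j)) / W"
    using Wpos by (simp add: field_simps)
  also have "\<dots> = G / W - m * (\<Sum>j\<in>?J. d + y j) / W" by (simp add: diff_divide_distrib)
  also have "\<dots> \<le> G / ((real n - 1) * m) - m * (\<Sum>j\<in>?J. d + y j) / ((real n - 1) * (1/4))"
    using W1 W2 Wpos G D m n1 by (intro diff_mono divide_left_mono mult_nonneg_nonneg) auto
  finally show ?thesis by (simp add: field_simps)
qed

text \<open>Two rows share at least n - 2 columns. At a shared column the shortfall
  \<open>d + y j\<close> below the top, used for row \<open>i\<close>, and the excess
  \<open>- c - y j\<close> above the bottom, used for row \<open>i'\<close>, add up to
  \<open>d - c\<close>, so the two means cannot both be extreme. This is a Doeblin-type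
  contraction.\<close>

lemma row_oscillation_diff:
  fixes w :: "nat \<Rightarrow> nat \<Rightarrow> real" and x y :: "nat \<Rightarrow> real"
  assumes n: "n \<ge> 3" and m: "0 < m" and G: "0 \<le> G"
    and w: "\<And>i j. i \<in> {1..n} \<Longrightarrow> j \<in> {1..n} \<Longrightarrow> i \<noteq> j \<Longrightarrow> m \<le> w i j \<and> w i j \<le> 1/4"
    and row: "\<And>i. i \<in> {1..n} \<Longrightarrow> \<bar>\<Sum>j\<in>{1..n} - {i}. w i j * (x i + y j)\<bar> \<le> G"
    and y: "\<And>j. j \<in> {1..n} \<Longrightarrow> c \<le> - y j \<and> - y j \<le> d"
    and i: "i \<in> {1..n}" "i' \<in> {1..n}"
  shows "x i - x i' \<le> (1 - 2 * m) * (d - c) + 2 * G / ((real n - 1) * m)"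
proof -
  have n1: "real n - 1 > 0" using n by simp
  have cd: "c \<le> d" using y[OF i(1)] by auto
  have A: "x i \<le> d + G / ((real n - 1) * m) - 4 * m / (real n - 1) * (\<Sum>j\<in>{1..n} - {i}. d + y j)"
    using row_oscillation[OF n m G w row y i(1)] by auto
  \<comment> \<open>Changing the sign of both \<open>x\<close> and \<open>y\<close> preserves the
    system and turns the upper bound into a lower one.\<close>
  have row': "\<bar>\<Sum>j\<in>{1..n} - {i}. w i j * (- x i + - y j)\<bar> \<le> G" if "i \<in> {1..n}" for i
  proof -
    have "(\<Sum>j\<in>{1..n} - {i}. w i j * (- x i + - y j)) = - (\<Sum>j\<in>{1..n} - {i}. w i j * (x i + y j))"
      by (simp add: sum_negf[symmetric] algebra_simps)
    then show ?thesis using row[OF that] by simp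
  qed
  have y': "- d \<le> - (- y j) \<and> - (- y j) \<le> - c" if "j \<in> {1..n}" for j
    using y[OF that] by auto
  have B: "- x i' \<le> - c + G / ((real n - 1) * m) - 4 * m / (real n - 1) * (\<Sum>j\<in>{1..n} - {i'}. - c + - y j)"
    using row_oscillation[where x="\<lambda>i. - x i" and y="\<lambda>j. - y j" and c="-d" and d="-c", OF n m G w row' y' i(2)]
    by auto
  let ?K = "{1..n} - {i, i'}"
  have "(real n - 2) * (d - c) \<le> (\<Sum>j\<in>?K. d - c)"
  proof -
    have "real n - 2 \<le> real (card ?K)"
      using i by (cases "i = i'") (auto simp: card_Diff_subset)
    then show ?thesis using cd by (simp add: mult_right_mono)
  qed
  also have "\<dots> = (\<Sum>j\<in>?K. d + y j) + (\<Sum>j\<in>?K. - c + - y j)"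
    by (simp add: sum.distrib[symmetric])
  also have "\<dots> \<le> (\<Sum>j\<in>{1..n} - {i}. d + y j) + (\<Sum>j\<in>{1..n} - {i'}. - c + - y j)"
    using y by (intro add_mono sum_mono2) (auto, (smt (verit) atLeastAtMost_iff)+)
  finally have "4 * m / (real n - 1) * ((real n - 2) * (d - c)) \<le>
      4 * m / (real n - 1) * ((\<Sum>j\<in>{1..n} - {i}. d + y j) + (\<Sum>j\<in>{1..n} - {i'}. - c + - y j))"
    using m n1 by (intro mult_left_mono) auto
  moreover have "2 * m * (d - c) \<le> 4 * m / (real n - 1) * ((real n - 2) * (d - c))"
  proof -
    \<comment> \<open>Equality holds at n = 3; this turns the rate 4m(n - 2)/(n - 1) into
      2m.\<close>
    have "1/2 \<le> (real n - 2) / (real n - 1)" using n by (simp add: field_simps)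
    then have "4 * m * (d - c) * (1/2) \<le> 4 * m * (d - c) * ((real n - 2) / (real n - 1))"
      using m cd by (intro mult_left_mono) auto
    also have "\<dots> = 4 * m / (real n - 1) * ((real n - 2) * (d - c))" by simp
    finally show ?thesis by simp
  qed
  moreover have "2 * G / ((real n - 1) * m) = G / ((real n - 1) * m) + G / ((real n - 1) * m)" by simp
  then have "x i - x i' \<le> d - c + 2 * G / ((real n - 1) * m)
      - 4 * m / (real n - 1) * ((\<Sum>j\<in>{1..n} - {i}. d + y j) + (\<Sum>j\<in>{1..n} - {i'}. - c + - y j))"
    using A B unfolding distrib_left by linarith
  ultimately show ?thesis by (simp add: algebra_simps)
qed

text \<open>The oscillations of \<open>x\<close> and of \<open>- y\<close> are each at most 1 - 2m
  times the other plus 2\<epsilon>, so the larger one is at most \<epsilon> / m. Every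
  \<open>x i\<close> lies within \<epsilon> of the range of \<open>- y\<close>, which bounds all
  sums \<open>x i + y j\<close>, including those with i = j that occur in no equation.\<close>

lemma bipartite_stability:
  fixes w :: "nat \<Rightarrow> nat \<Rightarrow> real" and x y :: "nat \<Rightarrow> real"
  assumes n: "n \<ge> 3" and m: "0 < m" and G: "0 \<le> G"
    and w: "\<And>i j. i \<in> {1..n} \<Longrightarrow> j \<in> {1..n} \<Longrightarrow> i \<noteq> j \<Longrightarrow> m \<le> w i j \<and> w i j \<le> 1/4"
    and row: "\<And>i. i \<in> {1..n} \<Longrightarrow> \<bar>\<Sum>j\<in>{1..n} - {i}. w i j * (x i + y j)\<bar> \<le> G"
    and col: "\<And>j. j \<in> {1..n} \<Longrightarrow> \<bar>\<Sum>i\<in>{1..n} - {j}. w i j * (x i + y j)\<bar> \<le> G"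
    and i: "i \<in> {1..n}" and j: "j \<in> {1..n}"
  shows "\<bar>x i + y j\<bar> \<le> 2 * G / ((real n - 1) * m^2)"
proof -
  have n1: "real n - 1 > 0" using n by simp
  have ne: "{1..n} \<noteq> {}" using n by auto
  define a where "a = Min (x ` {1..n})"
  define b where "b = Max (x ` {1..n})"
  define c where "c = Min ((\<lambda>j. - y j) ` {1..n})"
  define d where "d = Max ((\<lambda>j. - y j) ` {1..n})"
  have x: "a \<le> x i \<and> x i \<le> b" if "i \<in> {1..n}" for i
    using that by (auto simp: a_def b_def)
  have y: "c \<le> - y j \<and> - y j \<le> d" if "j \<in> {1..n}" for j
    using that by (auto simp: c_def d_def)
  have "a \<in> x ` {1..n}" "b \<in> x ` {1..n}" using ne by (auto simp: a_def b_def simp del: image_is_empty intro!: Min_in Max_in)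
  then obtain ia ib where ia: "ia \<in> {1..n}" "a = x ia" and ib: "ib \<in> {1..n}" "b = x ib" by auto
  have "c \<in> (\<lambda>j. - y j) ` {1..n}" "d \<in> (\<lambda>j. - y j) ` {1..n}" using ne
    by (auto simp: c_def d_def simp del: image_is_empty intro!: Min_in Max_in)
  then obtain jc jd where jc: "jc \<in> {1..n}" "c = - y jc" and jd: "jd \<in> {1..n}" "d = - y jd" by auto
  define \<epsilon> where "\<epsilon> = G / ((real n - 1) * m)"
  have e0: "0 \<le> \<epsilon>" using G m n1 by (simp add: \<epsilon>_def)
  have X: "b - a \<le> (1 - 2 * m) * (d - c) + 2 * \<epsilon>"
    unfolding ia ib \<epsilon>_def
    using row_oscillation_diff[OF n m G w row y ib(1) ia(1)] by auto
  have col': "\<bar>\<Sum>i\<in>{1..n} - {j}. w i j * (y j + x i)\<bar> \<le> G" if "j \<in> {1..n}" for j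
    using col[OF that] by (simp add: add.commute)
  \<comment> \<open>The columns are the rows of the transposed weights, with \<open>- x\<close>
    ranging over [-b, -a].\<close>
  have Y: "d - c \<le> (1 - 2 * m) * (b - a) + 2 * \<epsilon>"
    using row_oscillation_diff[where w="\<lambda>i j. w j i" and x=y and y=x and c="-b" and d="-a",
      OF n m G _ col' _ jc(1) jd(1)] w x unfolding jc jd \<epsilon>_def by auto
  have m4: "m \<le> 1/4" using w[of 1 2] n by auto
  have ab: "a \<le> b" "c \<le> d" using x[OF i] y[OF j] by auto
  have osc: "d - c \<le> \<epsilon> / m"
  proof (cases "b - a \<le> d - c")
    case True
    then have "(1 - 2*m) * (b - a) \<le> (1 - 2*m) * (d - c)" using m4 by (intro mult_left_mono) auto
    then have "2 * m * (d - c) \<le> 2 * \<epsilon>" using Y by (simp add: algebra_simps)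
    then show ?thesis using m by (simp add: field_simps)
  next
    case False
    then have "(1 - 2*m) * (d - c) \<le> (1 - 2*m) * (b - a)" using m4 by (intro mult_left_mono) auto
    then have "2 * m * (b - a) \<le> 2 * \<epsilon>" using X by (simp add: algebra_simps)
    then have "b - a \<le> \<epsilon> / m" using m by (simp add: field_simps)
    then show ?thesis using False by simp
  qed
  have em: "\<epsilon> \<le> \<epsilon> / m"
    using e0 m m4 by (simp add: le_divide_eq mult_left_le)
  have up: "x i \<le> d + \<epsilon>"
  proof -
    have "0 \<le> 4 * m / (real n - 1) * (\<Sum>j\<in>{1..n} - {i}. d + y j)"
      using y m n1 by (intro mult_nonneg_nonneg sum_nonneg) (auto, smt (verit) atLeastAtMost_iff)
    then show ?thesis
      using row_oscillation[OF n m G w row y i] unfolding \<epsilon>_def by simp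
  qed
  have row': "\<bar>\<Sum>j\<in>{1..n} - {i}. w i j * (- x i + - y j)\<bar> \<le> G" if "i \<in> {1..n}" for i
  proof -
    have "(\<Sum>j\<in>{1..n} - {i}. w i j * (- x i + - y j)) = - (\<Sum>j\<in>{1..n} - {i}. w i j * (x i + y j))"
      by (simp add: sum_negf[symmetric] algebra_simps)
    then show ?thesis using row[OF that] by simp
  qed
  have y': "- d \<le> - (- y j) \<and> - (- y j) \<le> - c" if "j \<in> {1..n}" for j
    using y[OF that] by auto
  have lo: "- x i \<le> - c + \<epsilon>"
  proof -
    have "0 \<le> 4 * m / (real n - 1) * (\<Sum>j\<in>{1..n} - {i}. - c + - y j)"
      using y m n1 by (intro mult_nonneg_nonneg sum_nonneg) (auto, smt (verit) atLeastAtMost_iff)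
    moreover have "- x i \<le> - c + G / ((real n - 1) * m) - 4 * m / (real n - 1) * (\<Sum>j\<in>{1..n} - {i}. - c + - y j)"
      using row_oscillation[where x="\<lambda>i. - x i" and y="\<lambda>j. - y j" and c="-d" and d="-c", OF n m G w row' y' i]
      by auto
    ultimately show ?thesis unfolding \<epsilon>_def by simp
  qed
  have "\<bar>x i + y j\<bar> \<le> (d - c) + \<epsilon>" using up lo y[OF j] by auto
  also have "\<dots> \<le> 2 * (\<epsilon> / m)" using osc em by simp
  also have "\<dots> = 2 * G / ((real n - 1) * m^2)" by (simp add: \<epsilon>_def power2_eq_square)
  finally show ?thesis .
qed

section \<open>Existence and expansion of the maximum likelihood estimator\<close>

text \<open>The log-likelihood at log-odds \<open>c i j + x i + y j\<close>, up to an additive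
  constant. Written in increments about \<open>c\<close> and with \<open>y n\<close> left free, it
  is symmetric under transposition and retains the gauge symmetry.\<close>

definition edge_loglik ::
  "nat \<Rightarrow> (nat \<Rightarrow> nat \<Rightarrow> real) \<Rightarrow> (nat \<Rightarrow> nat \<Rightarrow> real) \<Rightarrow> (nat \<Rightarrow> real) \<Rightarrow> (nat \<Rightarrow> real) \<Rightarrow> real" where
  "edge_loglik n a c x y =
     (\<Sum>i\<in>{1..n}. \<Sum>j\<in>{1..n} - {i}. a i j * (x i + y j) - ln (1 + exp (c i j + x i + y j)))"

lemma sum_offdiag_swap:
  fixes f :: "nat \<Rightarrow> nat \<Rightarrow> real"
  shows "(\<Sum>i\<in>{1..n}. \<Sum>j\<in>{1..n} - {i}. f i j) = (\<Sum>j\<in>{1..n}. \<Sum>i\<in>{1..n} - {j}. f i j)"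
proof -
  have A: "(\<Sum>j\<in>{1..n} - {i}. f i j) = (\<Sum>j\<in>{1..n}. if j \<noteq> i then f i j else 0)" for i
    by (simp add: sum.If_cases Int_def Diff_eq set_eq_iff)
  have B: "(\<Sum>i\<in>{1..n} - {j}. f i j) = (\<Sum>i\<in>{1..n}. if j \<noteq> i then f i j else 0)" for j
    by (rule sum.mono_neutral_cong_left) auto
  show ?thesis unfolding A B by (rule sum.swap)
qed

lemma edge_loglik_transpose:
  "edge_loglik n a c x y = edge_loglik n (\<lambda>i j. a j i) (\<lambda>i j. c j i) y x"
  unfolding edge_loglik_def by (subst sum_offdiag_swap) (simp add: algebra_simps)

lemma edge_loglik_shift:
  "edge_loglik n a c (\<lambda>i. x i + s) (\<lambda>j. y j - s) = edge_loglik n a c x y"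
  by (simp add: edge_loglik_def algebra_simps)

lemma edge_loglik_deriv:
  assumes i: "i \<in> {1..n}"
  shows "((\<lambda>t. edge_loglik n a c (x(i := t)) y) has_real_derivative
            (\<Sum>j\<in>{1..n} - {i}. a i j - logistic (c i j + t + y j))) (at t)"
proof -
  have D: "((\<lambda>t. a i' j * ((x(i := t)) i' + y j) - ln (1 + exp (c i' j + (x(i := t)) i' + y j)))
      has_real_derivative (if i' = i then a i j - logistic (c i j + t + y j) else 0)) (at t)" for i' j
  proof (cases "i' = i")
    case True
    then show ?thesis
      by (auto intro!: derivative_eq_intros simp: logistic_def add_pos_pos)
  next
    case False
    then show ?thesis by simp
  qed
  have "((\<lambda>t. edge_loglik n a c (x(i := t)) y) has_real_derivative
     (\<Sum>i'\<in>{1..n}. \<Sum>j\<in>{1..n} - {i'}. if i' = i then a i j - logistic (c i j + t + y j) else 0)) (at t)"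
    unfolding edge_loglik_def by (intro DERIV_sum D)
  also have "(\<Sum>i'\<in>{1..n}. \<Sum>j\<in>{1..n} - {i'}. if i' = i then a i j - logistic (c i j + t + y j) else 0)
     = (\<Sum>i'\<in>{1..n}. if i' = i then (\<Sum>j\<in>{1..n} - {i}. a i j - logistic (c i j + t + y j)) else 0)"
    by (intro sum.cong) auto
  also have "\<dots> = (\<Sum>j\<in>{1..n} - {i}. a i j - logistic (c i j + t + y j))"
    using i by simp
  finally show ?thesis .
qed

definition sup_box :: "real \<Rightarrow> (nat \<Rightarrow> real) set" where
  "sup_box r = {x. \<forall>i. \<bar>x i\<bar> \<le> r}"

text \<open>Tychonoff on the whole function space. Coordinates outside 1..n do not enter the
  likelihood, but confining them as well makes the box compact, so that a maximiser exists.\<close>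

lemma compact_sup_box: "compact (sup_box r)"
proof -
  have "compactin (product_topology (\<lambda>i::nat. euclidean) UNIV) (PiE UNIV (\<lambda>_. {-r..r}))"
    unfolding compactin_PiE by (auto simp: compactin_euclidean_iff)
  moreover have "PiE UNIV (\<lambda>_::nat. {-r..r}) = sup_box r"
    by (fastforce simp: sup_box_def PiE_UNIV_domain abs_le_iff Pi_iff minus_le_iff)
  ultimately show ?thesis by (simp add: euclidean_product_topology compactin_euclidean_iff)
qed

lemma edge_loglik_continuous:
  "continuous_on UNIV (\<lambda>(x, y). edge_loglik n a c x y)"
proof -
  have pos: "1 + exp z \<noteq> (0::real)" for z :: real by (smt (verit) exp_gt_zero)
  have p: "continuous_on UNIV (\<lambda>p :: (nat \<Rightarrow> real) \<times> (nat \<Rightarrow> real). fst p i)"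
          "continuous_on UNIV (\<lambda>p :: (nat \<Rightarrow> real) \<times> (nat \<Rightarrow> real). snd p i)" for i
    by (rule continuous_on_product_then_coordinatewise, intro continuous_intros)+
  show ?thesis unfolding edge_loglik_def case_prod_beta
    using pos by (intro continuous_intros p) auto
qed

text \<open>At a maximiser over a box, a coordinate stuck at the boundary has a score of the favourable
  sign, so the score equation still holds as an inequality.\<close>

lemma constrained_score:
  assumes max: "\<And>x'. x' \<in> sup_box r \<Longrightarrow> edge_loglik n a c x' y \<le> edge_loglik n a c x y"
    and x: "x \<in> sup_box r" and i: "i \<in> {1..n}"
  shows "x i < r \<Longrightarrow> (\<Sum>j\<in>{1..n} - {i}. a i j) \<le> (\<Sum>j\<in>{1..n} - {i}. logistic (c i j + x i + y j))"
    and "- r < x i \<Longrightarrow> (\<Sum>j\<in>{1..n} - {i}. logistic (c i j + x i + y j)) \<le> (\<Sum>j\<in>{1..n} - {i}. a i j)"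
proof -
  let ?D = "\<Sum>j\<in>{1..n} - {i}. a i j - logistic (c i j + x i + y j)"
  note D = edge_loglik_deriv[OF i, of a c x y "x i"]
  have bx: "\<bar>x l\<bar> \<le> r" for l using x by (auto simp: sup_box_def)
  have box: "x(i := t) \<in> sup_box r" if "\<bar>t\<bar> \<le> r" for t
    using that bx by (auto simp: sup_box_def)
  show "(\<Sum>j\<in>{1..n} - {i}. a i j) \<le> (\<Sum>j\<in>{1..n} - {i}. logistic (c i j + x i + y j))" if "x i < r"
  proof (rule ccontr)
    assume "\<not> ?thesis"
    then have "?D > 0" by (simp add: sum_subtractf)
    from DERIV_pos_inc_right[OF D this] obtain d where d: "d > 0"
      "\<And>h. 0 < h \<Longrightarrow> h < d \<Longrightarrow> edge_loglik n a c (x(i := x i)) y < edge_loglik n a c (x(i := x i + h)) y"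
      by auto
    define h where "h = min (d/2) (r - x i)"
    have h: "0 < h" "h < d" using d(1) that by (auto simp: h_def)
    have "\<bar>x i + h\<bar> \<le> r" using bx[of i] h by (auto simp: h_def min_def split: if_splits)
    then show False using d(2)[OF h] max[OF box] by (simp add: not_le[symmetric])
  qed
  show "(\<Sum>j\<in>{1..n} - {i}. logistic (c i j + x i + y j)) \<le> (\<Sum>j\<in>{1..n} - {i}. a i j)" if "- r < x i"
  proof (rule ccontr)
    assume "\<not> ?thesis"
    then have "?D < 0" by (simp add: sum_subtractf)
    from DERIV_neg_dec_left[OF D this] obtain d where d: "d > 0"
      "\<And>h. 0 < h \<Longrightarrow> h < d \<Longrightarrow> edge_loglik n a c (x(i := x i)) y < edge_loglik n a c (x(i := x i - h)) y"
      by auto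
    define h where "h = min (d/2) (x i + r)"
    have h: "0 < h" "h < d" using d(1) that by (auto simp: h_def)
    have "\<bar>x i - h\<bar> \<le> r" using bx[of i] h by (auto simp: h_def min_def split: if_splits)
    then show False using d(2)[OF h] max[OF box] by (simp add: not_le[symmetric])
  qed
qed

text \<open>At the upper face \<open>x i = r\<close> every \<open>x i + y j\<close> is nonnegative,
  because \<open>y\<close> lies in a box of the same radius; the score difference is then
  nonnegative, and the one-sided inequality caps it by the noise. The lower face is the mirror
  image.\<close>

lemma score_abs_le:
  assumes max: "\<And>x'. x' \<in> sup_box r \<Longrightarrow> edge_loglik n a c x' y \<le> edge_loglik n a c x y"
    and x: "x \<in> sup_box r" and y: "y \<in> sup_box r" and r: "0 < r" and i: "i \<in> {1..n}"
  shows "\<bar>\<Sum>j\<in>{1..n} - {i}. logistic (c i j + x i + y j) - logistic (c i j)\<bar>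
      \<le> \<bar>\<Sum>j\<in>{1..n} - {i}. a i j - logistic (c i j)\<bar>"
proof -
  have mono: "logistic s \<le> logistic t" if "s \<le> t" for s t
  proof -
    obtain \<xi> where "logistic (s + (t - s)) - logistic s = u_fun \<xi> * (t - s)"
      using logistic_mean_value by blast
    then show ?thesis using u_fun_pos[of \<xi>] that by (smt (verit) mult_nonneg_nonneg)
  qed
  have bx: "\<bar>x l\<bar> \<le> r" "\<bar>y l\<bar> \<le> r" for l using x y by (auto simp: sup_box_def)
  note S = constrained_score[OF max x i]
  consider "x i = r" | "x i = - r" | "- r < x i" "x i < r" using bx[of i] by force
  then show ?thesis
  proof cases
    case 1
    have "0 \<le> (\<Sum>j\<in>{1..n} - {i}. logistic (c i j + x i + y j) - logistic (c i j))"
      using bx 1 by (intro sum_nonneg) (smt (verit) mono)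
    moreover have "- r < x i" using 1 r by simp
    ultimately show ?thesis using S(2) by (simp add: sum_subtractf)
  next
    case 2
    have "(\<Sum>j\<in>{1..n} - {i}. logistic (c i j + x i + y j) - logistic (c i j)) \<le> 0"
      using bx 2 by (intro sum_nonpos) (smt (verit) mono)
    moreover have "x i < r" using 2 r by simp
    ultimately show ?thesis using S(1) by (simp add: sum_subtractf)
  next
    case 3
    then show ?thesis using S by (simp add: sum_subtractf)
  qed
qed

text \<open>The mean value form turns the score inequalities into a bipartite linear system with
  weights \<open>u_fun (\<xi> i j)\<close>. The radius 1/2 keeps every \<open>x i + y j\<close>
  within 1, the range on which \<open>m\<close> bounds the weights from below.\<close>

lemma box_maximiser_bound:
  assumes n: "n \<ge> 3" and m: "0 < m" and G: "0 \<le> G"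
    and u: "\<And>i j z. i \<in> {1..n} \<Longrightarrow> j \<in> {1..n} \<Longrightarrow> i \<noteq> j \<Longrightarrow> \<bar>z - c i j\<bar> \<le> 1 \<Longrightarrow> m \<le> u_fun z"
    and row: "\<And>i. i \<in> {1..n} \<Longrightarrow> \<bar>\<Sum>j\<in>{1..n} - {i}. a i j - logistic (c i j)\<bar> \<le> G"
    and col: "\<And>j. j \<in> {1..n} \<Longrightarrow> \<bar>\<Sum>i\<in>{1..n} - {j}. a i j - logistic (c i j)\<bar> \<le> G"
    and x: "x \<in> sup_box (1/2)" and y: "y \<in> sup_box (1/2)"
    and max: "\<And>x' y'. x' \<in> sup_box (1/2) \<Longrightarrow> y' \<in> sup_box (1/2) \<Longrightarrow>
           edge_loglik n a c x' y' \<le> edge_loglik n a c x y"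
    and i: "i \<in> {1..n}" and j: "j \<in> {1..n}"
  shows "\<bar>x i + y j\<bar> \<le> 2 * G / ((real n - 1) * m^2)"
proof -
  have "\<exists>\<xi>. \<bar>\<xi> - c i j\<bar> \<le> \<bar>x i + y j\<bar> \<and>
      logistic (c i j + (x i + y j)) - logistic (c i j) = u_fun \<xi> * (x i + y j)" for i j
    by (rule logistic_mean_value)
  then obtain \<xi> where \<xi>: "\<And>i j. \<bar>\<xi> i j - c i j\<bar> \<le> \<bar>x i + y j\<bar>"
      "\<And>i j. logistic (c i j + (x i + y j)) - logistic (c i j) = u_fun (\<xi> i j) * (x i + y j)"
    by metis
  have small: "\<bar>x i + y j\<bar> \<le> 1" for i j
  proof -
    have "\<bar>x i\<bar> \<le> 1/2" "\<bar>y j\<bar> \<le> 1/2" using x y by (auto simp: sup_box_def)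
    then show ?thesis by linarith
  qed
  have w: "m \<le> u_fun (\<xi> i j) \<and> u_fun (\<xi> i j) \<le> 1/4" if "i \<in> {1..n}" "j \<in> {1..n}" "i \<noteq> j" for i j
    using u[OF that, of "\<xi> i j"] \<xi>(1)[of i j] small[of i j] u_fun_le by auto
  have R: "\<bar>\<Sum>j\<in>{1..n} - {i}. u_fun (\<xi> i j) * (x i + y j)\<bar> \<le> G" if "i \<in> {1..n}" for i
    using score_abs_le[OF max[OF _ y] x y _ that] row[OF that]
    unfolding \<xi>(2)[symmetric] by (simp add: add.assoc)
  have C: "\<bar>\<Sum>i\<in>{1..n} - {j}. u_fun (\<xi> i j) * (x i + y j)\<bar> \<le> G" if "j \<in> {1..n}" for j
  proof -
    have "edge_loglik n (\<lambda>i j. a j i) (\<lambda>i j. c j i) y' x \<le> edge_loglik n (\<lambda>i j. a j i) (\<lambda>i j. c j i) y x"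
      if "y' \<in> sup_box (1/2)" for y'
      using max[OF x that] by (simp only: edge_loglik_transpose[of n a c, symmetric])
    then have "\<bar>\<Sum>i\<in>{1..n} - {j}. logistic (c i j + y j + x i) - logistic (c i j)\<bar>
        \<le> \<bar>\<Sum>i\<in>{1..n} - {j}. a i j - logistic (c i j)\<bar>"
      by (rule score_abs_le[OF _ y x _ that]) auto
    moreover have "u_fun (\<xi> i j) * (x i + y j) = logistic (c i j + y j + x i) - logistic (c i j)" for i
    proof -
      have "c i j + (x i + y j) = c i j + y j + x i" by simp
      then show ?thesis using \<xi>(2)[of i j] by (simp only:)
    qed
    ultimately show ?thesis using col[OF that] by simp
  qed
  show ?thesis
    by (rule bipartite_stability[OF n m G w R C i j])
qed

text \<open>Stability applies to the maximiser before it is known to be interior. The threshold 1/4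
  is half the radius: after the shift \<open>y j\<close> is a difference of two of the bounded sums,
  hence below 1/2, so no coordinate sits on a face and the two one-sided score inequalities combine
  to an equality.\<close>

lemma mle_exists_near:
  assumes n: "n \<ge> 3" and m: "0 < m" and G: "0 \<le> G"
    and u: "\<And>i j z. i \<in> {1..n} \<Longrightarrow> j \<in> {1..n} \<Longrightarrow> i \<noteq> j \<Longrightarrow> \<bar>z - c i j\<bar> \<le> 1 \<Longrightarrow> m \<le> u_fun z"
    and row: "\<And>i. i \<in> {1..n} \<Longrightarrow> \<bar>\<Sum>j\<in>{1..n} - {i}. a i j - logistic (c i j)\<bar> \<le> G"
    and col: "\<And>j. j \<in> {1..n} \<Longrightarrow> \<bar>\<Sum>i\<in>{1..n} - {j}. a i j - logistic (c i j)\<bar> \<le> G"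
    and K: "2 * G / ((real n - 1) * m^2) < 1/4"
  shows "\<exists>x y. y n = 0 \<and>
    (\<forall>i\<in>{1..n}. \<forall>j\<in>{1..n}. \<bar>x i + y j\<bar> \<le> 2 * G / ((real n - 1) * m^2)) \<and>
    (\<forall>i\<in>{1..n}. (\<Sum>j\<in>{1..n} - {i}. logistic (c i j + x i + y j)) = (\<Sum>j\<in>{1..n} - {i}. a i j)) \<and>
    (\<forall>j\<in>{1..n}. (\<Sum>i\<in>{1..n} - {j}. logistic (c i j + x i + y j)) = (\<Sum>i\<in>{1..n} - {j}. a i j))"
proof -
  let ?B = "sup_box (1/2)"
  have cp: "compact (?B \<times> ?B)" by (intro compact_Times compact_sup_box)
  have "(\<lambda>_. 0) \<in> ?B" by (auto simp: sup_box_def)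
  then have ne: "?B \<times> ?B \<noteq> {}" by auto
  obtain p where p: "p \<in> ?B \<times> ?B"
     "\<And>q. q \<in> ?B \<times> ?B \<Longrightarrow> (\<lambda>(x, y). edge_loglik n a c x y) q \<le> (\<lambda>(x, y). edge_loglik n a c x y) p"
    using continuous_attains_sup[OF cp ne continuous_on_subset[OF edge_loglik_continuous[of n a c] subset_UNIV]] by blast
  obtain x0 y0 where p': "p = (x0, y0)" by (cases p)
  have x0: "x0 \<in> ?B" and y0: "y0 \<in> ?B" using p(1) p' by auto
  have max0: "edge_loglik n a c x' y' \<le> edge_loglik n a c x0 y0" if "x' \<in> ?B" "y' \<in> ?B" for x' y'
    using p(2)[of "(x', y')"] that p' by auto
  let ?K = "2 * G / ((real n - 1) * m^2)"
  have b0: "\<bar>x0 i + y0 j\<bar> \<le> ?K" if "i \<in> {1..n}" "j \<in> {1..n}" for i j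
    using box_maximiser_bound[OF n m G u row col x0 y0 max0 that] by auto
  have nn: "n \<in> {1..n}" using n by auto
  text \<open>Shifting along the gauge direction to \<open>y n = 0\<close> moves the maximiser into the interior.\<close>
  define x where "x i = (if i \<in> {1..n} then x0 i + y0 n else 0)" for i
  define y where "y j = (if j \<in> {1..n} then y0 j - y0 n else 0)" for j
  have same: "edge_loglik n a c x y = edge_loglik n a c x0 y0"
    unfolding edge_loglik_shift[of n a c x0 "y0 n" y0, symmetric] edge_loglik_def
    by (intro sum.cong) (auto simp: x_def y_def add.assoc)
  have bx: "\<bar>x i\<bar> \<le> ?K" if "i \<in> {1..n}" for i using b0[OF that nn] that by (simp add: x_def)
  have by': "\<bar>y j\<bar> \<le> 2 * ?K" if "j \<in> {1..n}" for j
    using b0[OF nn nn] b0[OF nn that] that by (simp add: y_def)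
  have K0: "0 \<le> ?K" using bx[OF nn] by linarith
  have x: "x \<in> ?B" unfolding sup_box_def
  proof (intro CollectI allI)
    fix i show "\<bar>x i\<bar> \<le> 1/2"
    proof (cases "i \<in> {1..n}")
      case True then show ?thesis using bx[OF True] K by linarith
    next
      case False then have "x i = 0" unfolding x_def by (rule if_not_P)
      then show ?thesis by simp
    qed
  qed
  have y: "y \<in> ?B" unfolding sup_box_def
  proof (intro CollectI allI)
    fix i show "\<bar>y i\<bar> \<le> 1/2"
    proof (cases "i \<in> {1..n}")
      case True then show ?thesis using by'[OF True] K by linarith
    next
      case False then have "y i = 0" unfolding y_def by (rule if_not_P)
      then show ?thesis by simp
    qed
  qed
  have max: "edge_loglik n a c x' y' \<le> edge_loglik n a c x y" if "x' \<in> ?B" "y' \<in> ?B" for x' y'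
    using max0[OF that] same by simp
  have maxT: "edge_loglik n (\<lambda>i j. a j i) (\<lambda>i j. c j i) y' x \<le> edge_loglik n (\<lambda>i j. a j i) (\<lambda>i j. c j i) y x"
    if "y' \<in> ?B" for y'
    using max[OF x that] by (simp only: edge_loglik_transpose[of n a c, symmetric])
  show ?thesis
  proof (rule exI[of _ x], rule exI[of _ y], intro conjI ballI)
    show "y n = 0" using nn by (simp add: y_def)
    show "\<bar>x i + y j\<bar> \<le> ?K" if "i \<in> {1..n}" "j \<in> {1..n}" for i j
      using b0[OF that] that by (simp add: x_def y_def)
    show "(\<Sum>j\<in>{1..n} - {i}. logistic (c i j + x i + y j)) = (\<Sum>j\<in>{1..n} - {i}. a i j)"
      if i: "i \<in> {1..n}" for i
    proof -
      have "- (1/2) < x i" "x i < 1/2" using bx[OF i] K by linarith+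
      then show ?thesis using constrained_score[OF max[OF _ y] x i] by simp
    qed
    show "(\<Sum>i\<in>{1..n} - {j}. logistic (c i j + x i + y j)) = (\<Sum>i\<in>{1..n} - {j}. a i j)"
      if j: "j \<in> {1..n}" for j
    proof -
      have "- (1/2) < y j" "y j < 1/2" using by'[OF j] K by linarith+
      then show ?thesis using constrained_score[OF maxT y j] by (simp add: ac_simps)
    qed
  qed
qed

section \<open>Uniqueness of the solution and linearisation of the score\<close>

lemma logistic_diff_sign: "(logistic s - logistic t) * (s - t) \<ge> 0"
  and logistic_diff_eq_0: "(logistic s - logistic t) * (s - t) = 0 \<Longrightarrow> s = t"
proof -
  obtain \<xi> where "logistic (t + (s - t)) - logistic t = u_fun \<xi> * (s - t)"
    using logistic_mean_value by blast
  then have E: "(logistic s - logistic t) * (s - t) = u_fun \<xi> * (s - t)^2"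
    by (simp add: power2_eq_square)
  show "(logistic s - logistic t) * (s - t) \<ge> 0"
    unfolding E using u_fun_pos[of \<xi>] by simp
  show "(logistic s - logistic t) * (s - t) = 0 \<Longrightarrow> s = t"
    unfolding E using u_fun_pos[of \<xi>] by simp
qed

text \<open>Strict monotonicity: pairing the vanishing score differences with the parameter
  differences gives a zero sum of nonnegative terms (difference of \<open>logistic\<close> times
  difference of arguments), so the off-diagonal sums agree. The common value at \<open>y n\<close>
  then separates \<open>x\<close> from \<open>y\<close>.\<close>

lemma score_equations_unique:
  fixes n :: nat and x x' y y' :: "nat \<Rightarrow> real"
  assumes n: "n \<ge> 3" and y: "y n = y' n"
    and row: "\<And>i. i \<in> {1..n} \<Longrightarrow> (\<Sum>j\<in>{1..n} - {i}. logistic (x i + y j)) = (\<Sum>j\<in>{1..n} - {i}. logistic (x' i + y' j))"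
    and col: "\<And>j. j \<in> {1..n} \<Longrightarrow> (\<Sum>i\<in>{1..n} - {j}. logistic (x i + y j)) = (\<Sum>i\<in>{1..n} - {j}. logistic (x' i + y' j))"
    and i: "i \<in> {1..n}"
  shows "x i = x' i" "y i = y' i"
proof -
  let ?d = "\<lambda>i j :: nat. logistic (x i + y j) - logistic (x' i + y' j)"
  let ?e = "\<lambda>i j :: nat. ?d i j * ((x i + y j) - (x' i + y' j))"
  have "(\<Sum>i\<in>{1..n}. \<Sum>j\<in>{1..n} - {i}. ?e i j) =
     (\<Sum>i\<in>{1..n}. \<Sum>j\<in>{1..n} - {i}. (x i - x' i) * ?d i j) + (\<Sum>i\<in>{1..n}. \<Sum>j\<in>{1..n} - {i}. (y j - y' j) * ?d i j)"
    by (simp add: sum.distrib[symmetric] algebra_simps)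
  also have "(\<Sum>i\<in>{1..n}. \<Sum>j\<in>{1..n} - {i}. (x i - x' i) * ?d i j) = 0"
    using row by (simp add: sum_distrib_left[symmetric] sum_subtractf)
  also have "(\<Sum>i\<in>{1..n}. \<Sum>j\<in>{1..n} - {i}. (y j - y' j) * ?d i j) =
      (\<Sum>j\<in>{1..n}. \<Sum>i\<in>{1..n} - {j}. (y j - y' j) * ?d i j)"
    using sum_offdiag_swap[of "\<lambda>i j. (y j - y' j) * ?d i j" n] by simp
  also have "\<dots> = 0"
    using col by (simp add: sum_distrib_left[symmetric] sum_subtractf)
  finally have Z: "(\<Sum>i\<in>{1..n}. \<Sum>j\<in>{1..n} - {i}. ?e i j) = 0" by simp
  have eq: "x i + y j = x' i + y' j" if "i \<in> {1..n}" "j \<in> {1..n}" "i \<noteq> j" for i j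
  proof -
    have "(\<Sum>j\<in>{1..n} - {i}. ?e i j) = 0"
      using Z that(1) by (subst (asm) sum_nonneg_eq_0_iff) (auto intro!: sum_nonneg logistic_diff_sign)
    then have "?e i j = 0"
      using that by (subst (asm) sum_nonneg_eq_0_iff) (auto intro!: logistic_diff_sign)
    then show ?thesis by (rule logistic_diff_eq_0)
  qed
  have nn: "n \<in> {1..n}" using n by auto
  have xn: "x i = x' i" if "i \<in> {1..n}" "i \<noteq> n" for i using eq[OF that(1) nn that(2)] y by simp
  have yy: "y j = y' j" if "j \<in> {1..n}" for j
  proof -
    \<comment> \<open>Recovering \<open>y j\<close> needs a row different from both \<open>j\<close>
      and \<open>n\<close>; for n \<ge> 3 one of 1 and 2 qualifies.\<close>
    obtain l where "l \<in> {1..n}" "l \<noteq> n" "l \<noteq> j"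
    proof (cases "j = 1")
      case True then show ?thesis using n that[of 2] by auto
    next
      case False then show ?thesis using n that[of 1] by auto
    qed
    then show ?thesis using eq[of l j] xn[of l] that by simp
  qed
  show "y i = y' i" by (rule yy[OF i])
  show "x i = x' i"
  proof (cases "i = n")
    case False then show ?thesis using xn i by simp
  next
    case True
    then show ?thesis using eq[of i 1] yy[of 1] i n by simp
  qed
qed

text \<open>Subtracting \<open>g i / v i\<close> from \<open>x i\<close> and
  \<open>h j / v' j\<close> from \<open>y j\<close> cancels the noise on the right-hand sides
  exactly, since the weights in row \<open>i\<close> sum to \<open>v i\<close> and those in column
  \<open>j\<close> to \<open>v' j\<close>. What is left in a row or column is a Taylor remainder of
  at most n K^2 and a mixed sum of at most \<open>H\<close>.\<close>

lemma score_linearisation: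
  assumes n: "n \<ge> 3" and m: "0 < m"
    and u: "\<And>i j. i \<in> {1..n} \<Longrightarrow> j \<in> {1..n} \<Longrightarrow> i \<noteq> j \<Longrightarrow> m \<le> u_fun (c i j)"
    and y: "y n = (0::real)"
    and K: "\<And>i j. i \<in> {1..n} \<Longrightarrow> j \<in> {1..n} \<Longrightarrow> \<bar>x i + y j\<bar> \<le> K"
    and row: "\<And>i. i \<in> {1..n} \<Longrightarrow> (\<Sum>j\<in>{1..n} - {i}. logistic (c i j + x i + y j)) = (\<Sum>j\<in>{1..n} - {i}. a i j)"
    and col: "\<And>j. j \<in> {1..n} \<Longrightarrow> (\<Sum>i\<in>{1..n} - {j}. logistic (c i j + x i + y j)) = (\<Sum>i\<in>{1..n} - {j}. a i j)"
    and g: "\<And>i. g i = (\<Sum>j\<in>{1..n} - {i}. a i j - logistic (c i j))"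
    and h: "\<And>j. h j = (\<Sum>i\<in>{1..n} - {j}. a i j - logistic (c i j))"
    and v: "\<And>i. v i = (\<Sum>j\<in>{1..n} - {i}. u_fun (c i j))"
    and v': "\<And>j. v' j = (\<Sum>i\<in>{1..n} - {j}. u_fun (c i j))"
    and Hr: "\<And>i. i \<in> {1..n} \<Longrightarrow> \<bar>\<Sum>j\<in>{1..n} - {i}. u_fun (c i j) * (h j / v' j)\<bar> \<le> H"
    and Hc: "\<And>j. j \<in> {1..n} \<Longrightarrow> \<bar>\<Sum>i\<in>{1..n} - {j}. u_fun (c i j) * (g i / v i)\<bar> \<le> H"
    and i: "i \<in> {1..n}"
  shows "\<bar>x i - (g i / v i + h n / v' n)\<bar> \<le> 2 * (real n * K^2 + H) / ((real n - 1) * m^2)"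
proof -
  have nn: "n \<in> {1..n}" using n by auto
  have H0: "0 \<le> H" using Hr[OF i] by linarith
  define \<rho> where "\<rho> i j = logistic (c i j + (x i + y j)) - logistic (c i j) - u_fun (c i j) * (x i + y j)" for i j
  have \<rho>: "\<bar>\<rho> i j\<bar> \<le> K^2" if "i \<in> {1..n}" "j \<in> {1..n}" for i j
  proof -
    have "\<bar>\<rho> i j\<bar> \<le> (x i + y j)^2" unfolding \<rho>_def by (rule logistic_second_order)
    also have "\<dots> \<le> K^2" using K[OF that] by (rule power2_le_iff_abs_le[THEN iffD2, rotated]) (use K[OF that] in linarith)
    finally show ?thesis .
  qed
  have \<rho>s: "\<bar>\<Sum>j\<in>{1..n} - {i}. f j\<bar> \<le> real n * K^2" if "\<And>j. j \<in> {1..n} \<Longrightarrow> \<bar>f j\<bar> \<le> K^2" for f i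
  proof -
    have "\<bar>\<Sum>j\<in>{1..n} - {i}. f j\<bar> \<le> (\<Sum>j\<in>{1..n} - {i}. K^2)"
      by (rule order_trans[OF sum_abs sum_mono]) (use that in auto)
    also have "\<dots> \<le> (\<Sum>j\<in>{1..n}. K^2)" by (rule sum_mono2) auto
    finally show ?thesis by simp
  qed
  have vpos: "v i > 0" "v' i > 0" if "i \<in> {1..n}" for i
  proof -
    have "(if i = 1 then 2 else 1) \<in> {1..n} - {i}" using n by auto
    then have "{1..n} - {i} \<noteq> {}" by blast
    then show "v i > 0" "v' i > 0" unfolding v v' by (intro sum_pos u_fun_pos; simp)+
  qed
  \<comment> \<open>The opposite shifts by \<open>h n / v' n\<close> cancel in
    \<open>e i + e' j\<close> and make \<open>e' n\<close> vanish; the bound on the sum at column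
    \<open>n\<close> is then a bound on \<open>e i\<close> alone.\<close>
  define e where "e i = x i - g i / v i - h n / v' n" for i
  define e' where "e' j = y j - h j / v' j + h n / v' n" for j
  have R: "\<bar>\<Sum>j\<in>{1..n} - {i}. u_fun (c i j) * (e i + e' j)\<bar> \<le> real n * K^2 + H" if "i \<in> {1..n}" for i
  proof -
    have "(\<Sum>j\<in>{1..n} - {i}. u_fun (c i j) * (e i + e' j)) =
       (\<Sum>j\<in>{1..n} - {i}. (logistic (c i j + x i + y j) - logistic (c i j)) - \<rho> i j
            - u_fun (c i j) * (g i / v i) - u_fun (c i j) * (h j / v' j))"
      by (intro sum.cong) (auto simp: e_def e'_def \<rho>_def algebra_simps)
    also have "\<dots> = g i - (\<Sum>j\<in>{1..n} - {i}. \<rho> i j) - v i * (g i / v i)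
        - (\<Sum>j\<in>{1..n} - {i}. u_fun (c i j) * (h j / v' j))"
      by (simp only: sum_subtractf row[OF that] g v sum_distrib_right)
    also have "v i * (g i / v i) = g i" using vpos[OF that] by simp
    finally show ?thesis using \<rho>s[of "\<rho> i" i] \<rho>[OF that] Hr[OF that] by fastforce
  qed
  have C: "\<bar>\<Sum>i\<in>{1..n} - {j}. u_fun (c i j) * (e i + e' j)\<bar> \<le> real n * K^2 + H" if "j \<in> {1..n}" for j
  proof -
    have "(\<Sum>i\<in>{1..n} - {j}. u_fun (c i j) * (e i + e' j)) =
       (\<Sum>i\<in>{1..n} - {j}. (logistic (c i j + x i + y j) - logistic (c i j)) - \<rho> i j
            - u_fun (c i j) * (h j / v' j) - u_fun (c i j) * (g i / v i))"
      by (intro sum.cong) (auto simp: e_def e'_def \<rho>_def algebra_simps)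
    also have "\<dots> = h j - (\<Sum>i\<in>{1..n} - {j}. \<rho> i j) - v' j * (h j / v' j)
        - (\<Sum>i\<in>{1..n} - {j}. u_fun (c i j) * (g i / v i))"
      by (simp only: sum_subtractf col[OF that] h v' sum_distrib_right)
    also have "v' j * (h j / v' j) = h j" using vpos[OF that] by simp
    finally show ?thesis using \<rho>s[of "\<lambda>i. \<rho> i j" j] \<rho>[OF _ that] Hc[OF that] by fastforce
  qed
  have "\<bar>e i + e' n\<bar> \<le> 2 * (real n * K^2 + H) / ((real n - 1) * m^2)"
    by (rule bipartite_stability[OF n m _ _ R C i nn]) (use u u_fun_le H0 in auto)
  moreover have "e' n = 0" using y by (simp add: e'_def)
  ultimately show ?thesis by (simp add: e_def algebra_simps)
qed

section \<open>From the score equations to the estimator\<close>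

definition log_odds :: "nat \<Rightarrow> (nat \<Rightarrow> real) \<Rightarrow> nat \<Rightarrow> nat \<Rightarrow> real" where
  "log_odds n \<theta> i j = alpha n \<theta> i + beta n \<theta> j"

text \<open>Only n - 1 column equations are imposed. The missing one follows because the row
  equations and the column equations have the same total.\<close>

lemma mle_eqs_iff:
  assumes n: "n \<ge> 1"
  shows "mle_eqs n A \<theta> \<longleftrightarrow>
     (\<forall>i. i \<notin> {1..2*n-1} \<longrightarrow> \<theta> i = 0) \<and>
     (\<forall>i\<in>{1..n}. (\<Sum>j\<in>{1..n} - {i}. logistic (log_odds n \<theta> i j)) = (\<Sum>j\<in>{1..n} - {i}. of_bool (A (i, j)))) \<and>
     (\<forall>j\<in>{1..n}. (\<Sum>i\<in>{1..n} - {j}. logistic (log_odds n \<theta> i j)) = (\<Sum>i\<in>{1..n} - {j}. of_bool (A (i, j))))"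
  (is "_ \<longleftrightarrow> ?Z \<and> (\<forall>i\<in>{1..n}. ?R i) \<and> (\<forall>j\<in>{1..n}. ?C j)")
proof
  assume L: "mle_eqs n A \<theta>"
  then have R: "\<forall>i\<in>{1..n}. ?R i" and C: "\<forall>j\<in>{1..n-1}. ?C j" and Z: ?Z
    by (simp_all add: mle_eqs_def out_deg_def in_deg_def log_odds_def)
  have "?C n"
  proof -
    let ?f = "\<lambda>i j :: nat. logistic (log_odds n \<theta> i j) - of_bool (A (i, j))"
    have "0 = (\<Sum>i\<in>{1..n}. \<Sum>j\<in>{1..n} - {i}. ?f i j)"
      using R by (simp add: sum_subtractf)
    also have "\<dots> = (\<Sum>j\<in>{1..n}. \<Sum>i\<in>{1..n} - {j}. ?f i j)"
      by (rule sum_offdiag_swap)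
    also have "{1..n} = insert n {1..n-1}" using n by auto
    also have "(\<Sum>j\<in>insert n {1..n-1}. \<Sum>i\<in>insert n {1..n-1} - {j}. ?f i j) = (\<Sum>i\<in>{1..n} - {n}. ?f i n)"
    proof (subst sum.insert)
      have e: "insert n {1..n-1} = {1..n}" using n by auto
      show "(\<Sum>i\<in>insert n {1..n-1} - {n}. ?f i n) + (\<Sum>j\<in>{1..n-1}. \<Sum>i\<in>insert n {1..n-1} - {j}. ?f i j) = (\<Sum>i\<in>{1..n} - {n}. ?f i n)"
        unfolding e using C by (simp add: sum_subtractf)
    qed (use n in auto)
    finally show ?thesis by (simp add: sum_subtractf)
  qed
  moreover have "{1..n} = insert n {1..n-1}" using n by auto
  ultimately have "\<forall>j\<in>{1..n}. ?C j" using C by (metis insert_iff)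
  then show "?Z \<and> (\<forall>i\<in>{1..n}. ?R i) \<and> (\<forall>j\<in>{1..n}. ?C j)" using R Z by blast
next
  assume "?Z \<and> (\<forall>i\<in>{1..n}. ?R i) \<and> (\<forall>j\<in>{1..n}. ?C j)"
  then show "mle_eqs n A \<theta>"
    by (auto simp: mle_eqs_def out_deg_def in_deg_def log_odds_def)
qed

text \<open>Uniqueness makes the choice in \<open>mle\<close> harmless; indices outside 1..2n-1
  agree because \<open>mle_eqs\<close> forces the value 0 there.\<close>

lemma mle_eqI:
  assumes n: "n \<ge> 3" and T: "mle_eqs n A T"
  shows "mle n A = T"
proof -
  have uniq: "T' = T" if T': "mle_eqs n A T'" for T'
  proof
    fix l
    have n1: "n \<ge> 1" using n by simp
    note E = T[unfolded mle_eqs_iff[OF n1]] T'[unfolded mle_eqs_iff[OF n1]]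
    have b: "beta n T' n = beta n T n" by (simp add: beta_def)
    have U: "alpha n T' i = alpha n T i" "beta n T' i = beta n T i" if "i \<in> {1..n}" for i
      using score_equations_unique[where x="alpha n T'" and x'="alpha n T" and y="beta n T'" and y'="beta n T", OF n b _ _ that] E
      unfolding log_odds_def by auto
    consider "l \<notin> {1..2*n-1}" | "l \<in> {1..n}" | "l \<in> {n+1..2*n-1}" using n by fastforce
    then show "T' l = T l"
    proof cases
      case 1 then show ?thesis using E by auto
    next
      case 2 then show ?thesis using U(1)[of l] by (simp add: alpha_def)
    next
      case 3
      then have "l - n \<in> {1..n}" "l - n \<noteq> n" "n + (l - n) = l" by auto
      then show ?thesis using U(2)[of "l - n"] by (simp add: beta_def)
    qed
  qed
  have "mle n A = (SOME \<theta>. mle_eqs n A \<theta>)" using T by (auto simp: mle_def)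
  also have "\<dots> = T" using T uniq by (rule some_equality)
  finally show ?thesis .
qed

lemma mle_expansion:
  fixes A :: "nat \<times> nat \<Rightarrow> bool"
  assumes n: "n \<ge> 3" and m: "0 < m" and G: "0 \<le> G"
    and u: "\<And>i j z. i \<in> {1..n} \<Longrightarrow> j \<in> {1..n} \<Longrightarrow> i \<noteq> j \<Longrightarrow> \<bar>z - log_odds n \<theta> i j\<bar> \<le> 1 \<Longrightarrow> m \<le> u_fun z"
    and g: "\<And>i. g i = (\<Sum>j\<in>{1..n} - {i}. of_bool (A (i, j)) - logistic (log_odds n \<theta> i j))"
    and h: "\<And>j. h j = (\<Sum>i\<in>{1..n} - {j}. of_bool (A (i, j)) - logistic (log_odds n \<theta> i j))"
    and v: "\<And>i. v i = (\<Sum>j\<in>{1..n} - {i}. u_fun (log_odds n \<theta> i j))"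
    and v': "\<And>j. v' j = (\<Sum>i\<in>{1..n} - {j}. u_fun (log_odds n \<theta> i j))"
    and row: "\<And>i. i \<in> {1..n} \<Longrightarrow> \<bar>g i\<bar> \<le> G"
    and col: "\<And>j. j \<in> {1..n} \<Longrightarrow> \<bar>h j\<bar> \<le> G"
    and K: "K = 2 * G / ((real n - 1) * m^2)" "K < 1/4"
    and Hr: "\<And>i. i \<in> {1..n} \<Longrightarrow> \<bar>\<Sum>j\<in>{1..n} - {i}. u_fun (log_odds n \<theta> i j) * (h j / v' j)\<bar> \<le> H"
    and Hc: "\<And>j. j \<in> {1..n} \<Longrightarrow> \<bar>\<Sum>i\<in>{1..n} - {j}. u_fun (log_odds n \<theta> i j) * (g i / v i)\<bar> \<le> H"
    and i: "i \<in> {1..n}"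
  shows "\<bar>mle n A i - \<theta> i - (g i / v i + h n / v' n)\<bar> \<le> 2 * (real n * K^2 + H) / ((real n - 1) * m^2)"
proof -
  have ex: "\<exists>x y. y n = 0 \<and>
    (\<forall>i\<in>{1..n}. \<forall>j\<in>{1..n}. \<bar>x i + y j\<bar> \<le> K) \<and>
    (\<forall>i\<in>{1..n}. (\<Sum>j\<in>{1..n} - {i}. logistic (log_odds n \<theta> i j + x i + y j)) = (\<Sum>j\<in>{1..n} - {i}. of_bool (A (i, j)))) \<and>
    (\<forall>j\<in>{1..n}. (\<Sum>i\<in>{1..n} - {j}. logistic (log_odds n \<theta> i j + x i + y j)) = (\<Sum>i\<in>{1..n} - {j}. of_bool (A (i, j))))"
    unfolding K(1)
  proof (rule mle_exists_near[OF n m G])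
    show "m \<le> u_fun z" if "i \<in> {1..n}" "j \<in> {1..n}" "i \<noteq> j" "\<bar>z - log_odds n \<theta> i j\<bar> \<le> 1" for i j z
      by (rule u[OF that])
    show "\<bar>\<Sum>j\<in>{1..n} - {i}. of_bool (A (i, j)) - logistic (log_odds n \<theta> i j)\<bar> \<le> G" if "i \<in> {1..n}" for i
      using row[OF that] unfolding g .
    show "\<bar>\<Sum>i\<in>{1..n} - {j}. of_bool (A (i, j)) - logistic (log_odds n \<theta> i j)\<bar> \<le> G" if "j \<in> {1..n}" for j
      using col[OF that] unfolding h .
    show "2 * G / ((real n - 1) * m\<^sup>2) < 1 / 4" using K by simp
  qed
  obtain y x where xy: "y n = 0"
    "\<And>i j. i \<in> {1..n} \<Longrightarrow> j \<in> {1..n} \<Longrightarrow> \<bar>x i + y j\<bar> \<le> K"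
    "\<And>i. i \<in> {1..n} \<Longrightarrow> (\<Sum>j\<in>{1..n} - {i}. logistic (log_odds n \<theta> i j + x i + y j)) = (\<Sum>j\<in>{1..n} - {i}. of_bool (A (i, j)))"
    "\<And>j. j \<in> {1..n} \<Longrightarrow> (\<Sum>i\<in>{1..n} - {j}. logistic (log_odds n \<theta> i j + x i + y j)) = (\<Sum>i\<in>{1..n} - {j}. of_bool (A (i, j)))"
    using ex by blast
  \<comment> \<open>The increments in packed indexing: the beta increment at \<open>j\<close> is
    stored at index n + j. The one at \<open>n\<close> has no slot, which is consistent because
    \<open>y n = 0\<close>.\<close>
  define T where "T l = (if l \<in> {1..n} then \<theta> l + x l else if l \<in> {n+1..2*n-1} then \<theta> l + y (l - n) else 0)" for l
  have lo: "log_odds n T i j = log_odds n \<theta> i j + x i + y j" if "i \<in> {1..n}" "j \<in> {1..n}" for i j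
  proof -
    have "alpha n T i = alpha n \<theta> i + x i" using that by (simp add: alpha_def T_def)
    moreover have "beta n T j = beta n \<theta> j + y j"
    proof (cases "j = n")
      case True then show ?thesis using xy(1) by (simp add: beta_def)
    next
      case False
      then have "n + j \<notin> {1..n}" "n + j \<in> {n+1..2*n-1}" using that by auto
      then show ?thesis using False by (simp add: beta_def T_def)
    qed
    ultimately show ?thesis by (simp add: log_odds_def)
  qed
  have n1: "n \<ge> 1" using n by simp
  have "mle_eqs n A T"
    unfolding mle_eqs_iff[OF n1]
    using xy(3,4) lo n by (auto simp: T_def)
  then have "mle n A = T" by (rule mle_eqI[OF n])
  then have e: "mle n A i - \<theta> i = x i" using i by (simp add: T_def)
  show ?thesis unfolding e
    by (rule score_linearisation[OF n m _ xy g h v v' Hr Hc i]) (use u in auto)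
qed

section \<open>Inverse square roots of positive definite matrices\<close>

lemma kmatD: "kmat k M \<Longrightarrow> i \<notin> {1..k} \<or> j \<notin> {1..k} \<Longrightarrow> M i j = 0"
  unfolding kmat_def by blast

lemma kmat_kid: "kmat k (kid k)" and kmat_kmul: "kmat k (kmul k A B)"
  by (auto simp: kmat_def kid_def kmul_def)

lemma kmul_assoc: "kmul k (kmul k A B) C = kmul k A (kmul k B C)"
proof (intro ext)
  fix i j
  have "(\<Sum>l\<in>{1..k}. (\<Sum>m\<in>{1..k}. A i m * B m l) * C l j) = (\<Sum>m\<in>{1..k}. A i m * (\<Sum>l\<in>{1..k}. B m l * C l j))"
    unfolding sum_distrib_left sum_distrib_right by (subst sum.swap) (simp add: mult.assoc)
  moreover have "(\<Sum>l\<in>{1..k}. kmul k A B i l * C l j) = (\<Sum>l\<in>{1..k}. (\<Sum>m\<in>{1..k}. A i m * B m l) * C l j)"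
    if "i \<in> {1..k}"
    using that by (intro sum.cong) (auto simp: kmul_def)
  moreover have "(\<Sum>l\<in>{1..k}. A i l * kmul k B C l j) = (\<Sum>m\<in>{1..k}. A i m * (\<Sum>l\<in>{1..k}. B m l * C l j))"
    if "j \<in> {1..k}"
    using that by (intro sum.cong) (auto simp: kmul_def)
  ultimately show "kmul k (kmul k A B) C i j = kmul k A (kmul k B C) i j"
    unfolding kmul_def[of k "kmul k A B"] kmul_def[of k A] by simp
qed

lemma kmul_kid_left: "kmat k A \<Longrightarrow> kmul k (kid k) A = A"
  and kmul_kid_right: "kmat k A \<Longrightarrow> kmul k A (kid k) = A"
proof -
  assume A: "kmat k A"
  show "kmul k (kid k) A = A"
  proof (intro ext)
    fix i j
    have "(\<Sum>l\<in>{1..k}. kid k i l * A l j) = (\<Sum>l\<in>{1..k}. if l = i then A i j else 0)" if "i \<in> {1..k}"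
      using that by (intro sum.cong) (auto simp: kid_def)
    then show "kmul k (kid k) A i j = A i j"
      using kmatD[OF A, of i j] by (auto simp: kmul_def)
  qed
  show "kmul k A (kid k) = A"
  proof (intro ext)
    fix i j
    have "(\<Sum>l\<in>{1..k}. A i l * kid k l j) = (\<Sum>l\<in>{1..k}. if l = j then A i j else 0)" if "j \<in> {1..k}"
      using that by (intro sum.cong) (auto simp: kid_def)
    then show "kmul k A (kid k) i j = A i j"
      using kmatD[OF A, of i j] by (auto simp: kmul_def)
  qed
qed

lemma kmul_transpose: "kmul k A B i j = kmul k (\<lambda>i j. B j i) (\<lambda>i j. A j i) j i"
  by (auto simp: kmul_def mult.commute)

fun kpow :: "nat \<Rightarrow> (nat \<Rightarrow> nat \<Rightarrow> real) \<Rightarrow> nat \<Rightarrow> nat \<Rightarrow> nat \<Rightarrow> real" where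
  "kpow k B 0 = kid k"
| "kpow k B (Suc m) = kmul k B (kpow k B m)"

lemma kmat_kpow: "kmat k (kpow k B m)"
  by (cases m) (auto simp: kmat_kid kmat_kmul)

lemma kpow_add: "kpow k B (m + l) = kmul k (kpow k B m) (kpow k B l)"
  by (induction m) (simp_all add: kmul_kid_left kmat_kpow kmul_assoc)

lemma kpow_Suc_right: "kmat k B \<Longrightarrow> kpow k B (Suc m) = kmul k (kpow k B m) B"
  using kpow_add[of k B m 1] by (simp add: kmul_kid_right)

lemma kpow_sym:
  assumes B: "kmat k B" "\<And>i j. B i j = B j i"
  shows "kpow k B m i j = kpow k B m j i"
proof (induction m arbitrary: i j)
  case 0
  show ?case by (auto simp: kid_def)
next
  case (Suc m)
  have e: "(\<lambda>i j. kpow k B m j i) = kpow k B m" "(\<lambda>i j. B j i) = B"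
    using Suc B(2) by auto
  have "kpow k B (Suc m) i j = kmul k (kpow k B m) B j i"
    unfolding kpow.simps by (subst kmul_transpose) (simp only: e)
  then show ?case using kpow_Suc_right[OF B(1)] by simp
qed

definition kvec :: "nat \<Rightarrow> (nat \<Rightarrow> nat \<Rightarrow> real) \<Rightarrow> (nat \<Rightarrow> real) \<Rightarrow> nat \<Rightarrow> real" where
  "kvec k M x i = (\<Sum>l\<in>{1..k}. M i l * x l)"

definition kdot :: "nat \<Rightarrow> (nat \<Rightarrow> real) \<Rightarrow> (nat \<Rightarrow> real) \<Rightarrow> real" where
  "kdot k x y = (\<Sum>i\<in>{1..k}. x i * y i)"

lemma kdot_commute: "kdot k x y = kdot k y x"
  by (simp add: kdot_def mult.commute)

lemma kdot_diff: "kdot k (\<lambda>i. a * x i - y i) z = a * kdot k x z - kdot k y z"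
  by (simp add: kdot_def sum_distrib_left sum_subtractf algebra_simps)

lemma kvec_diff: "kvec k M (\<lambda>i. a * x i - y i) = (\<lambda>i. a * kvec k M x i - kvec k M y i)"
  by (rule ext) (simp add: kvec_def sum_distrib_left sum_subtractf algebra_simps)

lemma kdot_self_nonneg: "0 \<le> kdot k x x"
  by (simp add: kdot_def sum_nonneg)

lemma kdot_kvec: "kdot k x (kvec k M y) = (\<Sum>i\<in>{1..k}. \<Sum>j\<in>{1..k}. x i * M i j * y j)"
  by (simp add: kdot_def kvec_def sum_distrib_left mult.assoc)

lemma kdot_kvec_transpose:
  "kdot k x (kvec k M y) = kdot k (kvec k (\<lambda>i j. M j i) x) y"
  unfolding kdot_def kvec_def sum_distrib_left sum_distrib_right
  by (subst sum.swap) (simp add: mult_ac)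

lemma kvec_kmul: "i \<in> {1..k} \<Longrightarrow> kvec k (kmul k A B) x i = kvec k A (kvec k B x) i"
proof -
  assume i: "i \<in> {1..k}"
  have "(\<Sum>l\<in>{1..k}. (\<Sum>m\<in>{1..k}. A i m * B m l) * x l) = (\<Sum>m\<in>{1..k}. A i m * (\<Sum>l\<in>{1..k}. B m l * x l))"
    unfolding sum_distrib_left sum_distrib_right by (subst sum.swap) (simp add: mult.assoc)
  moreover have "(\<Sum>l\<in>{1..k}. kmul k A B i l * x l) = (\<Sum>l\<in>{1..k}. (\<Sum>m\<in>{1..k}. A i m * B m l) * x l)"
    using i by (intro sum.cong) (auto simp: kmul_def)
  ultimately show ?thesis by (simp add: kvec_def)
qed

lemma kvec_kid: "i \<in> {1..k} \<Longrightarrow> kvec k (kid k) x i = x i"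
proof -
  assume i: "i \<in> {1..k}"
  have "kvec k (kid k) x i = (\<Sum>l\<in>{1..k}. if l = i then x i else 0)"
    unfolding kvec_def using i by (intro sum.cong) (auto simp: kid_def)
  then show ?thesis using i by simp
qed

text \<open>For 0 \<le> B \<le> q one has B^2 \<le> qB \<le> q^2. Without eigenvalues this follows
  by testing positivity of \<open>B\<close> on the vector q x - B x.\<close>

lemma psd_contraction:
  assumes sym: "\<And>i j. B i j = B j i"
    and psd: "\<And>x. 0 \<le> kdot k x (kvec k B x)"
    and le: "\<And>x. kdot k x (kvec k B x) \<le> q * kdot k x x" and q: "0 < q"
  shows "kdot k (kvec k B x) (kvec k B x) \<le> q^2 * kdot k x x"
proof -
  let ?y = "kvec k B x"
  have T: "(\<lambda>i j. B j i) = B" using sym by auto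
  have xy: "kdot k x (kvec k B ?y) = kdot k ?y ?y"
    by (subst kdot_kvec_transpose) (simp add: T)
  have "0 \<le> kdot k (\<lambda>i. q * x i - ?y i) (kvec k B (\<lambda>i. q * x i - ?y i))" by (rule psd)
  also have "\<dots> = q * (q * kdot k x ?y - kdot k ?y ?y) - (q * kdot k ?y ?y - kdot k ?y (kvec k B ?y))"
    unfolding kdot_diff kvec_diff kdot_commute[of k x "\<lambda>i. _ i - _ i"] kdot_commute[of k ?y "\<lambda>i. _ i - _ i"]
    unfolding kdot_commute[of k "kvec k B ?y" x] xy
    by (simp add: kdot_commute)
  finally have "q * kdot k ?y ?y \<le> q * (q * kdot k x ?y)"
    using le[of ?y] by (simp add: algebra_simps)
  then have "kdot k ?y ?y \<le> q * kdot k x ?y" using q by simp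
  also have "\<dots> \<le> q * (q * kdot k x x)" using q le[of x] by simp
  finally show ?thesis by (simp add: power2_eq_square mult.assoc)
qed

text \<open>Column \<open>j\<close> of the m-th power is \<open>B\<close> applied m times to a unit
  vector, so its Euclidean norm is at most q^m.\<close>

lemma kpow_entry_le:
  assumes "\<And>x. kdot k (kvec k B x) (kvec k B x) \<le> q^2 * kdot k x x" and q: "0 < q"
  shows "\<bar>kpow k B m i j\<bar> \<le> q ^ m"
proof (cases "i \<in> {1..k} \<and> j \<in> {1..k}")
  case False
  then show ?thesis using kmatD[OF kmat_kpow, of i k j B m] q by auto
next
  case True
  have "kdot k (\<lambda>i. kpow k B m i j) (\<lambda>i. kpow k B m i j) \<le> (q^m)^2"
  proof (induction m)
    case 0
    have "kdot k (\<lambda>i. kid k i j) (\<lambda>i. kid k i j) = (\<Sum>i\<in>{1..k}. if i = j then 1 else 0)"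
      unfolding kdot_def by (intro sum.cong) (auto simp: kid_def)
    then show ?case using True by simp
  next
    case (Suc m)
    have "kdot k (\<lambda>i. kpow k B (Suc m) i j) (\<lambda>i. kpow k B (Suc m) i j)
        = kdot k (kvec k B (\<lambda>i. kpow k B m i j)) (kvec k B (\<lambda>i. kpow k B m i j))"
      unfolding kdot_def using True by (intro sum.cong) (auto simp: kvec_def kmul_def)
    also have "\<dots> \<le> q^2 * (q^m)^2"
      by (rule order_trans[OF assms(1) mult_left_mono[OF Suc]]) simp
    finally show ?case by (simp add: power_mult_distrib)
  qed
  moreover have "(kpow k B m i j)^2 \<le> kdot k (\<lambda>i. kpow k B m i j) (\<lambda>i. kpow k B m i j)"
    unfolding kdot_def power2_eq_square using True
    by (intro member_le_sum[of i "{1..k}" "\<lambda>i. kpow k B m i j * kpow k B m i j"]) auto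
  ultimately have "(kpow k B m i j)^2 \<le> (q^m)^2" by linarith
  then show ?thesis using q by (simp add: abs_le_square_iff[symmetric])
qed

text \<open>The matrix \<open>(1 - B)\<^sup>\<alpha>\<close> as a binomial series.\<close>

definition kbinom :: "nat \<Rightarrow> (nat \<Rightarrow> nat \<Rightarrow> real) \<Rightarrow> real \<Rightarrow> nat \<Rightarrow> nat \<Rightarrow> real" where
  "kbinom k B \<alpha> i j = (\<Sum>m. (\<alpha> gchoose m) * (-1)^m * kpow k B m i j)"

lemma kbinom_summable:
  assumes P: "\<And>m i j. \<bar>kpow k B m i j\<bar> \<le> q ^ m" and q: "0 < q" "q < 1"
  shows "summable (\<lambda>m. norm ((\<alpha> gchoose m) * (-1)^m * kpow k B m i j))"
proof (rule summable_comparison_test'[where N=0])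
  \<comment> \<open>A point strictly between q and 1: convergence there gives absolute convergence
    at q.\<close>
  have "summable (\<lambda>m. (\<alpha> gchoose m) * ((1 + q)/2)^m)"
    using gen_binomial_real[of "(1+q)/2" \<alpha>] q by (auto simp: sums_iff)
  then show "summable (\<lambda>m. norm ((\<alpha> gchoose m) * q^m))"
    by (rule powser_insidea) (use q in auto)
  show "norm (norm ((\<alpha> gchoose m) * (-1)^m * kpow k B m i j)) \<le> norm ((\<alpha> gchoose m) * q^m)" for m
    using P[of m i j] q by (auto simp: abs_mult power_abs intro!: mult_left_mono)
qed

text \<open>The Cauchy product collects the powers of \<open>B\<close>, and Vandermonde's identity
  sums their coefficients. Roots and inverses of 1 - B all come from this one identity.\<close>

lemma kbinom_mult:
  assumes P: "\<And>m i j. \<bar>kpow k B m i j\<bar> \<le> q ^ m" and q: "0 < q" "q < 1"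
  shows "kmul k (kbinom k B \<alpha>) (kbinom k B \<beta>) = kbinom k B (\<alpha> + \<beta>)"
proof (intro ext)
  fix i j
  note S = kbinom_summable[OF P q]
  show "kmul k (kbinom k B \<alpha>) (kbinom k B \<beta>) i j = kbinom k B (\<alpha> + \<beta>) i j"
  proof (cases "i \<in> {1..k} \<and> j \<in> {1..k}")
    case False
    then show ?thesis using kmatD[OF kmat_kpow, of i k j B] by (auto simp: kmul_def kbinom_def)
  next
    case True
    let ?a = "\<lambda>l m. (\<alpha> gchoose m) * (-1)^m * kpow k B m i l"
    let ?b = "\<lambda>l m. (\<beta> gchoose m) * (-1)^m * kpow k B m l j"
    have "kmul k (kbinom k B \<alpha>) (kbinom k B \<beta>) i j = (\<Sum>l\<in>{1..k}. (\<Sum>m. ?a l m) * (\<Sum>m. ?b l m))"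
      using True by (simp add: kmul_def kbinom_def)
    also have "\<dots> = (\<Sum>l\<in>{1..k}. \<Sum>s. \<Sum>m\<le>s. ?a l m * ?b l (s - m))"
      by (intro sum.cong refl Cauchy_product S)
    also have "\<dots> = (\<Sum>s. \<Sum>l\<in>{1..k}. \<Sum>m\<le>s. ?a l m * ?b l (s - m))"
      by (intro suminf_sum[symmetric] summable_Cauchy_product S)
    also have "\<dots> = (\<Sum>s. ((\<alpha> + \<beta>) gchoose s) * (-1)^s * kpow k B s i j)"
    proof (intro suminf_cong)
      fix s
      have "(\<Sum>l\<in>{1..k}. \<Sum>m\<le>s. ?a l m * ?b l (s - m)) =
          (\<Sum>m\<le>s. (\<alpha> gchoose m) * (\<beta> gchoose (s - m)) * (-1)^s * (\<Sum>l\<in>{1..k}. kpow k B m i l * kpow k B (s - m) l j))"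
        by (subst sum.swap) (auto simp: sum_distrib_left power_add[symmetric] mult_ac intro!: sum.cong)
      also have "\<dots> = (\<Sum>m\<le>s. (\<alpha> gchoose m) * (\<beta> gchoose (s - m)) * (-1)^s * kpow k B s i j)"
      proof (intro sum.cong refl arg_cong2[where f="(*)"])
        fix m assume "m \<in> {..s}"
        then show "(\<Sum>l\<in>{1..k}. kpow k B m i l * kpow k B (s - m) l j) = kpow k B s i j"
          using kpow_add[of k B m "s - m"] True by (simp add: kmul_def)
      qed
      also have "\<dots> = (\<Sum>m\<le>s. (\<alpha> gchoose m) * (\<beta> gchoose (s - m))) * (-1)^s * kpow k B s i j"
        by (simp add: sum_distrib_right)
      also have "(\<Sum>m\<le>s. (\<alpha> gchoose m) * (\<beta> gchoose (s - m))) = (\<alpha> + \<beta>) gchoose s"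
        using gbinomial_Vandermonde[of \<alpha> \<beta> s] by (simp add: atLeast0AtMost)
      finally show "(\<Sum>l\<in>{1..k}. \<Sum>m\<le>s. ?a l m * ?b l (s - m)) = ((\<alpha> + \<beta>) gchoose s) * (-1)^s * kpow k B s i j" .
    qed
    finally show ?thesis by (simp add: kbinom_def)
  qed
qed

lemma kbinom_0: "kbinom k B 0 = kid k"
proof (intro ext)
  fix i j
  have "kbinom k B 0 i j = (\<Sum>m\<in>{0}. (0 gchoose m) * (-1)^m * kpow k B m i j)"
    unfolding kbinom_def by (rule suminf_finite) (auto simp: gbinomial_0_left)
  then show "kbinom k B 0 i j = kid k i j" by simp
qed

lemma kbinom_1: "kmat k B \<Longrightarrow> kbinom k B 1 = (\<lambda>i j. kid k i j - B i j)"
proof (intro ext)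
  fix i j assume B: "kmat k B"
  have "((1::real) gchoose m) = 0" if "m \<notin> {0, 1}" for m
  proof -
    have "1 < m" using that by auto
    then have "1 choose m = 0" by (rule binomial_eq_0)
    then show ?thesis by (metis binomial_gbinomial of_nat_0 of_nat_1)
  qed
  then have "kbinom k B 1 i j = (\<Sum>m\<in>{0,1}. (1 gchoose m) * (-1)^m * kpow k B m i j)"
    unfolding kbinom_def by (intro suminf_finite) auto
  then show "kbinom k B 1 i j = kid k i j - B i j" using B by (simp add: kmul_kid_right)
qed

lemma kmat_kbinom: "kmat k (kbinom k B \<alpha>)"
  using kmatD[OF kmat_kpow, of _ k _ B] by (auto simp: kmat_def kbinom_def)

lemma kbinom_sym:
  assumes "kmat k B" "\<And>i j. B i j = B j i"
  shows "kbinom k B \<alpha> i j = kbinom k B \<alpha> j i"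
  unfolding kbinom_def by (subst kpow_sym[OF assms]) simp

text \<open>With D = R - R', equality of the squares reads RD + DR' = 0. Pairing this entrywise with
  D gives the form of \<open>R\<close> summed over the columns of D plus the form of
  \<open>R'\<close> summed over its rows; both are nonnegative, so they vanish and D = 0.\<close>

lemma ksym_posdef_square_unique:
  assumes R: "ksym_posdef k R" and R': "ksym_posdef k R'" and eq: "kmul k R R = kmul k R' R'"
  shows "R = R'"
proof -
  define D where "D i j = R i j - R' i j" for i j
  have s: "R i j = R j i" "R' i j = R' j i" for i j using R R' by (auto simp: ksym_posdef_def)
  have sD: "D i j = D j i" for i j by (simp add: D_def s)
  have nn: "0 \<le> kdot k x (kvec k M x)" if "ksym_posdef k M" for M x
  proof (cases "\<exists>i\<in>{1..k}. x i \<noteq> 0")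
    case True then show ?thesis using that unfolding kdot_kvec ksym_posdef_def by (simp add: less_imp_le)
  next
    case False
    then have "kdot k x (kvec k M x) = 0" unfolding kdot_def by (intro sum.neutral) auto
    then show ?thesis by simp
  qed
  have Z: "(\<Sum>l\<in>{1..k}. R i l * D l j) + (\<Sum>l\<in>{1..k}. D i l * R' l j) = 0" if "i \<in> {1..k}" "j \<in> {1..k}" for i j
  proof -
    have "(\<Sum>l\<in>{1..k}. R i l * R l j) = (\<Sum>l\<in>{1..k}. R' i l * R' l j)"
      using fun_cong[OF fun_cong[OF eq, of i], of j] that by (simp add: kmul_def)
    then show ?thesis by (simp add: D_def algebra_simps sum_subtractf)
  qed
  have "0 = (\<Sum>j\<in>{1..k}. \<Sum>i\<in>{1..k}. D i j * ((\<Sum>l\<in>{1..k}. R i l * D l j) + (\<Sum>l\<in>{1..k}. D i l * R' l j)))"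
    using Z by simp
  also have "\<dots> = (\<Sum>j\<in>{1..k}. kdot k (\<lambda>i. D i j) (kvec k R (\<lambda>i. D i j))) +
      (\<Sum>j\<in>{1..k}. \<Sum>i\<in>{1..k}. D i j * (\<Sum>l\<in>{1..k}. D i l * R' l j))"
    by (simp add: distrib_left sum.distrib kdot_def kvec_def)
  also have "(\<Sum>j\<in>{1..k}. \<Sum>i\<in>{1..k}. D i j * (\<Sum>l\<in>{1..k}. D i l * R' l j)) =
      (\<Sum>i\<in>{1..k}. kdot k (\<lambda>j. D i j) (kvec k R' (\<lambda>j. D i j)))"
    unfolding kdot_def kvec_def by (subst sum.swap) (simp add: s(2) mult.commute)
  finally have "(\<Sum>j\<in>{1..k}. kdot k (\<lambda>i. D i j) (kvec k R (\<lambda>i. D i j))) = 0"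
    using sum_nonneg[of "{1..k}" "\<lambda>j. kdot k (\<lambda>i. D i j) (kvec k R (\<lambda>i. D i j))"]
      sum_nonneg[of "{1..k}" "\<lambda>i. kdot k (\<lambda>j. D i j) (kvec k R' (\<lambda>j. D i j))"] nn[OF R] nn[OF R'] by force
  then have z: "kdot k (\<lambda>i. D i j) (kvec k R (\<lambda>i. D i j)) = 0" if "j \<in> {1..k}" for j
    using that nn[OF R] by (subst (asm) sum_nonneg_eq_0_iff) auto
  show ?thesis
  proof (intro ext)
    fix i j
    show "R i j = R' i j"
    proof (cases "i \<in> {1..k} \<and> j \<in> {1..k}")
      case False
      then show ?thesis using kmatD[of k R i j] kmatD[of k R' i j] R R' by (auto simp: ksym_posdef_def)
    next
      case True
      show ?thesis
      proof (rule ccontr)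
        assume "R i j \<noteq> R' i j"
        then have "\<exists>i\<in>{1..k}. D i j \<noteq> 0" using True by (auto simp: D_def)
        then have "0 < kdot k (\<lambda>i. D i j) (kvec k R (\<lambda>i. D i j))"
          using R unfolding kdot_kvec ksym_posdef_def by (elim conjE allE[where x="\<lambda>i. D i j"]) simp
        then show False using z True by simp
      qed
    qed
  qed
qed

lemma kmul_scale: "kmul k (\<lambda>i j. a * A i j) (\<lambda>i j. b * B i j) = (\<lambda>i j. a * b * kmul k A B i j)"
  by (intro ext) (simp add: kmul_def sum_distrib_left mult_ac)

lemma kinvsqrt_eqI:
  assumes R: "ksym_posdef k R" "kmul k R R = M" and N: "kmat k N" "kmul k R N = kid k" "kmul k N R = kid k"
  shows "kinvsqrt k M = N"
proof -
  have s: "ksqrt k M = R"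
    unfolding ksqrt_def using R ksym_posdef_square_unique by (intro the_equality) auto
  have "kinv k R = N"
    unfolding kinv_def
  proof (rule the_equality)
    show "kmat k N \<and> kmul k R N = kid k \<and> kmul k N R = kid k" using N by simp
    fix N' assume N': "kmat k N' \<and> kmul k R N' = kid k \<and> kmul k N' R = kid k"
    have "N' = kmul k (kid k) N'" using N' by (simp add: kmul_kid_left)
    also have "\<dots> = kmul k N (kmul k R N')" unfolding N(3)[symmetric] kmul_assoc ..
    also have "\<dots> = kmul k N (kid k)" using N' by simp
    finally show "N' = N" using N(1) by (simp add: kmul_kid_right)
  qed
  then show ?thesis by (simp add: kinvsqrt_def s)
qed

text \<open>Writing A = \<Lambda>(1 - B) puts \<open>B\<close> between 0 and 1 - \<mu>/\<Lambda>,
  where the binomial series converges. The constants \<mu> and \<Lambda> serve convergence and are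
  absent from the conclusions, so they may degenerate as the model grows.\<close>

lemma kinvsqrt_whitens:
  assumes A: "kmat k A" and sym: "\<And>i j. A i j = A j i"
    and lo: "\<And>x. \<mu> * kdot k x x \<le> kdot k x (kvec k A x)"
    and up: "\<And>x. kdot k x (kvec k A x) \<le> \<Lambda> * kdot k x x"
    and l: "0 < \<mu>" "\<mu> \<le> \<Lambda>"
  shows "kinvsqrt k A i j = kinvsqrt k A j i"
    and "kmul k (kinvsqrt k A) (kmul k A (kinvsqrt k A)) = kid k"
proof -
  \<comment> \<open>Half of \<mu>/\<Lambda> is given away so that q stays positive even if \<mu> =
    \<Lambda>.\<close>
  define q where "q = 1 - \<mu> / (2 * \<Lambda>)"
  have L: "\<Lambda> > 0" using l by simp
  have q: "0 < q" "q < 1" using l by (auto simp: q_def field_simps)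
  define B where "B i j = kid k i j - A i j / \<Lambda>" for i j
  have Bm: "kmat k B" using A kmat_kid[of k] by (auto simp: kmat_def B_def)
  have Bs: "B i j = B j i" for i j using sym by (auto simp: B_def kid_def)
  have BQ: "kdot k x (kvec k B x) = kdot k x x - kdot k x (kvec k A x) / \<Lambda>" for x
  proof -
    have "kvec k B x i = kvec k (kid k) x i - kvec k A x i / \<Lambda>" for i
      by (simp add: kvec_def B_def left_diff_distrib sum_subtractf sum_divide_distrib)
    then have "kdot k x (kvec k B x) = (\<Sum>i\<in>{1..k}. x i * (x i - kvec k A x i / \<Lambda>))"
      unfolding kdot_def by (intro sum.cong) (auto simp: kvec_kid)
    then show ?thesis by (simp add: kdot_def right_diff_distrib sum_subtractf sum_divide_distrib)
  qed
  have psd: "0 \<le> kdot k x (kvec k B x)" for x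
    unfolding BQ using up[of x] L by (simp add: field_simps)
  have le: "kdot k x (kvec k B x) \<le> q * kdot k x x" for x
  proof -
    have "\<mu> / (2 * \<Lambda>) * kdot k x x \<le> \<mu> / \<Lambda> * kdot k x x"
      using l L by (intro mult_right_mono kdot_self_nonneg) (auto simp: field_simps)
    also have "\<dots> \<le> kdot k x (kvec k A x) / \<Lambda>" using lo[of x] L by (simp add: field_simps)
    finally show ?thesis unfolding BQ q_def by (simp add: left_diff_distrib)
  qed
  have P: "\<bar>kpow k B m i j\<bar> \<le> q ^ m" for m i j
    by (rule kpow_entry_le[OF psd_contraction[OF Bs psd le q(1)] q(1)])
  note M = kbinom_mult[OF P q]
  define R where "R i j = sqrt \<Lambda> * kbinom k B (1/2) i j" for i j
  define N where "N i j = 1 / sqrt \<Lambda> * kbinom k B (-1/2) i j" for i j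
  have RR: "kmul k R R = A"
    unfolding R_def[abs_def] kmul_scale M using L
    by (simp add: kbinom_1[OF Bm]) (simp add: B_def)
  have RN: "kmul k R N = kid k"
    unfolding R_def[abs_def] N_def[abs_def] kmul_scale M using L by (simp add: kbinom_0)
  have NR: "kmul k N R = kid k"
    unfolding R_def[abs_def] N_def[abs_def] kmul_scale M using L by (simp add: kbinom_0)
  have Nm: "kmat k N" using kmat_kbinom[of k B "-1/2"] by (auto simp: N_def kmat_def)
  text \<open>Positivity of the root comes from writing it as the square of \<open>(1 - B)\<close> to the power 1/4.\<close>
  have R: "ksym_posdef k R"
    unfolding ksym_posdef_def
  proof (intro conjI allI impI)
    show "kmat k R" using kmat_kbinom[of k B "1/2"] by (auto simp: R_def kmat_def)
    show "R i j = R j i" for i j unfolding R_def by (simp add: kbinom_sym[OF Bm Bs])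
    fix x :: "nat \<Rightarrow> real" assume x: "\<exists>i\<in>{1..k}. x i \<noteq> 0"
    let ?h = "kbinom k B (1/4)"
    have hs: "(\<lambda>i j. ?h j i) = ?h" by (intro ext) (rule kbinom_sym[OF Bm Bs])
    have "kdot k x (kvec k (kbinom k B (1/2)) x) = kdot k x (kvec k ?h (kvec k ?h x))"
      using M[of "1/4" "1/4"] kvec_kmul[of _ k ?h ?h x] unfolding kdot_def by (intro sum.cong) auto
    also have "\<dots> = kdot k (kvec k ?h x) (kvec k ?h x)"
      by (subst kdot_kvec_transpose) (simp add: hs)
    finally have E: "kdot k x (kvec k (kbinom k B (1/2)) x) = kdot k (kvec k ?h x) (kvec k ?h x)" .
    have "kdot k (kvec k ?h x) (kvec k ?h x) \<noteq> 0"
    proof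
      assume "kdot k (kvec k ?h x) (kvec k ?h x) = 0"
      then have "kvec k ?h x i = 0" if "i \<in> {1..k}" for i
        using that unfolding kdot_def by (subst (asm) sum_nonneg_eq_0_iff) auto
      \<comment> \<open>The power -1/4 of 1 - B inverts \<open>?h\<close>, so \<open>?h\<close> has
        trivial kernel.\<close>
      then have z: "kvec k (kbinom k B (-1/4)) (kvec k ?h x) i = 0" for i
        by (simp add: kvec_def[of k _ "kvec k ?h x"])
      have "x i = 0" if "i \<in> {1..k}" for i
        using z[of i] kvec_kmul[OF that, of "kbinom k B (-1/4)" ?h x] M[of "-1/4" "1/4"] that
        by (simp add: kbinom_0 kvec_kid)
      then show False using x by blast
    qed
    then have "0 < sqrt \<Lambda> * kdot k x (kvec k (kbinom k B (1/2)) x)"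
      unfolding E using L kdot_self_nonneg[of k "kvec k ?h x"] by simp
    then show "0 < (\<Sum>i\<in>{1..k}. \<Sum>j\<in>{1..k}. x i * R i j * x j)"
      unfolding kdot_kvec by (simp add: R_def sum_distrib_left mult_ac)
  qed
  have e: "kinvsqrt k A = N" by (rule kinvsqrt_eqI[OF R RR Nm RN NR])
  show "kinvsqrt k A i j = kinvsqrt k A j i" unfolding e N_def by (simp add: kbinom_sym[OF Bm Bs])
  have "kmul k N (kmul k (kmul k R R) N) = kid k"
    by (simp add: kmul_assoc RN kmul_kid_right NR) (simp add: kmul_assoc[symmetric] NR kmul_kid_left kmat_kid)
  then show "kmul k (kinvsqrt k A) (kmul k A (kinvsqrt k A)) = kid k" unfolding e RR .
qed

section \<open>A continuity theorem for characteristic functions on finite products\<close>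

abbreviation borel_k :: "nat \<Rightarrow> (nat \<Rightarrow> real) measure" where
  "borel_k k \<equiv> PiM {1..k} (\<lambda>_. borel)"

definition char_k :: "nat \<Rightarrow> (nat \<Rightarrow> real) measure \<Rightarrow> (nat \<Rightarrow> real) \<Rightarrow> complex" where
  "char_k k \<mu> s = (\<integral>x. iexp (\<Sum>j\<in>{1..k}. s j * x j) \<partial>\<mu>)"

text \<open>The unnormalised density at \<open>y\<close> of independent normals of scale \<sigma>
  centred at \<open>x\<close>; it is symmetric in the two points.\<close>

definition gauss_bump :: "nat \<Rightarrow> real \<Rightarrow> (nat \<Rightarrow> real) \<Rightarrow> (nat \<Rightarrow> real) \<Rightarrow> real" where
  "gauss_bump k \<sigma> y x = exp (- (\<Sum>j\<in>{1..k}. ((y j - x j) / \<sigma>)^2) / 2)"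

lemma sets_std_normal_k [measurable_cong]: "sets (std_normal_k k) = sets (borel_k k)"
  unfolding std_normal_k_def by (intro sets_PiM_cong) auto

lemma prob_space_std_normal_k: "prob_space (std_normal_k k)"
  unfolding std_normal_k_def by (intro prob_space_PiM prob_space_normal_density) simp

lemma integral_std_normal_k_prod:
  fixes f :: "nat \<Rightarrow> real \<Rightarrow> complex"
  assumes "\<And>j. j \<in> {1..k} \<Longrightarrow> integrable std_normal_distribution (f j)"
  shows "(\<integral>x. (\<Prod>j\<in>{1..k}. f j (x j)) \<partial>std_normal_k k) = (\<Prod>j\<in>{1..k}. integral\<^sup>L std_normal_distribution (f j))"
proof -
  interpret product_sigma_finite "\<lambda>_ :: nat. std_normal_distribution"
    by (intro product_sigma_finite.intro prob_space_imp_sigma_finite prob_space_normal_density) simp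
  show ?thesis unfolding std_normal_k_def by (rule product_integral_prod) (use assms in auto)
qed

lemma char_std_normal_k:
  "char_k k (std_normal_k k) s = exp (- (\<Sum>j\<in>{1..k}. (s j)^2) / 2)"
proof -
  interpret N: real_distribution std_normal_distribution by (rule real_dist_normal_dist)
  have "char_k k (std_normal_k k) s = (\<integral>x. (\<Prod>j\<in>{1..k}. iexp (s j * x j)) \<partial>std_normal_k k)"
    unfolding char_k_def by (intro Bochner_Integration.integral_cong) (auto simp: exp_sum sum_distrib_left)
  also have "\<dots> = (\<Prod>j\<in>{1..k}. char std_normal_distribution (s j))"
    unfolding char_def by (rule integral_std_normal_k_prod) (auto intro!: N.integrable_iexp)
  also have "\<dots> = (\<Prod>j\<in>{1..k}. complex_of_real (exp (- ((s j)^2) / 2)))"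
    by (simp add: char_std_normal_distribution)
  also have "\<dots> = complex_of_real (exp (\<Sum>j\<in>{1..k}. - ((s j)^2) / 2))"
    by (simp only: exp_sum[OF finite_atLeastAtMost] of_real_prod)
  also have "(\<Sum>j\<in>{1..k}. - ((s j)^2) / 2) = - (\<Sum>j\<in>{1..k}. (s j)^2) / 2"
    by (simp add: sum_negf sum_divide_distrib)
  finally show ?thesis .
qed

lemma borel_k_component [measurable (raw)]:
  "f \<in> measurable M (borel_k k) \<Longrightarrow> j \<in> {1..k} \<Longrightarrow> (\<lambda>x. f x j) \<in> borel_measurable M"
  by (rule measurable_compose[OF _ measurable_component_singleton])

text \<open>A Gaussian bump is itself a Gaussian average of characters.\<close>

lemma integral_gauss_bump:
  assumes P: "prob_space \<mu>" and s [measurable_cong]: "sets \<mu> = sets (borel_k k)"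
  shows "complex_of_real (\<integral>x. gauss_bump k \<sigma> y x \<partial>\<mu>) =
     (\<integral>s. iexp (\<Sum>j\<in>{1..k}. s j * (y j / \<sigma>)) * char_k k \<mu> (\<lambda>j. - s j / \<sigma>) \<partial>std_normal_k k)"
proof -
  interpret M: prob_space \<mu> by (rule P)
  interpret N: prob_space "std_normal_k k" by (rule prob_space_std_normal_k)
  interpret Q: pair_prob_space \<mu> "std_normal_k k" ..
  let ?g = "\<lambda>x s. iexp (\<Sum>j\<in>{1..k}. s j * ((y j - x j) / \<sigma>))"
  have m: "(\<lambda>(x, s). ?g x s) \<in> borel_measurable (\<mu> \<Otimes>\<^sub>M std_normal_k k)"
    unfolding split_beta by measurable
  have "complex_of_real (\<integral>x. gauss_bump k \<sigma> y x \<partial>\<mu>) = (\<integral>x. complex_of_real (gauss_bump k \<sigma> y x) \<partial>\<mu>)"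
    by simp
  also have "\<dots> = (\<integral>x. (\<integral>s. ?g x s \<partial>std_normal_k k) \<partial>\<mu>)"
  proof (rule Bochner_Integration.integral_cong[OF refl])
    fix x
    have "(\<integral>s. ?g x s \<partial>std_normal_k k) = char_k k (std_normal_k k) (\<lambda>j. (y j - x j) / \<sigma>)"
      unfolding char_k_def by (simp add: mult.commute)
    then show "complex_of_real (gauss_bump k \<sigma> y x) = (\<integral>s. ?g x s \<partial>std_normal_k k)"
      by (simp only: char_std_normal_k gauss_bump_def)
  qed
  also have "\<dots> = (\<integral>s. (\<integral>x. ?g x s \<partial>\<mu>) \<partial>std_normal_k k)"
    by (rule Q.Fubini_integral[symmetric], rule Q.P.integrable_const_bound[where B=1]) (use m in auto)
  also have "\<dots> = (\<integral>s. iexp (\<Sum>j\<in>{1..k}. s j * (y j / \<sigma>)) * char_k k \<mu> (\<lambda>j. - s j / \<sigma>) \<partial>std_normal_k k)"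
  proof (rule Bochner_Integration.integral_cong[OF refl])
    fix s
    have "?g x s = iexp (\<Sum>j\<in>{1..k}. s j * (y j / \<sigma>)) * iexp (\<Sum>j\<in>{1..k}. (- s j / \<sigma>) * x j)" for x
    proof -
      have "(\<Sum>j\<in>{1..k}. s j * ((y j - x j) / \<sigma>)) = (\<Sum>j\<in>{1..k}. s j * (y j / \<sigma>)) + (\<Sum>j\<in>{1..k}. (- s j / \<sigma>) * x j)"
        by (simp add: sum.distrib[symmetric] diff_divide_distrib algebra_simps)
      then show ?thesis by (simp only: of_real_add distrib_left exp_add)
    qed
    then show "(\<integral>x. ?g x s \<partial>\<mu>) = iexp (\<Sum>j\<in>{1..k}. s j * (y j / \<sigma>)) * char_k k \<mu> (\<lambda>j. - s j / \<sigma>)"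
      unfolding char_k_def by simp
  qed
  finally show ?thesis .
qed

lemma char_k_measurable:
  assumes P: "prob_space \<mu>" and s [measurable_cong]: "sets \<mu> = sets (borel_k k)"
  shows "(\<lambda>s. char_k k \<mu> (\<lambda>j. - s j / \<sigma>)) \<in> borel_measurable (borel_k k)"
proof -
  interpret M: prob_space \<mu> by (rule P)
  have "(\<lambda>(s, x). iexp (\<Sum>j\<in>{1..k}. - s j / \<sigma> * x j)) \<in> borel_measurable (borel_k k \<Otimes>\<^sub>M \<mu>)"
    unfolding split_beta by measurable
  then show ?thesis unfolding char_k_def by (rule M.borel_measurable_lebesgue_integral)
qed

lemma char_k_norm: "prob_space \<mu> \<Longrightarrow> sets \<mu> = sets (borel_k k) \<Longrightarrow> cmod (char_k k \<mu> s) \<le> 1"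
proof -
  assume P: "prob_space \<mu>" and s [measurable_cong]: "sets \<mu> = sets (borel_k k)"
  interpret M: prob_space \<mu> by (rule P)
  have "cmod (char_k k \<mu> s) \<le> (\<integral>x. cmod (iexp (\<Sum>j\<in>{1..k}. s j * x j)) \<partial>\<mu>)"
    unfolding char_k_def by (rule integral_norm_bound)
  then show ?thesis by (simp add: M.prob_space)
qed

text \<open>The Gaussian average over frequencies turns pointwise convergence of characteristic
  functions into convergence of integrals by dominated convergence; neither tightness nor an
  inversion formula enters.\<close>

lemma gauss_bump_converges:
  assumes P: "\<And>n. prob_space (\<mu> n)" and s: "\<And>n. sets (\<mu> n) = sets (borel_k k)"
    and lim: "\<And>s. (\<lambda>n. char_k k (\<mu> n) s) \<longlonglongrightarrow> exp (- (\<Sum>j\<in>{1..k}. (s j)^2) / 2)"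
  shows "(\<lambda>n. \<integral>x. gauss_bump k \<sigma> y x \<partial>\<mu> n) \<longlonglongrightarrow> (\<integral>x. gauss_bump k \<sigma> y x \<partial>std_normal_k k)"
proof -
  interpret N: prob_space "std_normal_k k" by (rule prob_space_std_normal_k)
  have e [measurable]: "(\<lambda>s. iexp (\<Sum>j\<in>{1..k}. s j * (y j / \<sigma>))) \<in> borel_measurable (std_normal_k k)"
    by measurable
  have m: "(\<lambda>s. iexp (\<Sum>j\<in>{1..k}. s j * (y j / \<sigma>)) * char_k k M (\<lambda>j. - s j / \<sigma>)) \<in> borel_measurable (std_normal_k k)"
    if "prob_space M" "sets M = sets (borel_k k)" for M
    using char_k_measurable[OF that, of \<sigma>] measurable_cong_sets[OF sets_std_normal_k refl]
    by (intro borel_measurable_times e) auto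
  have "(\<lambda>n. \<integral>s. iexp (\<Sum>j\<in>{1..k}. s j * (y j / \<sigma>)) * char_k k (\<mu> n) (\<lambda>j. - s j / \<sigma>) \<partial>std_normal_k k)
      \<longlonglongrightarrow> (\<integral>s. iexp (\<Sum>j\<in>{1..k}. s j * (y j / \<sigma>)) * char_k k (std_normal_k k) (\<lambda>j. - s j / \<sigma>) \<partial>std_normal_k k)"
  proof (rule integral_dominated_convergence[where w="\<lambda>_. 1"])
    show "AE x in std_normal_k k. (\<lambda>n. iexp (\<Sum>j\<in>{1..k}. x j * (y j / \<sigma>)) * char_k k (\<mu> n) (\<lambda>j. - x j / \<sigma>))
       \<longlonglongrightarrow> iexp (\<Sum>j\<in>{1..k}. x j * (y j / \<sigma>)) * char_k k (std_normal_k k) (\<lambda>j. - x j / \<sigma>)"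
      unfolding char_std_normal_k by (intro AE_I2 tendsto_mult tendsto_const lim)
    show "AE x in std_normal_k k. cmod (iexp (\<Sum>j\<in>{1..k}. x j * (y j / \<sigma>)) * char_k k (\<mu> n) (\<lambda>j. - x j / \<sigma>)) \<le> 1" for n
      using char_k_norm[OF P s] by (intro AE_I2) (simp add: norm_mult)
  qed (intro m P s prob_space_std_normal_k sets_std_normal_k, intro m P s, simp)
  then have "(\<lambda>n. complex_of_real (\<integral>x. gauss_bump k \<sigma> y x \<partial>\<mu> n)) \<longlonglongrightarrow> complex_of_real (\<integral>x. gauss_bump k \<sigma> y x \<partial>std_normal_k k)"
    unfolding integral_gauss_bump[OF P s] integral_gauss_bump[OF prob_space_std_normal_k sets_std_normal_k] .
  then show ?thesis by (simp only: tendsto_of_real_iff)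
qed

section \<open>Gaussian smoothing of compactly supported test functions\<close>

abbreviation lborel_k :: "nat \<Rightarrow> (nat \<Rightarrow> real) measure" where
  "lborel_k k \<equiv> PiM {1..k} (\<lambda>_. lborel)"

definition gauss_smooth :: "nat \<Rightarrow> real \<Rightarrow> ((nat \<Rightarrow> real) \<Rightarrow> real) \<Rightarrow> (nat \<Rightarrow> real) \<Rightarrow> real" where
  "gauss_smooth k \<sigma> h x = (\<integral>y. h y * (\<Prod>j\<in>{1..k}. normal_density (x j) \<sigma> (y j)) \<partial>lborel_k k)"

lemma sets_lborel_k [measurable_cong]: "sets (lborel_k k) = sets (borel_k k)"
  by (intro sets_PiM_cong) auto

interpretation lborel_k: product_sigma_finite "\<lambda>_ :: nat. lborel :: real measure"
  by standard

lemma sigma_finite_lborel_k: "sigma_finite_measure (lborel_k k)"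
  by (rule lborel_k.sigma_finite) simp

lemma prod_normal_density:
  assumes "0 < \<sigma>"
  shows "(\<Prod>j\<in>{1..k}. normal_density (x j) \<sigma> (y j)) = (1 / sqrt (2 * pi * \<sigma>\<^sup>2)) ^ k * gauss_bump k \<sigma> y x"
proof -
  have "gauss_bump k \<sigma> y x = exp (\<Sum>j\<in>{1..k}. - (y j - x j)\<^sup>2 / (2 * \<sigma>\<^sup>2))"
    unfolding gauss_bump_def using assms
    by (intro arg_cong[where f=exp]) (simp add: sum_negf sum_divide_distrib power_divide mult.commute)
  also have "\<dots> = (\<Prod>j\<in>{1..k}. exp (- (y j - x j)\<^sup>2 / (2 * \<sigma>\<^sup>2)))"
    by (rule exp_sum) simp
  finally show ?thesis by (simp add: normal_density_def prod.distrib power_divide prod_dividef)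
qed

lemma gauss_bump_bounds: "0 \<le> gauss_bump k \<sigma> y x" "gauss_bump k \<sigma> y x \<le> 1"
  by (auto simp: gauss_bump_def sum_nonneg)

lemma gauss_bump_measurable [measurable (raw)]:
  assumes [measurable]: "f \<in> measurable M (borel_k k)" "g \<in> measurable M (borel_k k)"
  shows "(\<lambda>z. gauss_bump k \<sigma> (f z) (g z)) \<in> borel_measurable M"
  unfolding gauss_bump_def by measurable

lemma normal_density_second_moment:
  assumes \<sigma>: "0 < \<sigma>" and j: "j \<in> {1..k}"
  shows "integrable (lborel_k k) (\<lambda>y. (y j - x j)^2 * (\<Prod>i\<in>{1..k}. normal_density (x i) \<sigma> (y i)))"
    and "(\<integral>y. (y j - x j)^2 * (\<Prod>i\<in>{1..k}. normal_density (x i) \<sigma> (y i)) \<partial>lborel_k k) = \<sigma>^2"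
proof -
  let ?f = "\<lambda>i t. (if i = j then (t - x i)^2 else 1) * normal_density (x i) \<sigma> t"
  have e: "(y j - x j)^2 * (\<Prod>i\<in>{1..k}. normal_density (x i) \<sigma> (y i)) = (\<Prod>i\<in>{1..k}. ?f i (y i))" for y
    using j by (simp add: prod.distrib)
  have M2: "has_bochner_integral lborel (\<lambda>t. normal_density (x j) \<sigma> t * (t - x j)^2) (\<sigma>^2)"
  proof -
    have "fact (2 * 1) / ((2 / \<sigma>\<^sup>2) ^ 1 * fact 1) = \<sigma>^2" using \<sigma> by simp
    then show ?thesis using normal_moment_even[OF \<sigma>, of "x j" 1] by (simp only: mult_1_right)
  qed
  have int: "integrable lborel (?f i)" for i
    using M2 \<sigma> by (cases "i = j") (auto simp: has_bochner_integral_iff mult.commute integrable_normal_density)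
  show "integrable (lborel_k k) (\<lambda>y. (y j - x j)^2 * (\<Prod>i\<in>{1..k}. normal_density (x i) \<sigma> (y i)))"
    unfolding e by (rule lborel_k.product_integrable_prod) (use int in auto)
  have "(\<integral>y. (y j - x j)^2 * (\<Prod>i\<in>{1..k}. normal_density (x i) \<sigma> (y i)) \<partial>lborel_k k)
     = (\<Prod>i\<in>{1..k}. integral\<^sup>L lborel (?f i))"
    unfolding e by (rule lborel_k.product_integral_prod) (use int in auto)
  also have "\<dots> = (\<Prod>i\<in>{1..k}. if i = j then \<sigma>^2 else 1)"
    using M2 \<sigma> by (intro prod.cong) (auto simp: has_bochner_integral_iff mult.commute integral_normal_density)
  also have "\<dots> = \<sigma>^2" using j by simp
  finally show "(\<integral>y. (y j - x j)^2 * (\<Prod>i\<in>{1..k}. normal_density (x i) \<sigma> (y i)) \<partial>lborel_k k) = \<sigma>^2" .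
qed

text \<open>Test functions vanishing outside a cube. Their Lebesgue integrability is what licenses
  exchanging the smoothing integral with the integral against a probability measure.\<close>

locale compact_test =
  fixes k :: nat and h :: "(nat \<Rightarrow> real) \<Rightarrow> real" and B L :: real
  assumes h_measurable [measurable]: "h \<in> borel_measurable (borel_k k)"
    and h_bound: "\<And>x. \<bar>h x\<bar> \<le> B"
    and h_support: "\<And>x j. j \<in> {1..k} \<Longrightarrow> \<bar>x j\<bar> > L \<Longrightarrow> h x = 0"
begin

lemma B_nonneg: "0 \<le> B" using h_bound[of undefined] by linarith

lemma h_measurable_lborel [measurable]: "h \<in> borel_measurable (lborel_k k)"
  using h_measurable measurable_cong_sets[OF sets_lborel_k refl] by blast

lemma h_integrable: "integrable (lborel_k k) h"
proof (rule Bochner_Integration.integrable_bound)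
  show "integrable (lborel_k k) (\<lambda>x. B * (\<Prod>j\<in>{1..k}. indicator {-L..L} (x j)))"
    by (intro integrable_mult_right lborel_k.product_integrable_prod integrable_real_indicator)
      (auto simp: emeasure_lborel_Icc_eq)
  show "AE x in lborel_k k. norm (h x) \<le> norm (B * (\<Prod>j\<in>{1..k}. indicator {-L..L} (x j)))"
  proof (rule AE_I2)
    fix x
    show "norm (h x) \<le> norm (B * (\<Prod>j\<in>{1..k}. indicator {-L..L} (x j)))"
    proof (cases "\<exists>j\<in>{1..k}. \<bar>x j\<bar> > L")
      case True
      then have "h x = 0" using h_support by blast
      then show ?thesis by simp
    next
      case False
      then have "(\<Prod>j\<in>{1..k}. indicator {-L..L} (x j)) = (1::real)"
        by (intro prod.neutral) (auto simp: indicator_def abs_le_iff not_less)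
      then show ?thesis using h_bound[of x] B_nonneg by simp
    qed
  qed
qed measurable

text \<open>After Fubini the measure enters only through integrals of bumps, whose convergence is
  already known.\<close>

lemma integral_gauss_smooth:
  assumes P: "prob_space \<mu>" and s [measurable_cong]: "sets \<mu> = sets (borel_k k)" and \<sigma>: "0 < \<sigma>"
  shows "integrable \<mu> (gauss_smooth k \<sigma> h)"
    and "(\<integral>x. gauss_smooth k \<sigma> h x \<partial>\<mu>) =
     (1 / sqrt (2 * pi * \<sigma>\<^sup>2)) ^ k * (\<integral>y. h y * (\<integral>x. gauss_bump k \<sigma> y x \<partial>\<mu>) \<partial>lborel_k k)"
proof -
  interpret M: prob_space \<mu> by (rule P)
  interpret S: sigma_finite_measure "lborel_k k" by (rule sigma_finite_lborel_k)
  interpret Q: pair_sigma_finite "lborel_k k" \<mu> ..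
  let ?c = "(1 / sqrt (2 * pi * \<sigma>\<^sup>2)) ^ k"
  have gm: "gauss_bump k \<sigma> y \<in> borel_measurable \<mu>" if "y \<in> space (lborel_k k)" for y
  proof (rule gauss_bump_measurable)
    show "(\<lambda>_. y) \<in> measurable \<mu> (borel_k k)" using that by (intro measurable_const) (simp add: space_PiM)
    show "(\<lambda>x. x) \<in> measurable \<mu> (borel_k k)" by (rule measurable_ident_sets[OF s])
  qed
  have gi: "integrable \<mu> (gauss_bump k \<sigma> y)" if "y \<in> space (lborel_k k)" for y
    using gm[OF that] gauss_bump_bounds by (intro M.integrable_const_bound[where B=1]) auto
  have g01: "0 \<le> (\<integral>x. gauss_bump k \<sigma> y x \<partial>\<mu>)" "(\<integral>x. gauss_bump k \<sigma> y x \<partial>\<mu>) \<le> 1" if "y \<in> space (lborel_k k)" for y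
    using gauss_bump_bounds M.integral_le_const[OF gi[OF that], of 1] by (auto intro!: integral_nonneg)
  have m: "(\<lambda>(y, x). h y * gauss_bump k \<sigma> y x) \<in> borel_measurable (lborel_k k \<Otimes>\<^sub>M \<mu>)"
    unfolding split_beta by measurable
  have I: "integrable (lborel_k k \<Otimes>\<^sub>M \<mu>) (\<lambda>(y, x). h y * gauss_bump k \<sigma> y x)"
  proof (rule Q.Fubini_integrable[OF m])
    show "integrable (lborel_k k) (\<lambda>y. \<integral>x. norm (case (y, x) of (y, x) \<Rightarrow> h y * gauss_bump k \<sigma> y x) \<partial>\<mu>)"
    proof (rule Bochner_Integration.integrable_bound[OF h_integrable])
      show "(\<lambda>y. \<integral>x. norm (case (y, x) of (y, x) \<Rightarrow> h y * gauss_bump k \<sigma> y x) \<partial>\<mu>) \<in> borel_measurable (lborel_k k)"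
        by (intro M.borel_measurable_lebesgue_integral) (use m in measurable)
      show "AE y in lborel_k k. norm (\<integral>x. norm (case (y, x) of (y, x) \<Rightarrow> h y * gauss_bump k \<sigma> y x) \<partial>\<mu>) \<le> norm (h y)"
        using g01 gauss_bump_bounds by (intro AE_I2) (auto simp: abs_mult intro!: mult_left_le)
    qed
    show "AE y in lborel_k k. integrable \<mu> (\<lambda>x. case (y, x) of (y, x) \<Rightarrow> h y * gauss_bump k \<sigma> y x)"
      using gi by (intro AE_I2) auto
  qed
  have F: "gauss_smooth k \<sigma> h x = ?c * (\<integral>y. h y * gauss_bump k \<sigma> y x \<partial>lborel_k k)" for x
    unfolding gauss_smooth_def prod_normal_density[OF \<sigma>] mult.left_commute[of "h _"] by simp
  show "integrable \<mu> (gauss_smooth k \<sigma> h)"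
    using Q.integrable_snd[OF I] unfolding F[abs_def] by simp
  have "(\<integral>x. (\<integral>y. h y * gauss_bump k \<sigma> y x \<partial>lborel_k k) \<partial>\<mu>) = (\<integral>y. (\<integral>x. h y * gauss_bump k \<sigma> y x \<partial>\<mu>) \<partial>lborel_k k)"
    by (rule Q.Fubini_integral[OF I])
  then show "(\<integral>x. gauss_smooth k \<sigma> h x \<partial>\<mu>) = ?c * (\<integral>y. h y * (\<integral>x. gauss_bump k \<sigma> y x \<partial>\<mu>) \<partial>lborel_k k)"
    unfolding F by simp
qed

lemma gauss_smooth_converges:
  assumes P: "\<And>n. prob_space (\<mu> n)" and s: "\<And>n. sets (\<mu> n) = sets (borel_k k)"
    and lim: "\<And>s. (\<lambda>n. char_k k (\<mu> n) s) \<longlonglongrightarrow> exp (- (\<Sum>j\<in>{1..k}. (s j)^2) / 2)" and \<sigma>: "0 < \<sigma>"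
  shows "(\<lambda>n. \<integral>x. gauss_smooth k \<sigma> h x \<partial>\<mu> n) \<longlonglongrightarrow> (\<integral>x. gauss_smooth k \<sigma> h x \<partial>std_normal_k k)"
proof -
  have m: "(\<lambda>y. h y * (\<integral>x. gauss_bump k \<sigma> y x \<partial>M)) \<in> borel_measurable (lborel_k k)"
    if P: "prob_space M" and s [measurable_cong]: "sets M = sets (borel_k k)" for M
  proof -
    interpret M: prob_space M by (rule P)
    have "(\<lambda>(y, x). gauss_bump k \<sigma> y x) \<in> borel_measurable (lborel_k k \<Otimes>\<^sub>M M)"
      unfolding split_beta by measurable
    then have "(\<lambda>y. \<integral>x. gauss_bump k \<sigma> y x \<partial>M) \<in> borel_measurable (lborel_k k)"
      by (rule M.borel_measurable_lebesgue_integral)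
    then show ?thesis by measurable
  qed
  have g: "\<bar>\<integral>x. gauss_bump k \<sigma> y x \<partial>M\<bar> \<le> 1" if "prob_space M" for y M
  proof -
    interpret M: prob_space M by (rule that)
    have "\<bar>\<integral>x. gauss_bump k \<sigma> y x \<partial>M\<bar> \<le> (\<integral>x. 1 \<partial>M)"
    proof (cases "integrable M (gauss_bump k \<sigma> y)")
      case True
      then have "\<bar>\<integral>x. gauss_bump k \<sigma> y x \<partial>M\<bar> = (\<integral>x. gauss_bump k \<sigma> y x \<partial>M)"
        using gauss_bump_bounds by (intro abs_of_nonneg integral_nonneg) auto
      also have "\<dots> \<le> (\<integral>x. 1 \<partial>M)" using True gauss_bump_bounds by (intro integral_mono) auto
      finally show ?thesis .
    qed (simp add: not_integrable_integral_eq)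
    then show ?thesis by (simp add: M.prob_space)
  qed
  have "(\<lambda>n. \<integral>y. h y * (\<integral>x. gauss_bump k \<sigma> y x \<partial>\<mu> n) \<partial>lborel_k k) \<longlonglongrightarrow>
      (\<integral>y. h y * (\<integral>x. gauss_bump k \<sigma> y x \<partial>std_normal_k k) \<partial>lborel_k k)"
  proof (rule integral_dominated_convergence[where w="\<lambda>y. \<bar>h y\<bar>"])
    show "AE y in lborel_k k. (\<lambda>n. h y * (\<integral>x. gauss_bump k \<sigma> y x \<partial>\<mu> n)) \<longlonglongrightarrow> h y * (\<integral>x. gauss_bump k \<sigma> y x \<partial>std_normal_k k)"
      by (intro AE_I2 tendsto_mult tendsto_const gauss_bump_converges P s lim)
    show "AE y in lborel_k k. norm (h y * (\<integral>x. gauss_bump k \<sigma> y x \<partial>\<mu> n)) \<le> \<bar>h y\<bar>" for n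
      using g[OF P] by (intro AE_I2) (auto simp: abs_mult intro!: mult_left_le)
  qed (intro m prob_space_std_normal_k sets_std_normal_k, intro m P s, use h_integrable in simp)
  then show ?thesis
    unfolding integral_gauss_smooth(2)[OF P s \<sigma>] integral_gauss_smooth(2)[OF prob_space_std_normal_k sets_std_normal_k \<sigma>]
    by (intro tendsto_mult tendsto_const)
qed

text \<open>Chebyshev in pointwise form: within \<delta> of \<open>x\<close> in every coordinate the
  difference is at most \<epsilon>, and elsewhere it is at most 2B, hence at most 2B/\<delta>^2
  times the squared distance, whose mean under the kernel is k \<sigma>^2.\<close>

lemma gauss_smooth_close:
  assumes \<sigma>: "0 < \<sigma>" and \<delta>: "0 < \<delta>" and \<epsilon>: "0 \<le> \<epsilon>" and x: "x \<in> space (borel_k k)"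
    and uc: "\<And>y. y \<in> space (borel_k k) \<Longrightarrow> (\<And>j. j \<in> {1..k} \<Longrightarrow> \<bar>y j - x j\<bar> < \<delta>) \<Longrightarrow> \<bar>h y - h x\<bar> \<le> \<epsilon>"
  shows "\<bar>gauss_smooth k \<sigma> h x - h x\<bar> \<le> \<epsilon> + 2 * B * real k * \<sigma>^2 / \<delta>^2"
proof -
  define p where "p y = (\<Prod>i\<in>{1..k}. normal_density (x i) \<sigma> (y i))" for y
  define q where "q y = (\<Sum>j\<in>{1..k}. (y j - x j)^2 * p y)" for y
  have p0: "0 \<le> p y" for y unfolding p_def by (intro prod_nonneg) simp
  have pI: "integrable (lborel_k k) p"
    unfolding p_def[abs_def]
    by (rule lborel_k.product_integrable_prod) (use \<sigma> in \<open>auto intro: integrable_normal_density\<close>)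
  have p1: "integral\<^sup>L (lborel_k k) p = 1"
    unfolding p_def[abs_def]
    by (subst lborel_k.product_integral_prod) (use \<sigma> in \<open>auto intro: integrable_normal_density simp: integral_normal_density\<close>)
  note M2 = normal_density_second_moment[OF \<sigma>, where x=x and k=k, folded p_def]
  have qI: "integrable (lborel_k k) q"
    unfolding q_def[abs_def] by (rule Bochner_Integration.integrable_sum) (rule M2(1))
  have q1: "integral\<^sup>L (lborel_k k) q = real k * \<sigma>^2"
  proof -
    have "integral\<^sup>L (lborel_k k) q = (\<Sum>j\<in>{1..k}. \<integral>y. (y j - x j)^2 * p y \<partial>lborel_k k)"
      unfolding q_def[abs_def] by (rule Bochner_Integration.integral_sum) (rule M2(1))
    also have "\<dots> = (\<Sum>j\<in>{1..k}. \<sigma>^2)" by (intro sum.cong refl M2(2))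
    finally show ?thesis by simp
  qed
  have pm: "p \<in> borel_measurable (lborel_k k)" by (rule borel_measurable_integrable[OF pI])
  have hI: "integrable (lborel_k k) (\<lambda>y. h y * p y)"
  proof (rule Bochner_Integration.integrable_bound[OF integrable_mult_right[OF pI, of B]])
    show "AE y in lborel_k k. norm (h y * p y) \<le> norm (B * p y)"
      using p0 h_bound B_nonneg by (intro AE_I2) (auto simp: abs_mult intro!: mult_right_mono)
    show "(\<lambda>y. h y * p y) \<in> borel_measurable (lborel_k k)"
      by (rule borel_measurable_times[OF h_measurable_lborel pm])
  qed
  define C where "C = 2 * B / \<delta>^2"
  have C0: "0 \<le> C" using B_nonneg by (simp add: C_def)
  have q_alt: "q y = (\<Sum>j\<in>{1..k}. (y j - x j)^2) * p y" for y
    by (simp only: q_def sum_distrib_right)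
  have pt: "\<bar>(h y - h x) * p y\<bar> \<le> \<epsilon> * p y + C * q y" if y: "y \<in> space (lborel_k k)" for y
  proof -
    define S where "S = (\<Sum>j\<in>{1..k}. (y j - x j)^2)"
    have S0: "0 \<le> C * S"
      using C0 unfolding S_def by (intro mult_nonneg_nonneg sum_nonneg) auto
    have "\<bar>h y - h x\<bar> \<le> \<epsilon> + C * S"
    proof (cases "\<forall>j\<in>{1..k}. \<bar>y j - x j\<bar> < \<delta>")
      case True
      then have "\<bar>h y - h x\<bar> \<le> \<epsilon>" using y by (intro uc) (auto simp: space_PiM)
      then show ?thesis using S0 by linarith
    next
      case False
      then obtain j where j: "j \<in> {1..k}" "\<delta> \<le> \<bar>y j - x j\<bar>" by (auto simp: not_less)
      have "\<delta>^2 \<le> (y j - x j)^2" using j(2) \<delta> by (metis abs_le_square_iff abs_of_pos)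
      also have "\<dots> \<le> S"
        unfolding S_def by (rule member_le_sum[OF j(1)]) auto
      finally have "C * \<delta>^2 \<le> C * S" using C0 by (rule mult_left_mono)
      moreover have "C * \<delta>^2 = 2 * B" using \<delta> by (simp add: C_def)
      moreover have "\<bar>h y - h x\<bar> \<le> 2 * B" using h_bound[of x] h_bound[of y] by linarith
      ultimately show ?thesis using \<epsilon> by linarith
    qed
    then have "\<bar>h y - h x\<bar> * p y \<le> (\<epsilon> + C * S) * p y"
      by (rule mult_right_mono[OF _ p0])
    then show ?thesis using p0[of y] unfolding q_alt S_def[symmetric] by (simp add: abs_mult distrib_right mult.assoc)
  qed
  have "gauss_smooth k \<sigma> h x = (\<integral>y. h y * p y \<partial>lborel_k k)"
    unfolding gauss_smooth_def p_def ..
  moreover have "(\<integral>y. (h y - h x) * p y \<partial>lborel_k k) = (\<integral>y. h y * p y \<partial>lborel_k k) - h x * integral\<^sup>L (lborel_k k) p"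
    using hI pI by (simp add: left_diff_distrib)
  ultimately have e: "gauss_smooth k \<sigma> h x - h x = (\<integral>y. (h y - h x) * p y \<partial>lborel_k k)"
    using p1 by simp
  have dI: "integrable (lborel_k k) (\<lambda>y. (h y - h x) * p y)"
    unfolding left_diff_distrib by (rule Bochner_Integration.integrable_diff[OF hI integrable_mult_right[OF pI]])
  have bI: "integrable (lborel_k k) (\<lambda>y. \<epsilon> * p y + C * q y)"
    by (rule Bochner_Integration.integrable_add[OF integrable_mult_right[OF pI] integrable_mult_right[OF qI]])
  have "\<bar>\<integral>y. (h y - h x) * p y \<partial>lborel_k k\<bar> \<le> (\<integral>y. \<bar>(h y - h x) * p y\<bar> \<partial>lborel_k k)"
    by (rule integral_abs_bound)
  also have "\<dots> \<le> (\<integral>y. \<epsilon> * p y + C * q y \<partial>lborel_k k)"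
    by (rule integral_mono[OF integrable_abs[OF dI] bI pt])
  also have "\<dots> = \<epsilon> * integral\<^sup>L (lborel_k k) p + C * integral\<^sup>L (lborel_k k) q"
    using pI qI by simp
  also have "\<dots> = \<epsilon> + 2 * B * real k * \<sigma>^2 / \<delta>^2"
    unfolding p1 q1 C_def by simp
  finally show ?thesis unfolding e .
qed

end

section \<open>Measurability and uniform continuity in the product topology\<close>

lemma dist_fun_le:
  fixes x y :: "nat \<Rightarrow> real"
  assumes "\<And>i. \<bar>x i - y i\<bar> \<le> \<delta>"
  shows "dist x y \<le> 2 * \<delta>"
proof -
  have d0: "0 \<le> \<delta>" using assms[of 0] by linarith
  have s: "summable (\<lambda>n. (1/2)^n * \<delta> :: real)" by (intro summable_mult2 summable_geometric) simp
  \<comment> \<open>The metric on functions weights the n-th coordinate distance, capped at 1, by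
    2^(-n); the weights sum to 2.\<close>
  have "dist x y \<le> (\<Sum>n. (1/2)^n * \<delta>)"
    unfolding dist_fun_def
  proof (rule suminf_le[OF _ _ s])
    show le: "(1/2)^n * min (dist (x (from_nat n)) (y (from_nat n))) 1 \<le> (1/2)^n * \<delta>" for n
      using assms[of "from_nat n"] by (intro mult_left_mono) (auto simp: dist_real_def min_le_iff_disj)
    show "summable (\<lambda>n. (1/2)^n * min (dist (x (from_nat n)) (y (from_nat n))) 1)"
      by (rule summable_comparison_test'[OF s, of 0]) (use le in auto)
  qed
  also have "\<dots> = 2 * \<delta>"
    using suminf_mult2[OF summable_geometric[of "1/2 :: real"], of \<delta>] suminf_geometric[of "1/2 :: real"] by simp
  finally show ?thesis .
qed

text \<open>Points of the finite product are \<open>undefined\<close> off 1..k, so the extra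
  coordinates are constant there and hence measurable; the inclusion into the full function space is
  therefore measurable.\<close>

lemma continuous_imp_borel_k_measurable:
  fixes h :: "(nat \<Rightarrow> real) \<Rightarrow> real"
  assumes "continuous_on UNIV h"
  shows "h \<in> borel_measurable (borel_k k)"
proof -
  have "(\<lambda>x. x) \<in> measurable (borel_k k) borel"
  proof (rule measurable_coordinatewise_then_product)
    fix i
    show "(\<lambda>x. x i) \<in> borel_measurable (borel_k k)"
    proof (cases "i \<in> {1..k}")
      case True
      then show ?thesis by (rule measurable_component_singleton)
    next
      case False
      then have "(\<lambda>_. undefined :: real) \<in> borel_measurable (borel_k k) \<longleftrightarrow> (\<lambda>x. x i) \<in> borel_measurable (borel_k k)"
        by (intro measurable_cong) (auto simp: space_PiM PiE_def extensional_def)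
      then show ?thesis by simp
    qed
  qed
  from measurable_compose[OF this borel_measurable_continuous_onI[OF assms]] show ?thesis .
qed

lemma compactly_supported_uniform:
  fixes h :: "(nat \<Rightarrow> real) \<Rightarrow> real"
  assumes c: "continuous_on UNIV h"
    and supp: "\<And>x j. j \<in> {1..k} \<Longrightarrow> \<bar>x j\<bar> > L \<Longrightarrow> h x = 0" and \<epsilon>: "0 < \<epsilon>"
  shows "\<exists>\<delta>>0. \<forall>x\<in>space (borel_k k). \<forall>y\<in>space (borel_k k).
      (\<forall>j\<in>{1..k}. \<bar>y j - x j\<bar> < \<delta>) \<longrightarrow> \<bar>h y - h x\<bar> \<le> \<epsilon>"
proof -
  \<comment> \<open>A compact set of extensional points: singletons off 1..k, and a margin of 1
    beyond the support in the other coordinates.\<close>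
  define K where "K = PiE (UNIV :: nat set) (\<lambda>i. if i \<in> {1..k} then {-(L+1)..L+1} else {undefined :: real})"
  have "compactin (product_topology (\<lambda>i::nat. euclidean) UNIV) K"
    unfolding K_def compactin_PiE by (auto simp: compactin_euclidean_iff)
  then have "compact K" by (simp add: euclidean_product_topology compactin_euclidean_iff)
  then have "uniformly_continuous_on K h"
    by (intro compact_uniformly_continuous continuous_on_subset[OF c]) auto
  then obtain d where d: "d > 0" "\<And>x y. x \<in> K \<Longrightarrow> y \<in> K \<Longrightarrow> dist y x < d \<Longrightarrow> dist (h y) (h x) < \<epsilon>"
    unfolding uniformly_continuous_on_def using \<epsilon> by meson
  define \<delta> where "\<delta> = min 1 (d / 3)"
  have \<delta>: "0 < \<delta>" "\<delta> \<le> 1" "2 * \<delta> < d" using d(1) by (auto simp: \<delta>_def)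
  show ?thesis
  proof (intro exI[of _ \<delta>] conjI ballI impI \<delta>(1))
    fix x y assume x: "x \<in> space (borel_k k)" and y: "y \<in> space (borel_k k)"
      and "\<forall>j\<in>{1..k}. \<bar>y j - x j\<bar> < \<delta>"
    then have xy: "\<And>j. j \<in> {1..k} \<Longrightarrow> \<bar>y j - x j\<bar> < \<delta>" by blast
    have ext: "x i = undefined" "y i = undefined" if "i \<notin> {1..k}" for i
      using x y that by (auto simp: space_PiM PiE_def extensional_def)
    show "\<bar>h y - h x\<bar> \<le> \<epsilon>"
    proof (cases "\<exists>j\<in>{1..k}. \<bar>x j\<bar> > L + 1 \<or> \<bar>y j\<bar> > L + 1")
      case True
      then obtain j where j: "j \<in> {1..k}" "\<bar>x j\<bar> > L + 1 \<or> \<bar>y j\<bar> > L + 1" by blast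
      \<comment> \<open>As \<delta> \<le> 1, a point beyond the margin forces the other one outside
        the support in the same coordinate, so both values are 0.\<close>
      then have "\<bar>x j\<bar> > L" "\<bar>y j\<bar> > L" using xy[OF j(1)] \<delta>(2) by linarith+
      then show ?thesis using supp[OF j(1)] \<epsilon> by simp
    next
      case False
      then have "x \<in> K" "y \<in> K" unfolding K_def using ext by (force simp: PiE_UNIV_domain not_less abs_le_iff)+
      moreover have "dist y x \<le> 2 * \<delta>"
      proof (rule dist_fun_le)
        fix i show "\<bar>y i - x i\<bar> \<le> \<delta>" using xy[of i] ext[of i] \<delta>(1) by (cases "i \<in> {1..k}") auto
      qed
      ultimately show ?thesis using d(2)[of x y] \<delta>(3) by (auto simp: dist_real_def)
    qed
  qed
qed

lemma compact_test_converges: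
  fixes h :: "(nat \<Rightarrow> real) \<Rightarrow> real"
  assumes P: "\<And>n. prob_space (\<mu> n)" and s: "\<And>n. sets (\<mu> n) = sets (borel_k k)"
    and lim: "\<And>s. (\<lambda>n. char_k k (\<mu> n) s) \<longlonglongrightarrow> exp (- (\<Sum>j\<in>{1..k}. (s j)^2) / 2)"
    and c: "continuous_on UNIV h" and b: "\<And>x. \<bar>h x\<bar> \<le> B"
    and supp: "\<And>x j. j \<in> {1..k} \<Longrightarrow> \<bar>x j\<bar> > L \<Longrightarrow> h x = 0"
  shows "(\<lambda>n. \<integral>x. h x \<partial>\<mu> n) \<longlonglongrightarrow> (\<integral>x. h x \<partial>std_normal_k k)"
proof (rule LIMSEQ_I)
  fix \<epsilon> :: real assume \<epsilon>: "0 < \<epsilon>"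
  \<comment> \<open>The smoothing error is at most 2\<eta> under each of the two measures, and the
    smoothed integrals differ by less than \<eta>: a total below 5\<eta>.\<close>
  define \<eta> where "\<eta> = \<epsilon> / 6"
  have \<eta>: "0 < \<eta>" using \<epsilon> by (simp add: \<eta>_def)
  interpret compact_test k h B L
    by standard (use continuous_imp_borel_k_measurable[OF c] b supp in auto)
  have uniform: "\<exists>\<delta>>0. \<forall>x\<in>space (borel_k k). \<forall>y\<in>space (borel_k k).
      (\<forall>j\<in>{1..k}. \<bar>y j - x j\<bar> < \<delta>) \<longrightarrow> \<bar>h y - h x\<bar> \<le> \<eta>"
    by (rule compactly_supported_uniform[OF c _ \<eta>]) (erule (1) supp)
  obtain \<delta> where \<delta>: "0 < \<delta>" "\<forall>x\<in>space (borel_k k). \<forall>y\<in>space (borel_k k).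
      (\<forall>j\<in>{1..k}. \<bar>y j - x j\<bar> < \<delta>) \<longrightarrow> \<bar>h y - h x\<bar> \<le> \<eta>"
    using uniform by blast
  define C where "C = 2 * B * real k"
  have C: "0 \<le> C" using B_nonneg by (simp add: C_def)
  \<comment> \<open>Chosen so that C \<sigma>^2 / \<delta>^2 = C \<eta> / (C + 1) \<le> \<eta>; the
    summand 1 covers C = 0.\<close>
  define \<sigma> where "\<sigma> = \<delta> * sqrt (\<eta> / (C + 1))"
  have \<sigma>: "0 < \<sigma>" using \<delta>(1) \<eta> C by (simp add: \<sigma>_def)
  have "C * \<sigma>^2 / \<delta>^2 = C * (\<eta> / (C + 1))"
    using \<delta>(1) \<eta> C by (simp add: \<sigma>_def power_mult_distrib)
  also have "\<dots> \<le> \<eta>" using C \<eta> by (simp add: field_simps)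
  finally have le: "C * \<sigma>^2 / \<delta>^2 \<le> \<eta>" .
  have close: "\<bar>gauss_smooth k \<sigma> h x - h x\<bar> \<le> 2 * \<eta>" if "x \<in> space (borel_k k)" for x
  proof -
    have "\<bar>gauss_smooth k \<sigma> h x - h x\<bar> \<le> \<eta> + 2 * B * real k * \<sigma>^2 / \<delta>^2"
      by (rule gauss_smooth_close[OF \<sigma> \<delta>(1) less_imp_le[OF \<eta>] that])
        (rule \<delta>(2)[rule_format, OF that], auto)
    then show ?thesis using le unfolding C_def by linarith
  qed
  have I: "\<bar>(\<integral>x. gauss_smooth k \<sigma> h x \<partial>M) - (\<integral>x. h x \<partial>M)\<bar> \<le> 2 * \<eta>"
    if PM: "prob_space M" and sM: "sets M = sets (borel_k k)" for M
  proof -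
    interpret M: prob_space M by (rule PM)
    have hM: "h \<in> borel_measurable M" using h_measurable measurable_cong_sets[OF sM refl] by blast
    have hI: "integrable M h" by (rule M.integrable_const_bound[where B=B]) (use b hM in auto)
    note gI = integral_gauss_smooth(1)[OF PM sM \<sigma>]
    have "\<bar>\<integral>x. gauss_smooth k \<sigma> h x - h x \<partial>M\<bar> \<le> (\<integral>x. \<bar>gauss_smooth k \<sigma> h x - h x\<bar> \<partial>M)"
      by (rule integral_abs_bound)
    also have "\<dots> \<le> (\<integral>x. 2 * \<eta> \<partial>M)"
      using gI hI close sets_eq_imp_space_eq[OF sM] by (intro integral_mono) auto
    finally show ?thesis using gI hI by (simp add: M.prob_space)
  qed
  obtain N where N: "\<And>n. n \<ge> N \<Longrightarrow>
      norm ((\<integral>x. gauss_smooth k \<sigma> h x \<partial>\<mu> n) - (\<integral>x. gauss_smooth k \<sigma> h x \<partial>std_normal_k k)) < \<eta>"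
    using LIMSEQ_D[OF gauss_smooth_converges[OF P s lim \<sigma>] \<eta>] by blast
  show "\<exists>no. \<forall>n\<ge>no. norm ((\<integral>x. h x \<partial>\<mu> n) - (\<integral>x. h x \<partial>std_normal_k k)) < \<epsilon>"
  proof (intro exI allI impI)
    fix n assume "n \<ge> N"
    from N[OF this] I[OF P s, of n] I[OF prob_space_std_normal_k sets_std_normal_k]
    show "norm ((\<integral>x. h x \<partial>\<mu> n) - (\<integral>x. h x \<partial>std_normal_k k)) < \<epsilon>"
      using \<epsilon> unfolding real_norm_def \<eta>_def by linarith
  qed
qed

section \<open>Tightness and bounded continuous test functions\<close>

definition cutoff_k :: "nat \<Rightarrow> real \<Rightarrow> (nat \<Rightarrow> real) \<Rightarrow> real" where
  "cutoff_k k L x = (\<Prod>j\<in>{1..k}. max 0 (min 1 (L + 1 - \<bar>x j\<bar>)))"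

lemma cutoff_k_bounds: "0 \<le> cutoff_k k L x" "cutoff_k k L x \<le> 1"
  by (auto simp: cutoff_k_def intro!: prod_nonneg prod_le_1)

lemma cutoff_k_support: "j \<in> {1..k} \<Longrightarrow> \<bar>x j\<bar> > L + 1 \<Longrightarrow> cutoff_k k L x = 0"
  unfolding cutoff_k_def by (rule prod_zero) (auto intro!: bexI[of _ j])

lemma cutoff_k_continuous: "continuous_on UNIV (cutoff_k k L)"
proof -
  have "continuous_on UNIV (\<lambda>x :: nat \<Rightarrow> real. x j)" for j
    by (rule continuous_on_product_then_coordinatewise) (rule continuous_on_id)
  then show ?thesis unfolding cutoff_k_def[abs_def] by (intro continuous_intros)
qed

lemma cutoff_k_tight:
  assumes \<epsilon>: "0 < \<epsilon>"
  obtains L where "1 - \<epsilon> < (\<integral>x. cutoff_k k L x \<partial>std_normal_k k)"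
proof -
  interpret N: prob_space "std_normal_k k" by (rule prob_space_std_normal_k)
  have m: "cutoff_k k L \<in> borel_measurable (std_normal_k k)" for L
    using continuous_imp_borel_k_measurable[OF cutoff_k_continuous] measurable_cong_sets[OF sets_std_normal_k refl] by blast
  have "(\<lambda>n. \<integral>x. cutoff_k k (real n) x \<partial>std_normal_k k) \<longlonglongrightarrow> (\<integral>x. 1 \<partial>std_normal_k k)"
  proof (rule integral_dominated_convergence[where w="\<lambda>_. 1"])
    show "AE x in std_normal_k k. (\<lambda>n. cutoff_k k (real n) x) \<longlonglongrightarrow> 1"
    proof (rule AE_I2)
      fix x :: "nat \<Rightarrow> real"
      have "\<forall>\<^sub>F n in sequentially. \<forall>j\<in>{1..k}. \<bar>x j\<bar> \<le> real n"
      proof (intro eventually_ball_finite ballI)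
        fix j
        show "\<forall>\<^sub>F n in sequentially. \<bar>x j\<bar> \<le> real n"
          using filterlim_real_sequentially unfolding filterlim_at_top by blast
      qed simp
      then have "\<forall>\<^sub>F n in sequentially. cutoff_k k (real n) x = 1"
        by eventually_elim (auto simp: cutoff_k_def intro!: prod.neutral)
      then show "(\<lambda>n. cutoff_k k (real n) x) \<longlonglongrightarrow> 1" by (rule tendsto_eventually)
    qed
    show "AE x in std_normal_k k. norm (cutoff_k k (real n) x) \<le> 1" for n
      using cutoff_k_bounds by (intro AE_I2) simp
  qed (use m in auto)
  then have "(\<lambda>n. \<integral>x. cutoff_k k (real n) x \<partial>std_normal_k k) \<longlonglongrightarrow> 1" by (simp add: N.prob_space)
  then have "\<forall>\<^sub>F n in sequentially. 1 - \<epsilon> < (\<integral>x. cutoff_k k (real n) x \<partial>std_normal_k k)"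
    using \<epsilon> by (intro order_tendstoD(1)) auto
  then show ?thesis using that by (auto simp: eventually_sequentially)
qed

text \<open>Tightness of the sequence is derived: the cutoff is itself a compactly supported test
  function, so its integrals converge to a limit above 1 - \<eta>. Truncating \<open>f\<close> by
  the cutoff then costs at most \<open>B\<close> times the mass that the cutoff loses.\<close>

theorem levy_continuity_k:
  fixes f :: "(nat \<Rightarrow> real) \<Rightarrow> real"
  assumes P: "\<And>n. prob_space (\<mu> n)" and s: "\<And>n. sets (\<mu> n) = sets (borel_k k)"
    and lim: "\<And>s. (\<lambda>n. char_k k (\<mu> n) s) \<longlonglongrightarrow> exp (- (\<Sum>j\<in>{1..k}. (s j)^2) / 2)"
    and c: "continuous_on UNIV f" and b: "\<And>x. \<bar>f x\<bar> \<le> B"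
  shows "(\<lambda>n. \<integral>x. f x \<partial>\<mu> n) \<longlonglongrightarrow> (\<integral>x. f x \<partial>std_normal_k k)"
proof (rule LIMSEQ_I)
  fix \<epsilon> :: real assume \<epsilon>: "0 < \<epsilon>"
  have B: "0 \<le> B" using b[of undefined] by linarith
  \<comment> \<open>Each of the two truncation errors is at most \<epsilon>/4, leaving \<epsilon>/2
    for the truncated integrals; B + 1 replaces B in case B = 0.\<close>
  define \<eta> where "\<eta> = \<epsilon> / (4 * (B + 1))"
  have \<eta>: "0 < \<eta>" using \<epsilon> B by (simp add: \<eta>_def)
  obtain L where L: "1 - \<eta> < (\<integral>x. cutoff_k k L x \<partial>std_normal_k k)" using cutoff_k_tight[OF \<eta>] by blast
  let ?h = "\<lambda>x. f x * cutoff_k k L x"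
  have chi: "(\<lambda>n. \<integral>x. cutoff_k k L x \<partial>\<mu> n) \<longlonglongrightarrow> (\<integral>x. cutoff_k k L x \<partial>std_normal_k k)"
    by (rule compact_test_converges[OF P s lim, where B=1 and L="L+1"])
      (use cutoff_k_bounds cutoff_k_support cutoff_k_continuous in auto)
  have hc: "(\<lambda>n. \<integral>x. ?h x \<partial>\<mu> n) \<longlonglongrightarrow> (\<integral>x. ?h x \<partial>std_normal_k k)"
  proof (rule compact_test_converges[OF P s lim, where B=B and L="L+1"])
    show "continuous_on UNIV ?h" by (intro continuous_intros c cutoff_k_continuous)
    show "\<bar>?h x\<bar> \<le> B" for x
    proof -
      have "\<bar>f x\<bar> * \<bar>cutoff_k k L x\<bar> \<le> B * 1"
        using b cutoff_k_bounds[of k L x] B by (intro mult_mono) auto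
      then show ?thesis by (simp add: abs_mult)
    qed
  qed (use cutoff_k_support in auto)
  have I: "\<bar>(\<integral>x. f x \<partial>M) - (\<integral>x. ?h x \<partial>M)\<bar> \<le> B * (1 - (\<integral>x. cutoff_k k L x \<partial>M))"
    if PM: "prob_space M" and sM: "sets M = sets (borel_k k)" for M
  proof -
    interpret M: prob_space M by (rule PM)
    have fM: "f \<in> borel_measurable M" and cM: "cutoff_k k L \<in> borel_measurable M"
      using continuous_imp_borel_k_measurable[OF c] continuous_imp_borel_k_measurable[OF cutoff_k_continuous]
        measurable_cong_sets[OF sM refl] by blast+
    have fI: "integrable M f" by (rule M.integrable_const_bound[where B=B]) (use b fM in auto)
    have cI: "integrable M (cutoff_k k L)" by (rule M.integrable_const_bound[where B=1]) (use cutoff_k_bounds cM in auto)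
    have hI: "integrable M ?h"
      by (rule Bochner_Integration.integrable_bound[OF fI]) (use fM cM cutoff_k_bounds in \<open>auto simp: abs_mult intro!: mult_left_le\<close>)
    have "\<bar>\<integral>x. f x - ?h x \<partial>M\<bar> \<le> (\<integral>x. \<bar>f x - ?h x\<bar> \<partial>M)" by (rule integral_abs_bound)
    also have "\<dots> \<le> (\<integral>x. B * (1 - cutoff_k k L x) \<partial>M)"
    proof (rule integral_mono)
      show "\<bar>f x - ?h x\<bar> \<le> B * (1 - cutoff_k k L x)" for x
      proof -
        have "f x - ?h x = f x * (1 - cutoff_k k L x)" by (simp add: algebra_simps)
        then have "\<bar>f x - ?h x\<bar> = \<bar>f x\<bar> * (1 - cutoff_k k L x)" using cutoff_k_bounds[of k L x] by (simp add: abs_mult)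
        also have "\<dots> \<le> B * (1 - cutoff_k k L x)" using b cutoff_k_bounds[of k L x] by (intro mult_right_mono) auto
        finally show ?thesis .
      qed
    qed (use fI hI cI in auto)
    finally show ?thesis using fI hI cI by (simp add: M.prob_space)
  qed
  have "\<forall>\<^sub>F n in sequentially. 1 - \<eta> < (\<integral>x. cutoff_k k L x \<partial>\<mu> n)"
    using order_tendstoD(1)[OF chi L] .
  moreover have "\<forall>\<^sub>F n in sequentially. dist (\<integral>x. ?h x \<partial>\<mu> n) (\<integral>x. ?h x \<partial>std_normal_k k) < \<epsilon> / 2"
    using tendstoD[OF hc, of "\<epsilon> / 2"] \<epsilon> by simp
  ultimately have "\<forall>\<^sub>F n in sequentially. norm ((\<integral>x. f x \<partial>\<mu> n) - (\<integral>x. f x \<partial>std_normal_k k)) < \<epsilon>"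
  proof eventually_elim
    case (elim n)
    have "B * (1 - (\<integral>x. cutoff_k k L x \<partial>\<mu> n)) \<le> B * \<eta>"
      using elim(1) B by (intro mult_left_mono) auto
    moreover have "B * (1 - (\<integral>x. cutoff_k k L x \<partial>std_normal_k k)) \<le> B * \<eta>"
      using L B by (intro mult_left_mono) auto
    moreover have "B * \<eta> \<le> \<epsilon> / 4"
    proof -
      have "B * \<eta> \<le> (B + 1) * \<eta>" using \<eta> by simp
      also have "\<dots> = \<epsilon> / 4"
      proof -
        have "\<eta> * (4 * (B + 1)) = \<epsilon>" unfolding \<eta>_def using B by (intro nonzero_eq_divide_eq[THEN iffD1, OF _ refl]) auto
        then show ?thesis by (simp add: algebra_simps)
      qed
      finally show ?thesis .
    qed
    ultimately show ?case
      using I[OF P s, of n] I[OF prob_space_std_normal_k sets_std_normal_k] elim(2)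
      unfolding real_norm_def dist_real_def by linarith
  qed
  then show "\<exists>no. \<forall>n\<ge>no. norm ((\<integral>x. f x \<partial>\<mu> n) - (\<integral>x. f x \<partial>std_normal_k k)) < \<epsilon>"
    by (simp add: eventually_sequentially)
qed

text \<open>The definition tests functions that are continuous only on the extensional points.
  Composing with restriction to 1..k extends such an \<open>f\<close> continuously to all functions
  and leaves it unchanged on the values of \<open>X\<close>.\<close>

lemma conv_distr_kI:
  fixes P :: "nat \<Rightarrow> 'a pmf"
  assumes ext: "\<And>n \<omega>. X n \<omega> \<in> extensional {1..k}"
    and lim: "\<And>s. (\<lambda>n. measure_pmf.expectation (P n) (\<lambda>\<omega>. iexp (\<Sum>j\<in>{1..k}. s j * X n \<omega> j)))
        \<longlonglongrightarrow> exp (- (\<Sum>j\<in>{1..k}. (s j)^2) / 2)"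
  shows "conv_distr_k k P X (std_normal_k k)"
  unfolding conv_distr_k_def
proof (intro allI impI)
  fix f :: "(nat \<Rightarrow> real) \<Rightarrow> real"
  let ?E = "PiE {1..k} (\<lambda>_. UNIV :: real set)"
  assume c: "continuous_on ?E f" and "\<exists>B. \<forall>x\<in>?E. \<bar>f x\<bar> \<le> B"
  then obtain B where B: "\<And>x. x \<in> ?E \<Longrightarrow> \<bar>f x\<bar> \<le> B" by blast
  define f' where "f' x = f (restrict x {1..k})" for x
  have r: "restrict x {1..k} \<in> ?E" for x :: "nat \<Rightarrow> real" by auto
  have c': "continuous_on UNIV f'"
    unfolding f'_def
  proof (rule continuous_on_compose2[OF c])
    show "continuous_on UNIV (\<lambda>x :: nat \<Rightarrow> real. restrict x {1..k})"
    proof (rule continuous_on_coordinatewise_then_product)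
      fix i
      have "continuous_on UNIV (\<lambda>x :: nat \<Rightarrow> real. x i)"
        by (rule continuous_on_product_then_coordinatewise) (rule continuous_on_id)
      then show "continuous_on UNIV (\<lambda>x :: nat \<Rightarrow> real. restrict x {1..k} i)"
        by (cases "i \<in> {1..k}") auto
    qed
  qed auto
  define \<mu> where "\<mu> n = distr (measure_pmf (P n)) (borel_k k) (X n)" for n
  have Xm [measurable]: "X n \<in> measurable (measure_pmf (P n)) (borel_k k)" for n
  proof -
    have "X n \<omega> \<in> space (borel_k k)" for \<omega> by (simp add: space_PiM PiE_def ext del: One_nat_def)
    then show ?thesis by (intro measurableI) (simp_all del: One_nat_def)
  qed
  have pr: "prob_space (\<mu> n)" for n
    unfolding \<mu>_def by (rule measure_pmf.prob_space_distr) (rule Xm)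
  have se: "sets (\<mu> n) = sets (borel_k k)" for n by (simp add: \<mu>_def)
  have "(\<lambda>n. char_k k (\<mu> n) s) \<longlonglongrightarrow> exp (- (\<Sum>j\<in>{1..k}. (s j)^2) / 2)" for s
    using lim[of s] unfolding char_k_def \<mu>_def by (subst integral_distr[OF Xm]) auto
  then have "(\<lambda>n. \<integral>x. f' x \<partial>\<mu> n) \<longlonglongrightarrow> (\<integral>x. f' x \<partial>std_normal_k k)"
    by (rule levy_continuity_k[OF pr se _ c', where B=B]) (use B r in \<open>auto simp: f'_def\<close>)
  moreover have "(\<integral>x. f' x \<partial>\<mu> n) = measure_pmf.expectation (P n) (\<lambda>\<omega>. f (X n \<omega>))" for n
    unfolding \<mu>_def
    by (subst integral_distr[OF Xm continuous_imp_borel_k_measurable[OF c']])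
      (simp only: f'_def extensional_restrict[OF ext])
  moreover have "(\<integral>x. f' x \<partial>std_normal_k k) = integral\<^sup>L (std_normal_k k) f"
  proof (rule Bochner_Integration.integral_cong[OF refl])
    fix x assume "x \<in> space (std_normal_k k)"
    then have "x \<in> extensional {1..k}"
      using sets_eq_imp_space_eq[OF sets_std_normal_k, of k] by (auto simp: space_PiM PiE_def)
    then show "f' x = f x" by (simp add: f'_def extensional_restrict)
  qed
  ultimately show "(\<lambda>n. measure_pmf.expectation (P n) (\<lambda>\<omega>. f (X n \<omega>))) \<longlonglongrightarrow> integral\<^sup>L (std_normal_k k) f"
    by (simp only:)
qed

section \<open>Weighted sums of independent Bernoulli variables\<close>

lemma exp_neg_lipschitz: "0 \<le> a \<Longrightarrow> 0 \<le> b \<Longrightarrow> \<bar>exp (- a) - exp (- b)\<bar> \<le> \<bar>a - b\<bar>" for a b :: real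
proof (induction a b rule: linorder_wlog)
  case (le a b)
  have *: "1 - exp (- (b - a)) \<le> b - a" using exp_ge_add_one_self[of "- (b - a)"] by linarith
  have "exp (- a) - exp (- b) = exp (- a) * (1 - exp (- (b - a)))"
    by (simp add: right_diff_distrib exp_add[symmetric])
  also have "\<dots> \<le> 1 * (b - a)"
    using le by (intro mult_mono *) auto
  finally show ?case using le by simp
qed (simp add: abs_minus_commute)

lemma iexp_lipschitz: "cmod (iexp x - iexp y) \<le> \<bar>x - y\<bar>"
proof -
  have "iexp x - iexp y = iexp y * (iexp (x - y) - 1)"
    by (simp add: right_diff_distrib exp_add[symmetric])
  then have "cmod (iexp x - iexp y) = cmod (iexp (x - y) - 1)" by (simp add: norm_mult)
  also have "\<dots> \<le> \<bar>x - y\<bar>" using iexp_approx1[of "x - y" 0] by simp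
  finally show ?thesis .
qed

locale bernoulli_field =
  fixes E :: "'e set" and p :: "'e \<Rightarrow> real"
  assumes fin: "finite E" and p01: "\<And>e. 0 < p e" "\<And>e. p e < 1"
begin

definition edge_pmf :: "('e \<Rightarrow> bool) pmf" where
  "edge_pmf = Pi_pmf E False (\<lambda>e. bernoulli_pmf (p e))"

definition noise :: "'e \<Rightarrow> ('e \<Rightarrow> bool) \<Rightarrow> real" where
  "noise e A = of_bool (A e) - p e"

lemma expectation_coordinate:
  fixes f :: "bool \<Rightarrow> 'b :: {banach, second_countable_topology}"
  assumes e: "e \<in> E"
  shows "measure_pmf.expectation edge_pmf (\<lambda>A. f (A e)) = p e *\<^sub>R f True + (1 - p e) *\<^sub>R f False"
proof -
  have "bernoulli_pmf (p e) = map_pmf (\<lambda>A. A e) edge_pmf"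
    using Pi_pmf_component[OF fin, of e False "\<lambda>e. bernoulli_pmf (p e)"] e by (simp add: edge_pmf_def)
  then have "measure_pmf.expectation edge_pmf (\<lambda>A. f (A e)) = measure_pmf.expectation (bernoulli_pmf (p e)) f"
    by simp
  also have "\<dots> = (\<Sum>b\<in>UNIV. pmf (bernoulli_pmf (p e)) b *\<^sub>R f b)"
    by (rule integral_measure_pmf) auto
  finally show ?thesis using p01[of e] by (simp add: UNIV_bool)
qed

lemma indep_noise:
  "prob_space.indep_vars (measure_pmf edge_pmf) (\<lambda>_. borel) (\<lambda>e A. c e * noise e A) E"
proof -
  have i: "prob_space.indep_vars (measure_pmf edge_pmf) (\<lambda>_. count_space UNIV) (\<lambda>x f. f x) E"
    unfolding edge_pmf_def by (rule indep_vars_Pi_pmf[OF fin])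
  show ?thesis
    using prob_space.indep_vars_compose2[OF measure_pmf.prob_space_axioms i, of "\<lambda>e b. c e * (of_bool b - p e)" "\<lambda>_. borel"]
    by (simp add: noise_def)
qed

lemma expectation_noise:
  assumes "e \<in> E" shows "measure_pmf.expectation edge_pmf (\<lambda>A. c * noise e A) = 0"
  using expectation_coordinate[OF assms, of "\<lambda>b. c * (of_bool b - p e)"]
  by (simp add: noise_def algebra_simps)

text \<open>Hoeffding's inequality: a summand ranges over an interval of length |c e|, whatever
  \<open>p e\<close> is. The parameter \<open>V\<close> lets an explicit bound replace the sum of
  squares.\<close>

lemma noise_tail:
  assumes V: "(\<Sum>e\<in>E. (c e)^2) \<le> V" and t: "0 < t"
  shows "measure_pmf.prob edge_pmf {A. t \<le> \<bar>\<Sum>e\<in>E. c e * noise e A\<bar>} \<le> 2 * exp (- 2 * t^2 / V)"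
proof (cases "(\<Sum>e\<in>E. (c e)^2) = 0")
  \<comment> \<open>All weights vanish. Hoeffding's inequality needs a positive sum of squared
    ranges, so this case is separate.\<close>
  case True
  then have "c e = 0" if "e \<in> E" for e using that fin by (simp add: sum_nonneg_eq_0_iff)
  then have "{A. t \<le> \<bar>\<Sum>e\<in>E. c e * noise e A\<bar>} = {}" using t by simp
  then show ?thesis by simp
next
  case False
  then have pos: "0 < (\<Sum>e\<in>E. (c e)^2)" using sum_nonneg[of E "\<lambda>e. (c e)^2"] by simp
  define a where "a e = min (c e * (1 - p e)) (c e * (0 - p e))" for e
  define b where "b e = max (c e * (1 - p e)) (c e * (0 - p e))" for e
  have ba: "(b e - a e)^2 = (c e)^2" for e
    by (auto simp: a_def b_def min_def max_def power2_eq_square algebra_simps)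
  interpret H: Hoeffding_ineq "measure_pmf edge_pmf" E "\<lambda>e A. c e * noise e A" a b 0
  proof unfold_locales
    show "finite E" by (rule fin)
    show "prob_space.indep_vars (measure_pmf edge_pmf) (\<lambda>_. borel) (\<lambda>e A. c e * noise e A) E" by (rule indep_noise)
    show "AE A in measure_pmf edge_pmf. c e * noise e A \<in> {a e..b e}" for e
      by (rule AE_pmfI) (auto simp: a_def b_def noise_def of_bool_def)
    show "0 \<equiv> \<Sum>e\<in>E. measure_pmf.expectation edge_pmf (\<lambda>A. c e * noise e A)"
      by (intro eq_reflection sum.neutral[symmetric] ballI expectation_noise)
  qed
  have "measure_pmf.prob edge_pmf {A. t \<le> \<bar>\<Sum>e\<in>E. c e * noise e A\<bar>} \<le> 2 * exp (- 2 * t^2 / (\<Sum>e\<in>E. (c e)^2))"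
    using H.Hoeffding_ineq_abs_ge[of t] t pos by (simp add: ba)
  also have "\<dots> \<le> 2 * exp (- 2 * t^2 / V)"
    using V pos by (auto intro!: divide_left_mono mult_pos_pos)
  finally show ?thesis .
qed

text \<open>Second-order expansion of a two-point characteristic function; the linear term vanishes
  since the noise is centred. The error keeps a factor of the variance, so that errors summed over
  edges are measured against the total variance and not against the number of edges.\<close>

lemma char_coordinate_approx:
  assumes e: "e \<in> E" and c: "\<bar>c\<bar> \<le> 1"
  shows "cmod (measure_pmf.expectation edge_pmf (\<lambda>A. iexp (c * noise e A)) - exp (- (c^2 * (p e * (1 - p e)) / 2)))
      \<le> \<bar>c\<bar> * (c^2 * (p e * (1 - p e)))"
proof -
  define q where "q = p e"
  define s2 where "s2 = q * (1 - q)"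
  have q: "0 < q" "q < 1" using p01[of e] by (auto simp: q_def)
  have s2: "0 \<le> s2" "s2 \<le> 1" using q by (auto simp: s2_def mult_le_one)
  define r where "r x = iexp x - (1 + \<i> * complex_of_real x - complex_of_real (x^2) / 2)" for x
  have r: "cmod (r x) \<le> \<bar>x\<bar>^3 / 6" for x
    using iexp_approx1[of x 2] by (simp add: r_def numeral_eq_Suc power2_eq_square algebra_simps)
  have "measure_pmf.expectation edge_pmf (\<lambda>A. iexp (c * noise e A)) =
      q *\<^sub>R iexp (c * (1 - q)) + (1 - q) *\<^sub>R iexp (c * (0 - q))"
    using expectation_coordinate[OF e, of "\<lambda>b. iexp (c * (of_bool b - p e))"] by (simp add: noise_def q_def)
  also have "\<dots> = complex_of_real (1 - c^2 * s2 / 2) + (q *\<^sub>R r (c * (1 - q)) + (1 - q) *\<^sub>R r (c * (0 - q)))"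
    by (simp add: r_def s2_def scaleR_conv_of_real power2_eq_square algebra_simps add_divide_distrib diff_divide_distrib)
  finally have E: "measure_pmf.expectation edge_pmf (\<lambda>A. iexp (c * noise e A)) =
     complex_of_real (1 - c^2 * s2 / 2) + (q *\<^sub>R r (c * (1 - q)) + (1 - q) *\<^sub>R r (c * (0 - q)))" .
  have R: "cmod (q *\<^sub>R r (c * (1 - q)) + (1 - q) *\<^sub>R r (c * (0 - q))) \<le> \<bar>c\<bar>^3 * s2 / 6"
  proof -
    have "cmod (q *\<^sub>R r (c * (1 - q)) + (1 - q) *\<^sub>R r (c * (0 - q)))
       \<le> q * (\<bar>c * (1 - q)\<bar>^3 / 6) + (1 - q) * (\<bar>c * (0 - q)\<bar>^3 / 6)"
      using q by (intro order_trans[OF norm_triangle_ineq] add_mono)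
        (simp_all only: norm_scaleR abs_of_pos diff_gt_0_iff_gt mult_left_mono[OF r] less_imp_le diff_ge_0_iff_ge)
    \<comment> \<open>The third absolute moment of the noise is s2 ((1 - q)^2 + q^2), at most its
      variance \<open>s2\<close>.\<close>
    also have "\<dots> = \<bar>c\<bar>^3 * s2 / 6 * ((1 - q)^2 + q^2)"
    proof -
      have "\<bar>c * (1 - q)\<bar> = \<bar>c\<bar> * (1 - q)" "\<bar>c * (0 - q)\<bar> = \<bar>c\<bar> * q" using q by (simp_all add: abs_mult)
      then show ?thesis by (simp only:) (simp add: s2_def power2_eq_square power3_eq_cube field_simps)
    qed
    also have "\<dots> \<le> \<bar>c\<bar>^3 * s2 / 6 * 1"
    proof (rule mult_left_mono)
      have "(1 - q)^2 + q^2 = 1 - 2 * s2" by (simp add: s2_def power2_eq_square algebra_simps)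
      then show "(1 - q)^2 + q^2 \<le> 1" using s2 by simp
    qed (use s2 in auto)
    finally show ?thesis by simp
  qed
  define s where "s = c^2 * s2 / 2"
  have s0: "0 \<le> s" using s2 by (simp add: s_def)
  have X: "\<bar>(1 - s) - exp (- s)\<bar> \<le> s^2"
  proof -
    have "1 - s \<le> exp (- s)" using exp_ge_add_one_self[of "- s"] by simp
    moreover have "exp (- s) \<le> 1 - s + s^2"
    proof -
      have "exp (- s) = 1 / exp s" by (simp add: exp_minus inverse_eq_divide)
      also have "\<dots> \<le> 1 / (1 + s)" using exp_ge_add_one_self[of s] s0 by (intro divide_left_mono) auto
      also have "\<dots> \<le> 1 - s + s^2"
      proof -
        have "(1 - s + s^2) * (1 + s) = 1 + s^3" by (simp add: power2_eq_square power3_eq_cube algebra_simps)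
        then have "1 \<le> (1 - s + s^2) * (1 + s)" using s0 by simp
        then show ?thesis using s0 by (simp add: divide_le_eq)
      qed
      finally show ?thesis .
    qed
    ultimately show ?thesis by simp
  qed
  \<comment> \<open>Here |c| s2 \<le> 1 lowers the fourth power of |c| to the third; since 1/6 + 1/4
    < 1, both errors together fit the claimed constant.\<close>
  have S: "s^2 \<le> \<bar>c\<bar>^3 * s2 / 4"
  proof -
    have "s^2 = \<bar>c\<bar>^3 * s2 / 4 * (\<bar>c\<bar> * s2)"
      by (simp add: s_def power2_eq_square power3_eq_cube abs_mult_self_eq)
         (metis (no_types, opaque_lifting) abs_mult_self_eq mult.assoc mult.left_commute)?
    also have "\<dots> \<le> \<bar>c\<bar>^3 * s2 / 4 * 1"
      using s2 c by (intro mult_left_mono mult_le_one) auto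
    finally show ?thesis by simp
  qed
  have "cmod (complex_of_real (1 - s) - exp (- s)) = \<bar>(1 - s) - exp (- s)\<bar>"
    by (metis norm_of_real of_real_diff of_real_exp of_real_minus)
  then have "cmod (measure_pmf.expectation edge_pmf (\<lambda>A. iexp (c * noise e A)) - exp (- s)) \<le> s^2 + \<bar>c\<bar>^3 * s2 / 6"
    unfolding E s_def[symmetric] using R X
    by (smt (verit, ccfv_threshold) add_diff_eq add.commute diff_add_eq norm_triangle_ineq)
  also have "\<dots> \<le> \<bar>c\<bar>^3 * s2"
  proof -
    have "0 \<le> \<bar>c\<bar>^3 * s2" using s2 by simp
    then show ?thesis using S by linarith
  qed
  also have "\<dots> = \<bar>c\<bar> * (c^2 * s2)" by (simp add: power3_eq_cube power2_eq_square)
  finally show ?thesis unfolding s_def s2_def q_def by simp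
qed

text \<open>Independence factorises the expectation, and two products of numbers in the closed unit
  disc differ by at most the sum of the differences of their factors.\<close>

lemma char_noise_sum_approx:
  assumes c: "\<And>e. e \<in> E \<Longrightarrow> \<bar>c e\<bar> \<le> \<delta>" and d: "\<delta> \<le> 1"
  shows "cmod (measure_pmf.expectation edge_pmf (\<lambda>A. iexp (\<Sum>e\<in>E. c e * noise e A))
            - exp (- ((\<Sum>e\<in>E. (c e)^2 * (p e * (1 - p e))) / 2)))
      \<le> \<delta> * (\<Sum>e\<in>E. (c e)^2 * (p e * (1 - p e)))"
proof -
  let ?z = "\<lambda>e. measure_pmf.expectation edge_pmf (\<lambda>A. iexp (c e * noise e A))"
  let ?w = "\<lambda>e. complex_of_real (exp (- ((c e)^2 * (p e * (1 - p e)) / 2)))"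
  have pq: "0 \<le> p e * (1 - p e)" for e using p01[of e] by simp
  have "measure_pmf.expectation edge_pmf (\<lambda>A. iexp (\<Sum>e\<in>E. c e * noise e A)) = (\<Prod>e\<in>E. ?z e)"
    using prob_space.char_distr_sum[OF measure_pmf.prob_space_axioms indep_noise, of c 1] by (simp add: char_def integral_distr)
  moreover have "complex_of_real (exp (- ((\<Sum>e\<in>E. (c e)^2 * (p e * (1 - p e))) / 2))) = (\<Prod>e\<in>E. ?w e)"
    by (simp only: sum_divide_distrib sum_negf[symmetric] exp_sum[OF fin] of_real_prod)
  moreover have "cmod ((\<Prod>e\<in>E. ?z e) - (\<Prod>e\<in>E. ?w e)) \<le> (\<Sum>e\<in>E. cmod (?z e - ?w e))"
  proof (rule norm_prod_diff)
    show "cmod (?z e) \<le> 1" for e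
      by (rule order_trans[OF integral_norm_bound]) simp
    show "cmod (?w e) \<le> 1" for e using pq[of e] by (simp add: norm_of_real del: of_real_exp)
  qed
  moreover have "(\<Sum>e\<in>E. cmod (?z e - ?w e)) \<le> (\<Sum>e\<in>E. \<delta> * ((c e)^2 * (p e * (1 - p e))))"
  proof (rule sum_mono)
    fix e assume e: "e \<in> E"
    have "cmod (?z e - ?w e) \<le> \<bar>c e\<bar> * ((c e)^2 * (p e * (1 - p e)))"
      by (rule char_coordinate_approx) (use e c[OF e] d in auto)
    also have "\<dots> \<le> \<delta> * ((c e)^2 * (p e * (1 - p e)))"
      using c[OF e] pq[of e] by (intro mult_right_mono) auto
    finally show "cmod (?z e - ?w e) \<le> \<delta> * ((c e)^2 * (p e * (1 - p e)))" .
  qed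
  ultimately show ?thesis by (simp add: sum_distrib_left)
qed

end

section \<open>Asymptotic normality\<close>

lemma finite_offdiag: "finite (offdiag n)"
  by (rule finite_subset[of _ "{1..n} \<times> {1..n}"]) (auto simp: offdiag_def)

lemma sum_offdiag:
  fixes f :: "nat \<times> nat \<Rightarrow> real"
  shows "(\<Sum>e\<in>offdiag n. f e) = (\<Sum>i\<in>{1..n}. \<Sum>j\<in>{1..n} - {i}. f (i, j))"
proof -
  have "offdiag n = (SIGMA i:{1..n}. {1..n} - {i})" by (auto simp: offdiag_def)
  then show ?thesis by (simp add: sum.Sigma)
qed

text \<open>The floor \<open>m\<close> is required on unit neighbourhoods of the true log-odds,
  since the mean value points of the box argument lie there.\<close>

locale edge_model =
  fixes n :: nat and \<theta> :: "nat \<Rightarrow> real" and m :: real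
  assumes n3: "n \<ge> 3" and m0: "0 < m"
    and u_lower: "\<And>i j z. i \<in> {1..n} \<Longrightarrow> j \<in> {1..n} \<Longrightarrow> i \<noteq> j \<Longrightarrow> \<bar>z - log_odds n \<theta> i j\<bar> \<le> 1 \<Longrightarrow> m \<le> u_fun z"
begin

sublocale bernoulli_field "offdiag n" "\<lambda>e. logistic (log_odds n \<theta> (fst e) (snd e))"
  by standard (simp_all add: finite_offdiag logistic_bounds)

lemma binary_model_eq: "binary_model n \<theta> = edge_pmf"
  unfolding edge_pmf_def by (simp add: binary_model_def log_odds_def case_prod_beta')

definition u where "u i j = u_fun (log_odds n \<theta> i j)"
definition v where "v i = (\<Sum>j\<in>{1..n} - {i}. u i j)"
definition v' where "v' j = (\<Sum>i\<in>{1..n} - {j}. u i j)"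
definition g where "g A i = (\<Sum>j\<in>{1..n} - {i}. noise (i, j) A)"
definition h where "h A j = (\<Sum>i\<in>{1..n} - {j}. noise (i, j) A)"

lemma n1: "real n - 1 > 0" using n3 by simp

lemma u_bounds: "i \<in> {1..n} \<Longrightarrow> j \<in> {1..n} \<Longrightarrow> i \<noteq> j \<Longrightarrow> m \<le> u i j" "0 < u i j" "u i j \<le> 1/4"
  using u_lower[of i j "log_odds n \<theta> i j"] u_fun_pos u_fun_le by (auto simp: u_def)

lemma v_bounds:
  assumes "i \<in> {1..n}"
  shows "(real n - 1) * m \<le> v i" "v i \<le> real n" "(real n - 1) * m \<le> v' i" "v' i \<le> real n"
proof -
  have card: "real (card ({1..n} - {i})) = real n - 1" using assms by (simp add: of_nat_diff)
  have "v i \<le> (real n - 1) * (1/4)" "v' i \<le> (real n - 1) * (1/4)"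
    unfolding v_def v'_def card[symmetric] using u_bounds(3) by (intro sum_bounded_above; simp)+
  moreover have "(real n - 1) * (1/4) \<le> real n" by simp
  ultimately show "v i \<le> real n" "v' i \<le> real n" by (meson order_trans)+
  show "(real n - 1) * m \<le> v i" "(real n - 1) * m \<le> v' i"
    unfolding v_def v'_def card[symmetric] using u_bounds(1) assms by (intro sum_bounded_below; auto)+
qed

lemma v_pos: assumes "i \<in> {1..n}" shows "0 < v i" "0 < v' i"
  using v_bounds[OF assms] mult_pos_pos[OF n1 m0] by linarith+

lemma edge_variance:
  "logistic (log_odds n \<theta> (fst (i, j)) (snd (i, j))) * (1 - logistic (log_odds n \<theta> (fst (i, j)) (snd (i, j)))) = u i j"
  by (simp add: u_def u_fun_alt)

text \<open>Every statistic is brought to the form of one weighted sum over edges, the input of the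
  tail bound and of the characteristic function estimate.\<close>

lemma row_sum_as_edges:
  "i \<in> {1..n} \<Longrightarrow> g A i = (\<Sum>e\<in>offdiag n. of_bool (fst e = i) * noise e A)"
  "j \<in> {1..n} \<Longrightarrow> h A j = (\<Sum>e\<in>offdiag n. of_bool (snd e = j) * noise e A)"
proof -
  assume i: "i \<in> {1..n}"
  have "(\<Sum>e\<in>offdiag n. of_bool (fst e = i) * noise e A) = (\<Sum>i'\<in>{1..n}. if i' = i then g A i else 0)"
    unfolding sum_offdiag by (intro sum.cong) (auto simp: g_def)
  then show "g A i = (\<Sum>e\<in>offdiag n. of_bool (fst e = i) * noise e A)" using i by simp
next
  assume j: "j \<in> {1..n}"
  have "(\<Sum>e\<in>offdiag n. of_bool (snd e = j) * noise e A) = (\<Sum>j'\<in>{1..n}. if j' = j then h A j else 0)"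
    unfolding sum_offdiag by (subst sum_offdiag_swap, intro sum.cong) (auto simp: h_def)
  then show "h A j = (\<Sum>e\<in>offdiag n. of_bool (snd e = j) * noise e A)" using j by simp
qed

lemma mixed_sum_as_edges:
  "i \<in> {1..n} \<Longrightarrow> (\<Sum>j\<in>{1..n} - {i}. u i j * (h A j / v' j)) =
      (\<Sum>e\<in>offdiag n. (if snd e \<noteq> i then u i (snd e) / v' (snd e) else 0) * noise e A)"
  "j \<in> {1..n} \<Longrightarrow> (\<Sum>i\<in>{1..n} - {j}. u i j * (g A i / v i)) =
      (\<Sum>e\<in>offdiag n. (if fst e \<noteq> j then u (fst e) j / v (fst e) else 0) * noise e A)"
proof -
  have "(\<Sum>e\<in>offdiag n. (if snd e \<noteq> i then u i (snd e) / v' (snd e) else 0) * noise e A) =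
      (\<Sum>j\<in>{1..n}. if j \<noteq> i then u i j * (h A j / v' j) else 0)"
    unfolding sum_offdiag by (subst sum_offdiag_swap, intro sum.cong) (auto simp: h_def sum_distrib_left sum_divide_distrib)
  also have "\<dots> = (\<Sum>j\<in>{1..n} - {i}. u i j * (h A j / v' j))"
    by (rule sum.mono_neutral_cong_right) auto
  finally show "(\<Sum>j\<in>{1..n} - {i}. u i j * (h A j / v' j)) =
      (\<Sum>e\<in>offdiag n. (if snd e \<noteq> i then u i (snd e) / v' (snd e) else 0) * noise e A)" ..
next
  have "(\<Sum>e\<in>offdiag n. (if fst e \<noteq> j then u (fst e) j / v (fst e) else 0) * noise e A) =
      (\<Sum>i\<in>{1..n}. if i \<noteq> j then u i j * (g A i / v i) else 0)"
    unfolding sum_offdiag by (intro sum.cong) (auto simp: g_def sum_distrib_left sum_divide_distrib)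
  also have "\<dots> = (\<Sum>i\<in>{1..n} - {j}. u i j * (g A i / v i))"
    by (rule sum.mono_neutral_cong_right) auto
  finally show "(\<Sum>i\<in>{1..n} - {j}. u i j * (g A i / v i)) =
      (\<Sum>e\<in>offdiag n. (if fst e \<noteq> j then u (fst e) j / v (fst e) else 0) * noise e A)" ..
qed

definition good :: "real \<Rightarrow> real \<Rightarrow> (nat \<times> nat \<Rightarrow> bool) set" where
  "good G H = {A. \<forall>i\<in>{1..n}. \<bar>g A i\<bar> < G \<and> \<bar>h A i\<bar> < G \<and>
      \<bar>\<Sum>j\<in>{1..n} - {i}. u i j * (h A j / v' j)\<bar> < H \<and> \<bar>\<Sum>j\<in>{1..n} - {i}. u j i * (g A j / v j)\<bar> < H}"

text \<open>There are n(n - 1) edges with weights of order 1/(n m), so the bound is free of n: the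
  mixed sums fluctuate on the scale 1/m, whereas a single degree can fluctuate on the scale n^(1/2).
  The constant uses n/(n - 1) \<le> 2.\<close>

lemma sum_squares_mixed_le:
  assumes "\<And>e. e \<in> offdiag n \<Longrightarrow> \<bar>c e\<bar> \<le> 1 / (4 * ((real n - 1) * m))"
  shows "(\<Sum>e\<in>offdiag n. (c e)^2) \<le> 1 / (8 * m^2)"
proof -
  have "(\<Sum>e\<in>offdiag n. (c e)^2) \<le> (\<Sum>i\<in>{1..n}. \<Sum>j\<in>{1..n} - {i}. (1 / (4 * ((real n - 1) * m)))^2)"
    unfolding sum_offdiag
    by (intro sum_mono) (use assms in \<open>auto simp: abs_le_square_iff[symmetric] offdiag_def n1 m0 less_imp_le\<close>)
  also have "\<dots> = (\<Sum>i\<in>{1..n}. (real n - 1) * (1 / (4 * ((real n - 1) * m)))^2)"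
    by (intro sum.cong) (auto simp: of_nat_diff)
  also have "\<dots> = real n / (real n - 1) * (1 / (16 * m^2))"
  proof -
    have "N * (r * (1 / (4 * (r * m)))^2) = N / r * (1 / (16 * m^2))" if "r > 0" for N r :: real
      using that m0 by (simp add: power2_eq_square field_simps)
    from this[OF n1] show ?thesis by simp
  qed
  also have "\<dots> \<le> 2 * (1 / (16 * m^2))"
    using n3 m0 by (intro mult_right_mono) (auto simp: field_simps)
  finally show ?thesis by simp
qed

lemma prob_not_good:
  assumes G: "0 < G" and H: "0 < H"
  shows "measure_pmf.prob edge_pmf (- good G H) \<le> 4 * real n * exp (- 2 * G^2 / real n) + 4 * real n * exp (- 16 * H^2 * m^2)"
proof -
  define B1 where "B1 i = {A. G \<le> \<bar>g A i\<bar>}" for i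
  define B2 where "B2 i = {A. G \<le> \<bar>h A i\<bar>}" for i
  define B3 where "B3 i = {A. H \<le> \<bar>\<Sum>j\<in>{1..n} - {i}. u i j * (h A j / v' j)\<bar>}" for i
  define B4 where "B4 i = {A. H \<le> \<bar>\<Sum>j\<in>{1..n} - {i}. u j i * (g A j / v j)\<bar>}" for i
  let ?a = "2 * exp (- 2 * G^2 / real n)" and ?b = "2 * exp (- 16 * H^2 * m^2)"
  have row: "(\<Sum>e\<in>offdiag n. (of_bool (fst e = i))^2) \<le> real n" if "i \<in> {1..n}" for i
  proof -
    have "(\<Sum>e\<in>offdiag n. (of_bool (fst e = i))^2) = (\<Sum>i'\<in>{1..n}. if i' = i then real n - 1 else 0)"
      unfolding sum_offdiag by (intro sum.cong) (use that in \<open>auto simp: of_nat_diff\<close>)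
    then show ?thesis using that by simp
  qed
  have col: "(\<Sum>e\<in>offdiag n. (of_bool (snd e = i))^2) \<le> real n" if "i \<in> {1..n}" for i
  proof -
    have "(\<Sum>e\<in>offdiag n. (of_bool (snd e = i))^2) = (\<Sum>i'\<in>{1..n}. if i' = i then real n - 1 else 0)"
      unfolding sum_offdiag by (subst sum_offdiag_swap, intro sum.cong) (use that in \<open>auto simp: of_nat_diff\<close>)
    then show ?thesis using that by simp
  qed
  have 1: "measure_pmf.prob edge_pmf (B1 i) \<le> ?a" "measure_pmf.prob edge_pmf (B2 i) \<le> ?a" if "i \<in> {1..n}" for i
    unfolding B1_def B2_def row_sum_as_edges[OF that]
    by (rule noise_tail[OF row[OF that] G], rule noise_tail[OF col[OF that] G])
  have q: "\<bar>u i j / w\<bar> \<le> 1 / (4 * ((real n - 1) * m))" if "(real n - 1) * m \<le> w" for i j w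
  proof -
    have p: "0 < (real n - 1) * m" using n1 m0 by simp
    then have "\<bar>u i j / w\<bar> = u i j / w" using u_bounds(2)[of i j] that by simp
    also have "\<dots> \<le> (1/4) / ((real n - 1) * m)"
      using u_bounds(2,3)[of i j] that p by (intro frac_le) auto
    finally show ?thesis by simp
  qed
  \<comment> \<open>The Hoeffding exponent for the sum-of-squares bound 1/(8 m^2) of the mixed
    sums.\<close>
  have e: "- 2 * H^2 / (1 / (8 * m^2)) = - 16 * H^2 * m^2" by simp
  have p: "0 \<le> 1 / (4 * ((real n - 1) * m))" using n1 m0 by simp
  have 3: "measure_pmf.prob edge_pmf (B3 i) \<le> ?b" if i: "i \<in> {1..n}" for i
    unfolding B3_def mixed_sum_as_edges(1)[OF i] e[symmetric]
  proof (intro noise_tail[OF sum_squares_mixed_le H])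
    fix e assume "e \<in> offdiag n"
    then have "snd e \<in> {1..n}" by (auto simp: offdiag_def)
    then show "\<bar>if snd e \<noteq> i then u i (snd e) / v' (snd e) else 0\<bar> \<le> 1 / (4 * ((real n - 1) * m))"
      using q v_bounds(3) p by (cases "snd e = i") auto
  qed
  have 4: "measure_pmf.prob edge_pmf (B4 i) \<le> ?b" if i: "i \<in> {1..n}" for i
    unfolding B4_def mixed_sum_as_edges(2)[OF i] e[symmetric]
  proof (intro noise_tail[OF sum_squares_mixed_le H])
    fix e assume "e \<in> offdiag n"
    then have "fst e \<in> {1..n}" by (auto simp: offdiag_def)
    then show "\<bar>if fst e \<noteq> i then u (fst e) i / v (fst e) else 0\<bar> \<le> 1 / (4 * ((real n - 1) * m))"
      using q v_bounds(1) p by (cases "fst e = i") auto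
  qed
  let ?P = "measure_pmf.prob edge_pmf"
  have sub: "?P (B1 i \<union> B2 i \<union> (B3 i \<union> B4 i)) \<le> 2 * ?a + 2 * ?b" if "i \<in> {1..n}" for i
  proof -
    have "?P (B1 i \<union> B2 i \<union> (B3 i \<union> B4 i)) \<le> (?P (B1 i) + ?P (B2 i)) + (?P (B3 i) + ?P (B4 i))"
      by (intro order_trans[OF measure_Un_le] add_mono measure_Un_le) auto
    then show ?thesis using 1[OF that] 3[OF that] 4[OF that] by linarith
  qed
  have "- good G H \<subseteq> (\<Union>i\<in>{1..n}. B1 i \<union> B2 i \<union> (B3 i \<union> B4 i))"
    unfolding good_def B1_def B2_def B3_def B4_def by (auto simp: not_less)
  then have "?P (- good G H) \<le> ?P (\<Union>i\<in>{1..n}. B1 i \<union> B2 i \<union> (B3 i \<union> B4 i))"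
    by (intro measure_pmf.finite_measure_mono) auto
  also have "\<dots> \<le> (\<Sum>i\<in>{1..n}. ?P (B1 i \<union> B2 i \<union> (B3 i \<union> B4 i)))"
    by (intro measure_pmf.finite_measure_subadditive_finite) auto
  also have "\<dots> \<le> (\<Sum>i\<in>{1..n}. 2 * ?a + 2 * ?b)" by (intro sum_mono sub) auto
  finally show ?thesis by (simp add: algebra_simps)
qed

lemma mle_expansion_good:
  assumes G: "0 < G" and A: "A \<in> good G H" and i: "i \<in> {1..n}"
    and K: "K = 2 * G / ((real n - 1) * m^2)" "K < 1/4"
  shows "\<bar>mle n A i - \<theta> i - (g A i / v i + h A n / v' n)\<bar> \<le> 2 * (real n * K^2 + H) / ((real n - 1) * m^2)"
proof (rule mle_expansion[OF n3 m0 less_imp_le[OF G], where g="g A" and h="h A" and v=v and v'=v' and K=K])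
  show "m \<le> u_fun z" if "i \<in> {1..n}" "j \<in> {1..n}" "i \<noteq> j" "\<bar>z - log_odds n \<theta> i j\<bar> \<le> 1" for i j z
    by (rule u_lower[OF that])
  show "i \<in> {1..n}" "K = 2 * G / ((real n - 1) * m^2)" "K < 1/4" by fact+
  have *: "\<bar>g A i\<bar> < G \<and> \<bar>h A i\<bar> < G \<and>
      \<bar>\<Sum>j\<in>{1..n} - {i}. u i j * (h A j / v' j)\<bar> < H \<and> \<bar>\<Sum>j\<in>{1..n} - {i}. u j i * (g A j / v j)\<bar> < H"
    if "i \<in> {1..n}" for i using A that unfolding good_def by blast
  show "\<bar>g A i\<bar> \<le> G" "\<bar>h A i\<bar> \<le> G" if "i \<in> {1..n}" for i using *[OF that] by linarith+
  show "\<bar>\<Sum>j\<in>{1..n} - {i}. u_fun (log_odds n \<theta> i j) * (h A j / v' j)\<bar> \<le> H" if "i \<in> {1..n}" for i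
    using *[OF that] unfolding u_def by linarith
  show "\<bar>\<Sum>i\<in>{1..n} - {j}. u_fun (log_odds n \<theta> i j) * (g A i / v i)\<bar> \<le> H" if "j \<in> {1..n}" for j
    using *[OF that] unfolding u_def by linarith
qed (simp_all add: g_def h_def v_def v'_def u_def noise_def)

end

section \<open>The matrix S, its quadratic form and the leading term\<close>

context edge_model begin

lemma fisherV_row: "i \<in> {1..n} \<Longrightarrow> fisherV n \<theta> i i = v i"
  by (simp add: fisherV_def v_def u_def log_odds_def)

lemma fisherV_col:
  assumes "j \<in> {1..n-1}" shows "fisherV n \<theta> (n + j) (n + j) = v' j"
proof -
  have "n + j \<notin> {1..n}" "n + j \<in> {n+1..2*n-1}" using assms by auto
  then show ?thesis by (simp add: fisherV_def v'_def u_def log_odds_def)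
qed

lemma sum_split_coordinates:
  fixes f :: "nat \<Rightarrow> real"
  shows "(\<Sum>i\<in>{1..2*n-1}. f i) = (\<Sum>i\<in>{1..n}. f i) + (\<Sum>j\<in>{1..n-1}. f (n + j))"
proof -
  have "{1..2*n-1} = {1..n} \<union> {n+1..n+(n-1)}" using n3 by auto
  moreover have "{1..n} \<inter> {n+1..n+(n-1)} = {}" by auto
  moreover have "(\<Sum>i\<in>{n+1..n+(n-1)}. f i) = (\<Sum>j\<in>{1..n-1}. f (n + j))"
    using sum.shift_bounds_cl_nat_ivl[of f 1 n "n-1"] by (simp add: add.commute)
  ultimately show ?thesis by (simp add: sum.union_disjoint)
qed

text \<open>In the full bipartite information matrix each diagonal entry equals the sum of the
  off-diagonal entries of its row. Omitting the parameter fixed to 0 leaves an alpha row with the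
  defect \<open>u i n\<close>.\<close>

lemma v2n_row:
  assumes i: "i \<in> {1..n}" shows "v2n n \<theta> i = (if i = n then 0 else u i n)"
proof -
  have "(\<Sum>j\<in>{1..2*n-1} - {i}. fisherV n \<theta> i j) = (\<Sum>j\<in>{1..2*n-1}. if j = i then 0 else fisherV n \<theta> i j)"
    by (rule sum.mono_neutral_cong_left) auto
  also have "\<dots> = (\<Sum>j\<in>{1..n}. if j = i then 0 else fisherV n \<theta> i j) + (\<Sum>j\<in>{1..n-1}. fisherV n \<theta> i (n + j))"
    unfolding sum_split_coordinates using i by (intro arg_cong2[where f="(+)"] sum.cong) auto
  also have "(\<Sum>j\<in>{1..n}. if j = i then 0 else fisherV n \<theta> i j) = 0"
    using i by (intro sum.neutral) (auto simp: fisherV_def)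
  also have "(\<Sum>j\<in>{1..n-1}. fisherV n \<theta> i (n + j)) = (\<Sum>j\<in>{1..n-1} - {i}. u i j)"
    using i by (intro sum.mono_neutral_cong_right) (auto simp: fisherV_def u_def log_odds_def)
  finally have "v2n n \<theta> i = (\<Sum>j\<in>{1..n} - {i}. u i j) - (\<Sum>j\<in>{1..n-1} - {i}. u i j)"
    by (simp add: v2n_def fisherV_row[OF i] v_def)
  moreover have "(\<Sum>j\<in>{1..n} - {i}. u i j) = (\<Sum>j\<in>{1..n-1} - {i}. u i j) + (if i = n then 0 else u i n)"
  proof (cases "i = n")
    case True
    then have "{1..n} - {i} = {1..n-1} - {i}" by auto
    then show ?thesis using True by simp
  next
    case False
    then have "{1..n} - {i} = insert n ({1..n-1} - {i})" using n3 by auto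
    moreover have "n \<notin> {1..n-1} - {i}" using n3 by auto
    ultimately show ?thesis using False by simp
  qed
  ultimately show ?thesis by simp
qed

lemma v2n_col:
  assumes j: "j \<in> {1..n-1}" shows "v2n n \<theta> (n + j) = 0"
proof -
  have "(\<Sum>i\<in>{1..2*n-1} - {n + j}. fisherV n \<theta> (n + j) i) = (\<Sum>i\<in>{1..2*n-1}. if i = n + j then 0 else fisherV n \<theta> (n + j) i)"
    by (rule sum.mono_neutral_cong_left) auto
  also have "\<dots> = (\<Sum>i\<in>{1..n}. fisherV n \<theta> (n + j) i) + (\<Sum>i\<in>{1..n-1}. if i = j then 0 else fisherV n \<theta> (n + j) (n + i))"
    unfolding sum_split_coordinates using j by (intro arg_cong2[where f="(+)"] sum.cong) auto
  also have "(\<Sum>i\<in>{1..n-1}. if i = j then 0 else fisherV n \<theta> (n + j) (n + i)) = 0"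
    using j by (intro sum.neutral) (auto simp: fisherV_def)
  also have "(\<Sum>i\<in>{1..n}. fisherV n \<theta> (n + j) i) = v' j"
    unfolding v'_def using j by (intro sum.mono_neutral_cong_right) (auto simp: fisherV_def u_def log_odds_def)
  finally show ?thesis by (simp add: v2n_def fisherV_col[OF j])
qed

text \<open>The defects add up to the information of the parameter fixed to 0, so the 1 /
  \<open>v2n2n\<close> in \<open>S\<close> is the variance of the term \<open>h n / v' n\<close>
  common to all coordinates.\<close>

lemma v2n2n_eq: "v2n2n n \<theta> = v' n"
proof -
  have "v2n2n n \<theta> = (\<Sum>i\<in>{1..n}. if i = n then 0 else u i n) + (\<Sum>j\<in>{1..n-1}. 0)"
    unfolding v2n2n_def sum_split_coordinates using v2n_row v2n_col by (intro arg_cong2[where f="(+)"] sum.cong) auto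
  also have "(\<Sum>i\<in>{1..n}. if i = n then 0 else u i n) = v' n"
    unfolding v'_def by (rule sum.mono_neutral_cong_right) auto
  finally show ?thesis by simp
qed

lemma block_S_mat:
  assumes k: "k < n"
  shows "block k (S_mat n \<theta>) i j = (if i \<in> {1..k} \<and> j \<in> {1..k} then (if i = j then 1 / v i else 0) + 1 / v' n else 0)"
  using k fisherV_row[of i] by (auto simp: block_def S_mat_def v2n2n_eq)

text \<open>The quadratic form of the upper-left block of \<open>S\<close>: a diagonal form plus a
  rank-one form.\<close>

definition quad :: "nat \<Rightarrow> (nat \<Rightarrow> real) \<Rightarrow> real" where
  "quad k x = (\<Sum>i\<in>{1..k}. (x i)^2 / v i) + (\<Sum>i\<in>{1..k}. x i)^2 / v' n"

lemma kvec_block_S_mat: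
  assumes k: "k < n" and i: "i \<in> {1..k}"
  shows "kvec k (block k (S_mat n \<theta>)) x i = x i / v i + (\<Sum>l\<in>{1..k}. x l) / v' n"
proof -
  have "kvec k (block k (S_mat n \<theta>)) x i = (\<Sum>l\<in>{1..k}. (if l = i then x i / v i else 0) + x l / v' n)"
    unfolding kvec_def using i by (intro sum.cong) (auto simp: block_S_mat[OF k] distrib_right)
  then show ?thesis using i by (simp add: sum.distrib sum_divide_distrib)
qed

lemma kdot_block_S_mat:
  assumes k: "k < n"
  shows "kdot k x (kvec k (block k (S_mat n \<theta>)) x) = quad k x"
proof -
  have "kdot k x (kvec k (block k (S_mat n \<theta>)) x) = (\<Sum>i\<in>{1..k}. (x i)^2 / v i + x i * ((\<Sum>l\<in>{1..k}. x l) / v' n))"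
    unfolding kdot_def by (intro sum.cong) (auto simp: kvec_block_S_mat[OF k] power2_eq_square distrib_left)
  then show ?thesis unfolding quad_def sum.distrib sum_distrib_right[symmetric] by (simp add: power2_eq_square)
qed

lemma quad_terms:
  assumes k: "k < n"
  shows "i \<in> {1..k} \<Longrightarrow> (x i)^2 / v i \<le> quad k x" "(\<Sum>i\<in>{1..k}. x i)^2 / v' n \<le> quad k x" "0 \<le> quad k x"
proof -
  have nn: "n \<in> {1..n}" using n3 by simp
  have p: "0 \<le> (x i)^2 / v i" if "i \<in> {1..k}" for i
    using v_pos(1)[of i] that k by simp
  have p': "0 \<le> (\<Sum>i\<in>{1..k}. x i)^2 / v' n" using v_pos(2)[OF nn] by simp
  have s: "0 \<le> (\<Sum>i\<in>{1..k}. (x i)^2 / v i)" by (rule sum_nonneg) (rule p)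
  show "(\<Sum>i\<in>{1..k}. x i)^2 / v' n \<le> quad k x" "0 \<le> quad k x" using s p' by (simp_all add: quad_def)
  assume i: "i \<in> {1..k}"
  have "(x i)^2 / v i \<le> (\<Sum>i\<in>{1..k}. (x i)^2 / v i)"
    by (rule member_le_sum[OF i]) (use p in auto)
  then show "(x i)^2 / v i \<le> quad k x" using p' by (simp add: quad_def)
qed

text \<open>Bounds by the quadratic form alone: along whitened directions this form stays fixed,
  while the components of \<open>x\<close> may grow with n.\<close>

lemma abs_le_sqrt_quad:
  assumes k: "k < n"
  shows "i \<in> {1..k} \<Longrightarrow> \<bar>x i\<bar> \<le> sqrt (quad k x * v i)"
    and "\<bar>\<Sum>i\<in>{1..k}. x i\<bar> \<le> sqrt (quad k x * v' n)"
proof -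
  show "\<bar>x i\<bar> \<le> sqrt (quad k x * v i)" if i: "i \<in> {1..k}"
  proof (rule real_le_rsqrt)
    have "0 < v i" using v_pos(1)[of i] i k by simp
    then show "\<bar>x i\<bar>\<^sup>2 \<le> quad k x * v i" using quad_terms(1)[OF k i, of x] by (simp add: divide_le_eq)
  qed
  show "\<bar>\<Sum>i\<in>{1..k}. x i\<bar> \<le> sqrt (quad k x * v' n)"
  proof (rule real_le_rsqrt)
    have "0 < v' n" using v_pos(2)[of n] n3 by simp
    then show "\<bar>\<Sum>i\<in>{1..k}. x i\<bar>\<^sup>2 \<le> quad k x * v' n" using quad_terms(2)[OF k, of x] by (simp add: divide_le_eq)
  qed
qed

lemma abs_div_le:
  assumes "\<bar>x\<bar> \<le> sqrt (q * w)" "(real n - 1) * m \<le> w" "0 \<le> q"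
  shows "\<bar>x / w\<bar> \<le> sqrt (q / ((real n - 1) * m))"
proof -
  have p: "0 < (real n - 1) * m" using n1 m0 by simp
  then have w: "0 < w" using assms(2) by linarith
  have "\<bar>x / w\<bar> \<le> sqrt (q * w) / w" using assms(1) w by (simp add: divide_right_mono)
  also have "\<dots> = sqrt (q / w)"
    using w by (simp add: real_sqrt_mult real_sqrt_divide) (simp add: field_simps)
  also have "\<dots> \<le> sqrt (q / ((real n - 1) * m))"
    using assms p w by (intro real_sqrt_le_mono divide_left_mono) auto
  finally show ?thesis .
qed

text \<open>The weight of the noise of edge \<open>e\<close> in the leading term paired with
  \<open>s\<close>; an edge (i, n) with i \<le> k receives both contributions.\<close>

definition coef :: "nat \<Rightarrow> (nat \<Rightarrow> real) \<Rightarrow> nat \<times> nat \<Rightarrow> real" where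
  "coef k s e = (if fst e \<in> {1..k} then s (fst e) / v (fst e) else 0)
      + (if snd e = n then (\<Sum>l\<in>{1..k}. s l) / v' n else 0)"

lemma linear_statistic_as_edges:
  assumes k: "k < n"
  shows "(\<Sum>l\<in>{1..k}. s l * (g A l / v l + h A n / v' n)) = (\<Sum>e\<in>offdiag n. coef k s e * noise e A)"
proof -
  have nn: "n \<in> {1..n}" using n3 by simp
  have "(\<Sum>e\<in>offdiag n. coef k s e * noise e A) =
     (\<Sum>e\<in>offdiag n. (if fst e \<in> {1..k} then s (fst e) / v (fst e) else 0) * noise e A) +
     (\<Sum>e\<in>offdiag n. (\<Sum>l\<in>{1..k}. s l) / v' n * (of_bool (snd e = n) * noise e A))"
    unfolding sum.distrib[symmetric] by (intro sum.cong) (auto simp: coef_def distrib_right)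
  also have "(\<Sum>e\<in>offdiag n. (\<Sum>l\<in>{1..k}. s l) / v' n * (of_bool (snd e = n) * noise e A)) = (\<Sum>l\<in>{1..k}. s l) / v' n * h A n"
    unfolding sum_distrib_left[symmetric] row_sum_as_edges(2)[OF nn] ..
  also have "(\<Sum>e\<in>offdiag n. (if fst e \<in> {1..k} then s (fst e) / v (fst e) else 0) * noise e A) =
      (\<Sum>i\<in>{1..n}. if i \<in> {1..k} then s i / v i * g A i else 0)"
    unfolding sum_offdiag by (intro sum.cong) (auto simp: g_def sum_distrib_left)
  also have "\<dots> = (\<Sum>i\<in>{1..k}. s i / v i * g A i)"
    using k by (intro sum.mono_neutral_cong_right) auto
  finally show ?thesis
    by (simp add: sum.distrib distrib_left sum_distrib_right sum_divide_distrib)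
qed

lemma coef_abs_le:
  assumes k: "k < n" and e: "e \<in> offdiag n"
  shows "\<bar>coef k s e\<bar> \<le> 2 * sqrt (quad k s / ((real n - 1) * m))"
proof -
  let ?b = "sqrt (quad k s / ((real n - 1) * m))"
  have b0: "0 \<le> ?b" using quad_terms(3)[OF k] n1 m0 by simp
  have "\<bar>if fst e \<in> {1..k} then s (fst e) / v (fst e) else 0\<bar> \<le> ?b"
  proof (cases "fst e \<in> {1..k}")
    case True
    then show ?thesis
      using abs_div_le[OF abs_le_sqrt_quad(1)[OF k True, of s] v_bounds(1) quad_terms(3)[OF k]] k by simp
  next
    case False
    show ?thesis unfolding if_not_P[OF False] using b0 by simp
  qed
  moreover have "\<bar>if snd e = n then (\<Sum>l\<in>{1..k}. s l) / v' n else 0\<bar> \<le> ?b"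
    using abs_div_le[OF abs_le_sqrt_quad(2)[OF k, of s] v_bounds(3) quad_terms(3)[OF k]] n3 b0 by simp
  ultimately show ?thesis unfolding coef_def by linarith
qed

text \<open>The row sums and the last column sum share only the edges \<open>(i, n)\<close>, whose contribution
  to the variance is negligible.\<close>

lemma coef_variance:
  assumes k: "k < n"
  shows "\<bar>(\<Sum>e\<in>offdiag n. (coef k s e)^2 * u (fst e) (snd e)) - quad k s\<bar> \<le> real k * quad k s / (2 * ((real n - 1) * m))"
proof -
  have nn: "n \<in> {1..n}" using n3 by simp
  define S where "S = (\<Sum>l\<in>{1..k}. s l)"
  define a where "a i = (if i \<in> {1..k} then s i / v i else 0)" for i
  define b where "b j = (if j = n then S / v' n else 0)" for j
  \<comment> \<open>The two squares reproduce \<open>quad\<close> exactly, because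
    \<open>v i\<close> and \<open>v' n\<close> are the variances of \<open>g A i\<close> and
    \<open>h A n\<close>; only the cross terms remain.\<close>
  have "(\<Sum>e\<in>offdiag n. (coef k s e)^2 * u (fst e) (snd e)) =
      (\<Sum>i\<in>{1..n}. \<Sum>j\<in>{1..n} - {i}. (a i)^2 * u i j + (b j)^2 * u i j + 2 * a i * b j * u i j)"
    unfolding sum_offdiag by (intro sum.cong) (auto simp: coef_def a_def b_def S_def power2_eq_square algebra_simps)
  also have "\<dots> = (\<Sum>i\<in>{1..n}. \<Sum>j\<in>{1..n} - {i}. (a i)^2 * u i j) + (\<Sum>i\<in>{1..n}. \<Sum>j\<in>{1..n} - {i}. (b j)^2 * u i j)
      + (\<Sum>i\<in>{1..n}. \<Sum>j\<in>{1..n} - {i}. 2 * a i * b j * u i j)"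
    by (simp only: sum.distrib)
  also have "(\<Sum>i\<in>{1..n}. \<Sum>j\<in>{1..n} - {i}. (a i)^2 * u i j) = (\<Sum>i\<in>{1..k}. (s i)^2 / v i)"
  proof -
    have "(\<Sum>i\<in>{1..n}. \<Sum>j\<in>{1..n} - {i}. (a i)^2 * u i j) = (\<Sum>i\<in>{1..n}. if i \<in> {1..k} then (s i)^2 / v i else 0)"
    proof (intro sum.cong refl)
      fix i assume i: "i \<in> {1..n}"
      have "(\<Sum>j\<in>{1..n} - {i}. (a i)^2 * u i j) = (a i)^2 * v i" by (simp add: v_def sum_distrib_left)
      then show "(\<Sum>j\<in>{1..n} - {i}. (a i)^2 * u i j) = (if i \<in> {1..k} then (s i)^2 / v i else 0)"
        using v_pos(1)[OF i] by (simp add: a_def power2_eq_square)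
    qed
    also have "\<dots> = (\<Sum>i\<in>{1..k}. (s i)^2 / v i)" using k by (intro sum.mono_neutral_cong_right) auto
    finally show ?thesis .
  qed
  also have "(\<Sum>i\<in>{1..n}. \<Sum>j\<in>{1..n} - {i}. (b j)^2 * u i j) = S^2 / v' n"
  proof -
    have "(\<Sum>i\<in>{1..n}. \<Sum>j\<in>{1..n} - {i}. (b j)^2 * u i j) = (\<Sum>j\<in>{1..n}. \<Sum>i\<in>{1..n} - {j}. (b j)^2 * u i j)"
      by (rule sum_offdiag_swap)
    also have "\<dots> = (\<Sum>j\<in>{1..n}. if j = n then S^2 / v' n else 0)"
    proof (intro sum.cong refl)
      fix j assume j: "j \<in> {1..n}"
      have "(\<Sum>i\<in>{1..n} - {j}. (b j)^2 * u i j) = (b j)^2 * v' j" by (simp add: v'_def sum_distrib_left)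
      then show "(\<Sum>i\<in>{1..n} - {j}. (b j)^2 * u i j) = (if j = n then S^2 / v' n else 0)"
        using v_pos(2)[OF j] by (simp add: b_def power2_eq_square)
    qed
    finally show ?thesis using nn by simp
  qed
  finally have main: "(\<Sum>e\<in>offdiag n. (coef k s e)^2 * u (fst e) (snd e)) - quad k s =
      (\<Sum>i\<in>{1..n}. \<Sum>j\<in>{1..n} - {i}. 2 * a i * b j * u i j)"
    by (simp add: quad_def S_def)
  also have "\<dots> = (\<Sum>i\<in>{1..k}. 2 * (s i / v i) * (S / v' n) * u i n)"
  proof -
    have "(\<Sum>i\<in>{1..n}. \<Sum>j\<in>{1..n} - {i}. 2 * a i * b j * u i j) =
       (\<Sum>i\<in>{1..n}. if i \<in> {1..k} then 2 * (s i / v i) * (S / v' n) * u i n else 0)"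
    proof (intro sum.cong refl)
      fix i assume i: "i \<in> {1..n}"
      show "(\<Sum>j\<in>{1..n} - {i}. 2 * a i * b j * u i j) = (if i \<in> {1..k} then 2 * (s i / v i) * (S / v' n) * u i n else 0)"
      proof (cases "i \<in> {1..k}")
        case False
        then have "a i = 0" unfolding a_def by (rule if_not_P)
        then show ?thesis unfolding if_not_P[OF False] by simp
      next
        case True
        then have "n \<in> {1..n} - {i}" using k nn by auto
        moreover have "(\<Sum>j\<in>{1..n} - {i}. 2 * a i * b j * u i j) = (\<Sum>j\<in>{1..n} - {i}. if j = n then 2 * a i * (S / v' n) * u i n else 0)"
          by (intro sum.cong) (auto simp: b_def)
        ultimately show ?thesis using True by (simp add: a_def)
      qed
    qed
    also have "\<dots> = (\<Sum>i\<in>{1..k}. 2 * (s i / v i) * (S / v' n) * u i n)"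
      using k by (intro sum.mono_neutral_cong_right) auto
    finally show ?thesis .
  qed
  \<comment> \<open>Each of the k cross terms carries the factor 2, two weights bounded by the same
    square root, and an edge variance of at most 1/4.\<close>
  also have "\<bar>\<dots>\<bar> \<le> (\<Sum>i\<in>{1..k}. quad k s / (2 * ((real n - 1) * m)))"
  proof (rule order_trans[OF sum_abs sum_mono])
    fix i assume i: "i \<in> {1..k}"
    let ?b = "sqrt (quad k s / ((real n - 1) * m))"
    have A: "\<bar>s i / v i\<bar> \<le> ?b"
      using abs_div_le[OF abs_le_sqrt_quad(1)[OF k i, of s] v_bounds(1) quad_terms(3)[OF k]] k i by simp
    have B: "\<bar>S / v' n\<bar> \<le> ?b"
      unfolding S_def using abs_div_le[OF abs_le_sqrt_quad(2)[OF k, of s] v_bounds(3) quad_terms(3)[OF k]] n3 by simp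
    have q0: "0 \<le> quad k s / ((real n - 1) * m)" using quad_terms(3)[OF k] n1 m0 by simp
    have ab: "\<bar>s i / v i\<bar> * \<bar>S / v' n\<bar> \<le> ?b * ?b"
      by (rule mult_mono[OF A B]) (use q0 in auto)
    have "\<bar>2 * (s i / v i) * (S / v' n) * u i n\<bar> = 2 * (\<bar>s i / v i\<bar> * \<bar>S / v' n\<bar>) * u i n"
      using u_bounds(2)[of i n] by (simp only: abs_mult)
    also have "\<dots> \<le> 2 * (?b * ?b) * (1/4)"
      by (rule mult_mono[OF mult_left_mono[OF ab] u_bounds(3)]) (use q0 u_bounds(2)[of i n] in auto)
    also have "?b * ?b = quad k s / ((real n - 1) * m)"
      using real_sqrt_pow2[OF q0] by (simp only: power2_eq_square)
    also have "2 * (quad k s / ((real n - 1) * m)) * (1/4) = quad k s / (2 * ((real n - 1) * m))" by simp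
    finally show "\<bar>2 * (s i / v i) * (S / v' n) * u i n\<bar> \<le> quad k s / (2 * ((real n - 1) * m))" .
  qed
  also have "\<dots> = real k * quad k s / (2 * ((real n - 1) * m))" by simp
  finally show ?thesis .
qed

text \<open>\<open>\<delta>\<close> bounds the edge weights and \<open>\<kappa>\<close> the
  deviation of the variance from \<open>quad\<close>. The first error is that of the Gaussian
  approximation, the second that of replacing the variance by \<open>quad\<close>.\<close>

lemma char_linear_statistic:
  assumes k: "k < n" and \<delta>: "\<delta> = 2 * sqrt (quad k s / ((real n - 1) * m))" "\<delta> \<le> 1"
    and \<kappa>: "\<kappa> = real k * quad k s / (2 * ((real n - 1) * m))"
  shows "cmod (measure_pmf.expectation edge_pmf (\<lambda>A. iexp (\<Sum>l\<in>{1..k}. s l * (g A l / v l + h A n / v' n))) - exp (- quad k s / 2))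
     \<le> \<delta> * (quad k s + \<kappa>) + \<kappa> / 2"
proof -
  define W where "W = (\<Sum>e\<in>offdiag n. (coef k s e)^2 * u (fst e) (snd e))"
  have W: "\<bar>W - quad k s\<bar> \<le> \<kappa>" unfolding W_def \<kappa> by (rule coef_variance[OF k])
  have W0: "0 \<le> W" unfolding W_def by (intro sum_nonneg mult_nonneg_nonneg) (auto intro: less_imp_le[OF u_bounds(2)])
  have uu: "logistic (log_odds n \<theta> (fst e) (snd e)) * (1 - logistic (log_odds n \<theta> (fst e) (snd e))) = u (fst e) (snd e)" for e
    using edge_variance[of "fst e" "snd e"] by simp
  have d0: "0 \<le> \<delta>" unfolding \<delta>(1) using quad_terms(3)[OF k] n1 m0 by simp
  have 1: "cmod (measure_pmf.expectation edge_pmf (\<lambda>A. iexp (\<Sum>e\<in>offdiag n. coef k s e * noise e A)) - exp (- (W / 2))) \<le> \<delta> * W"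
    using char_noise_sum_approx[of "coef k s" \<delta>, unfolded uu, folded W_def] coef_abs_le[OF k] \<delta> by simp
  have 2: "\<bar>exp (- (W / 2)) - exp (- (quad k s / 2))\<bar> \<le> \<bar>W / 2 - quad k s / 2\<bar>"
    by (rule exp_neg_lipschitz) (use W0 quad_terms(3)[OF k] in auto)
  have "\<bar>W / 2 - quad k s / 2\<bar> = \<bar>W - quad k s\<bar> / 2" by (simp add: abs_if field_simps)
  then have "\<bar>exp (- (W / 2)) - exp (- (quad k s / 2))\<bar> \<le> \<kappa> / 2" using 2 W by linarith
  then have "cmod (complex_of_real (exp (- (W / 2))) - complex_of_real (exp (- quad k s / 2))) \<le> \<kappa> / 2"
    unfolding of_real_diff[symmetric] norm_of_real by simp
  then have "cmod (measure_pmf.expectation edge_pmf (\<lambda>A. iexp (\<Sum>e\<in>offdiag n. coef k s e * noise e A)) - exp (- quad k s / 2)) \<le> \<delta> * W + \<kappa> / 2"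
    by (rule norm_diff_triangle_le[OF 1])
  also have "\<dots> \<le> \<delta> * (quad k s + \<kappa>) + \<kappa> / 2"
    using W d0 by (intro add_right_mono mult_left_mono) auto
  finally show ?thesis unfolding linear_statistic_as_edges[OF k] .
qed

text \<open>On the good event the phases differ by at most the remainders \<epsilon> weighted by |s
  l| \<le> sqrt (quad k s * n), where v l \<le> n is used. Off it two numbers of modulus 1 differ by
  at most 2, so the default value of a nonexistent estimator does no harm.\<close>

lemma char_mle_approx:
  assumes k: "k < n" and \<delta>: "\<delta> = 2 * sqrt (quad k s / ((real n - 1) * m))" "\<delta> \<le> 1"
    and \<kappa>: "\<kappa> = real k * quad k s / (2 * ((real n - 1) * m))"
    and G: "0 < G" and H: "0 < H" and K: "K = 2 * G / ((real n - 1) * m^2)" "K < 1/4"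
    and \<epsilon>: "\<epsilon> = 2 * (real n * K^2 + H) / ((real n - 1) * m^2)"
    and \<pi>: "\<pi> = 4 * real n * exp (- 2 * G^2 / real n) + 4 * real n * exp (- 16 * H^2 * m^2)"
  shows "cmod (measure_pmf.expectation edge_pmf (\<lambda>A. iexp (\<Sum>l\<in>{1..k}. s l * (mle n A l - \<theta> l))) - exp (- quad k s / 2))
     \<le> \<delta> * (quad k s + \<kappa>) + \<kappa> / 2 + real k * sqrt (quad k s * real n) * \<epsilon> + 2 * \<pi>"
proof -
  let ?X = "\<lambda>A. \<Sum>l\<in>{1..k}. s l * (mle n A l - \<theta> l)"
  let ?Y = "\<lambda>A. \<Sum>l\<in>{1..k}. s l * (g A l / v l + h A n / v' n)"
  let ?q = "sqrt (quad k s * real n)"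
  have int: "integrable (measure_pmf edge_pmf) (\<lambda>A. iexp (f A))" for f
    by (rule measure_pmf.integrable_const_bound[where B=1]) auto
  have iI: "integrable (measure_pmf edge_pmf) (indicator (- good G H) :: _ \<Rightarrow> real)"
    by (rule measure_pmf.integrable_const_bound[where B=1]) (auto simp: indicator_def)
  have e0: "0 \<le> \<epsilon>" unfolding \<epsilon> using n1 H by (intro divide_nonneg_nonneg mult_nonneg_nonneg add_nonneg_nonneg) auto
  have pt: "cmod (iexp (?X A) - iexp (?Y A)) \<le> real k * ?q * \<epsilon> + 2 * indicator (- good G H) A" for A
  proof (cases "A \<in> good G H")
    case True
    have "?X A - ?Y A = (\<Sum>l\<in>{1..k}. s l * (mle n A l - \<theta> l - (g A l / v l + h A n / v' n)))"
      by (simp add: sum_subtractf right_diff_distrib)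
    also have "\<bar>\<dots>\<bar> \<le> (\<Sum>l\<in>{1..k}. ?q * \<epsilon>)"
    proof (rule order_trans[OF sum_abs sum_mono])
      fix l assume l: "l \<in> {1..k}"
      then have ln: "l \<in> {1..n}" using k by auto
      have "\<bar>s l\<bar> \<le> sqrt (quad k s * v l)" by (rule abs_le_sqrt_quad(1)[OF k l])
      also have "\<dots> \<le> ?q"
        using v_bounds(2)[OF ln] quad_terms(3)[OF k] by (intro real_sqrt_le_mono mult_left_mono)
      finally have "\<bar>s l\<bar> \<le> ?q" .
      moreover have "\<bar>mle n A l - \<theta> l - (g A l / v l + h A n / v' n)\<bar> \<le> \<epsilon>"
        unfolding \<epsilon> by (rule mle_expansion_good[OF G True ln K])
      ultimately show "\<bar>s l * (mle n A l - \<theta> l - (g A l / v l + h A n / v' n))\<bar> \<le> ?q * \<epsilon>"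
        unfolding abs_mult using quad_terms(3)[OF k, of s] by (intro mult_mono) auto
    qed
    finally have "\<bar>?X A - ?Y A\<bar> \<le> real k * ?q * \<epsilon>" by simp
    then show ?thesis using iexp_lipschitz[of "?X A" "?Y A"] True by simp
  next
    case False
    have "cmod (iexp (?X A) - iexp (?Y A)) \<le> 1 + 1"
      by (rule order_trans[OF norm_triangle_ineq4]) simp
    moreover have "0 \<le> real k * ?q * \<epsilon>" using e0 quad_terms(3)[OF k] by simp
    ultimately show ?thesis using False by simp
  qed
  have "cmod (measure_pmf.expectation edge_pmf (\<lambda>A. iexp (?X A)) - measure_pmf.expectation edge_pmf (\<lambda>A. iexp (?Y A)))
     = cmod (measure_pmf.expectation edge_pmf (\<lambda>A. iexp (?X A) - iexp (?Y A)))"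
    by (simp only: Bochner_Integration.integral_diff[OF int int])
  also have "\<dots> \<le> measure_pmf.expectation edge_pmf (\<lambda>A. cmod (iexp (?X A) - iexp (?Y A)))"
    by (rule integral_norm_bound)
  also have "\<dots> \<le> measure_pmf.expectation edge_pmf (\<lambda>A. real k * ?q * \<epsilon> + 2 * indicator (- good G H) A)"
    by (intro integral_mono pt integrable_norm Bochner_Integration.integrable_diff int
        Bochner_Integration.integrable_add integrable_mult_right iI) auto
  also have "\<dots> = real k * ?q * \<epsilon> + 2 * measure_pmf.prob edge_pmf (- good G H)"
    using iI by (subst Bochner_Integration.integral_add) auto
  also have "\<dots> \<le> real k * ?q * \<epsilon> + 2 * \<pi>"
    using prob_not_good[OF G H] unfolding \<pi> by simp
  finally have "cmod (measure_pmf.expectation edge_pmf (\<lambda>A. iexp (?X A)) - measure_pmf.expectation edge_pmf (\<lambda>A. iexp (?Y A))) \<le> real k * ?q * \<epsilon> + 2 * \<pi>" .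
  then have "cmod (measure_pmf.expectation edge_pmf (\<lambda>A. iexp (?X A)) - exp (- quad k s / 2)) \<le>
      (real k * ?q * \<epsilon> + 2 * \<pi>) + (\<delta> * (quad k s + \<kappa>) + \<kappa> / 2)"
    by (rule norm_diff_triangle_le[OF _ char_linear_statistic[OF k \<delta> \<kappa>]])
  then show ?thesis by linarith
qed

end

section \<open>Whitening and the choice of rates\<close>

context edge_model begin

text \<open>With N the inverse root of the block A, the vector in question is N t by symmetry of N,
  and its form is t^T N A N t = |t|^2. The identity is exact at every n.\<close>

lemma quad_whitened:
  assumes k: "k < n"
  shows "quad k (\<lambda>l. \<Sum>i\<in>{1..k}. t i * kinvsqrt k (block k (S_mat n \<theta>)) i l) = (\<Sum>i\<in>{1..k}. (t i)^2)"
proof -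
  define A where "A = block k (S_mat n \<theta>)"
  define N where "N = kinvsqrt k A"
  have p: "0 < (real n - 1) * m" using n1 m0 by simp
  have quad: "kdot k x (kvec k A x) = quad k x" for x unfolding A_def by (rule kdot_block_S_mat[OF k])
  have dot: "kdot k x x = (\<Sum>i\<in>{1..k}. (x i)^2)" for x by (simp add: kdot_def power2_eq_square)
  have lo: "1 / real n * kdot k x x \<le> kdot k x (kvec k A x)" for x
  proof -
    have "1 / real n * kdot k x x = (\<Sum>i\<in>{1..k}. (x i)^2 / real n)"
      unfolding dot by (simp add: sum_divide_distrib)
    also have "\<dots> \<le> (\<Sum>i\<in>{1..k}. (x i)^2 / v i)"
    proof (rule sum_mono)
      fix i assume "i \<in> {1..k}"
      then have "i \<in> {1..n}" using k by auto
      then show "(x i)^2 / real n \<le> (x i)^2 / v i" using v_bounds(2) v_pos(1) by (intro divide_left_mono) auto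
    qed
    also have "\<dots> \<le> quad k x" using v_pos(2)[of n] n3 by (simp add: quad_def)
    finally show ?thesis unfolding quad .
  qed
  \<comment> \<open>Cauchy-Schwarz controls the rank-one part. The summand 1/n in the upper constant
    makes its comparison with the lower constant immediate.\<close>
  have up: "kdot k x (kvec k A x) \<le> (1 / real n + (1 + real k) / ((real n - 1) * m)) * kdot k x x" for x
  proof -
    have "(\<Sum>i\<in>{1..k}. (x i)^2 / v i) \<le> (\<Sum>i\<in>{1..k}. (x i)^2 / ((real n - 1) * m))"
    proof (rule sum_mono)
      fix i assume "i \<in> {1..k}"
      then have "i \<in> {1..n}" using k by auto
      then show "(x i)^2 / v i \<le> (x i)^2 / ((real n - 1) * m)"
        using v_bounds(1) v_pos(1) p by (intro divide_left_mono) auto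
    qed
    also have "\<dots> = 1 / ((real n - 1) * m) * kdot k x x" unfolding dot by (simp add: sum_divide_distrib)
    finally have 1: "(\<Sum>i\<in>{1..k}. (x i)^2 / v i) \<le> 1 / ((real n - 1) * m) * kdot k x x" .
    have "(\<Sum>i\<in>{1..k}. x i)^2 \<le> (\<Sum>i\<in>{1..k}. (x i)^2) * real (card {1..k})"
      by (rule sum_squared_le_sum_of_squares)
    then have "(\<Sum>i\<in>{1..k}. x i)^2 / v' n \<le> real k * kdot k x x / v' n"
      using v_pos(2)[of n] n3 unfolding dot by (intro divide_right_mono) (auto simp: mult.commute)
    also have "\<dots> \<le> real k * kdot k x x / ((real n - 1) * m)"
      using v_pos(2)[of n] v_bounds(3)[of n] n3 p kdot_self_nonneg[of k x] by (intro divide_left_mono) auto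
    finally have 2: "(\<Sum>i\<in>{1..k}. x i)^2 / v' n \<le> real k / ((real n - 1) * m) * kdot k x x" by simp
    have 3: "0 \<le> 1 / real n * kdot k x x" using kdot_self_nonneg[of k x] by simp
    show ?thesis unfolding quad quad_def using 1 2 3 by (simp add: distrib_right add_divide_distrib)
  qed
  have \<Lambda>: "1 / real n \<le> 1 / real n + (1 + real k) / ((real n - 1) * m)" using p by simp
  have n0: "0 < 1 / real n" using n3 by simp
  have km: "kmat k A" unfolding A_def by (auto simp: kmat_def block_def)
  have sA: "A i j = A j i" for i j unfolding A_def block_S_mat[OF k] by auto
  note W = kinvsqrt_whitens[OF km sA lo up n0 \<Lambda>, folded N_def]
  have s: "(\<lambda>l. \<Sum>i\<in>{1..k}. t i * N i l) = kvec k N t"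
    unfolding kvec_def by (intro ext sum.cong refl) (subst W(1), simp add: mult.commute)
  have NT: "(\<lambda>i j. N j i) = N" by (intro ext) (rule W(1))
  have "quad k (kvec k N t) = kdot k (kvec k N t) (kvec k A (kvec k N t))" by (rule quad[symmetric])
  also have "\<dots> = kdot k t (kvec k N (kvec k A (kvec k N t)))"
    unfolding kdot_kvec_transpose[of k t] NT ..
  also have "\<dots> = kdot k t (kvec k (kmul k N (kmul k A N)) t)"
  proof -
    have "kvec k N (kvec k A (kvec k N t)) i = kvec k (kmul k N (kmul k A N)) t i" if i: "i \<in> {1..k}" for i
    proof -
      have "kvec k N (kvec k A (kvec k N t)) i = kvec k N (kvec k (kmul k A N) t) i"
        unfolding kvec_def[of k N "kvec k A _"] kvec_def[of k N "kvec k (kmul k A N) t"]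
        by (intro sum.cong refl) (simp only: kvec_kmul)
      then show ?thesis using kvec_kmul[OF i, of N "kmul k A N" t] by simp
    qed
    then show ?thesis unfolding kdot_def by (intro sum.cong) auto
  qed
  also have "\<dots> = kdot k t t" unfolding W(2) kdot_def by (intro sum.cong refl) (simp only: kvec_kid)
  finally show ?thesis unfolding s[unfolded N_def A_def] dot N_def A_def by simp
qed

end

text \<open>A log-odds is a sum of two parameters, hence at most 2\<tau> ln n \<le> (1/22) ln n in
  absolute value. The unit neighbourhood costs a factor e^(-1) \<ge> 1/3, and with the 1/4 of the
  variance bound this gives 1/12.\<close>

lemma edge_modelI:
  assumes \<tau>: "0 < \<tau>" "\<tau> < 1 / 44" and n: "n \<ge> 3"
    and b: "\<And>i. i \<in> {1..2*n-1} \<Longrightarrow> \<bar>\<theta> i\<bar> \<le> \<tau> * ln (real n)"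
  shows "edge_model n \<theta> (real n powr (-1/22) / 12)"
proof
  show "n \<ge> 3" by (rule n)
  show "0 < real n powr (-1/22) / 12" using n by simp
  fix i j z assume i: "i \<in> {1..n}" and j: "j \<in> {1..n}" and z: "\<bar>z - log_odds n \<theta> i j\<bar> \<le> 1"
  have l0: "0 \<le> ln (real n)" using n by simp
  have "\<bar>alpha n \<theta> i\<bar> \<le> \<tau> * ln (real n)" 
  proof -
    have "i \<in> {1..2*n-1}" using i by auto
    then show ?thesis using b by (simp add: alpha_def)
  qed
  moreover have "\<bar>beta n \<theta> j\<bar> \<le> \<tau> * ln (real n)"
  proof (cases "j = n")
    case True then show ?thesis using \<tau> l0 by (simp add: beta_def)
  next
    case False
    then have "n + j \<in> {1..2*n-1}" using j by auto
    then show ?thesis using b[of "n + j"] False by (simp add: beta_def)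
  qed
  ultimately have "\<bar>log_odds n \<theta> i j\<bar> \<le> 2 * \<tau> * ln (real n)" unfolding log_odds_def by linarith
  also have "\<dots> \<le> 1/22 * ln (real n)" using \<tau> l0 by (intro mult_right_mono) auto
  finally have "\<bar>z\<bar> \<le> 1 + 1/22 * ln (real n)" using z by linarith
  then have "exp (- (1 + 1/22 * ln (real n))) / 4 \<le> exp (- \<bar>z\<bar>) / 4" by simp
  also have "\<dots> \<le> u_fun z" by (rule u_fun_ge)
  finally have 1: "exp (- (1 + 1/22 * ln (real n))) / 4 \<le> u_fun z" .
  have "exp (- (1 + 1/22 * ln (real n))) = exp (- 1) * real n powr (-1/22)"
    using n by (simp add: powr_def exp_add[symmetric])
  moreover have "1/3 \<le> exp (- 1 :: real)" using exp_le by (simp add: exp_minus field_simps)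
  then have "1/3 * real n powr (-1/22) \<le> exp (- 1) * real n powr (-1/22)" by (intro mult_right_mono) auto
  ultimately show "real n powr (-1/22) / 12 \<le> u_fun z" using 1 by simp
qed

theorem theorem2:
  fixes \<tau> :: real and \<theta> :: "nat \<Rightarrow> nat \<Rightarrow> real" and k :: nat
  assumes "0 < \<tau>" and "\<tau> < 1 / 44"
    and "\<And>n i. n \<ge> 2 \<Longrightarrow> i \<in> {1..2*n-1} \<Longrightarrow> \<bar>\<theta> n i\<bar> \<le> \<tau> * ln (real n)"
    and "k \<ge> 1"
  shows "conv_distr_k k (\<lambda>n. binary_model n (\<theta> n))
           (\<lambda>n A. \<lambda>i\<in>{1..k}. \<Sum>l\<in>{1..k}.
               kinvsqrt k (block k (S_mat n (\<theta> n))) i l * (mle n A l - \<theta> n l))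
           (std_normal_k k)"
proof (rule conv_distr_kI)
  fix t :: "nat \<Rightarrow> real"
  define q where "q = (\<Sum>j\<in>{1..k}. (t j)^2)"
  have q0: "0 \<le> q" unfolding q_def by (intro sum_nonneg) auto
  define X where "X n A j = (\<lambda>i\<in>{1..k}. \<Sum>l\<in>{1..k}. kinvsqrt k (block k (S_mat n (\<theta> n))) i l * (mle n A l - \<theta> n l)) j" for n A j
  define m where "m n = real n powr (-1/22) / 12" for n
  \<comment> \<open>\<open>G\<close> must exceed the degree scale n^(1/2) by a power of n to survive
    the union bound, while n K^2 + H, divided by n m^2, must stay below n^(-1/2). The exponents
    11/20 and 1/5 achieve both: up to constants the tail exponents are n^(1/10) for the degrees and
    n^(17/55) for the mixed sums.\<close>
  define G where "G n = real n powr (11/20)" for n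
  define H where "H n = real n powr (1/5)" for n
  define K where "K n = 2 * G n / ((real n - 1) * (m n)^2)" for n
  define \<epsilon> where "\<epsilon> n = 2 * (real n * (K n)^2 + H n) / ((real n - 1) * (m n)^2)" for n
  define \<pi> where "\<pi> n = 4 * real n * exp (- 2 * (G n)^2 / real n) + 4 * real n * exp (- 16 * (H n)^2 * (m n)^2)" for n
  define r where "r n = 1 / ((real n - 1) * m n)" for n
  define \<delta> where "\<delta> n = 2 * sqrt (q / ((real n - 1) * m n))" for n
  define \<kappa> where "\<kappa> n = real k * q / (2 * ((real n - 1) * m n))" for n
  have r: "r \<longlonglongrightarrow> 0" unfolding r_def[abs_def] m_def by real_asymp
  have K: "K \<longlonglongrightarrow> 0" unfolding K_def[abs_def] m_def G_def by real_asymp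
  have \<pi>: "\<pi> \<longlonglongrightarrow> 0" unfolding \<pi>_def[abs_def] m_def G_def H_def by real_asymp
  \<comment> \<open>\<open>K\<close> has order n^(-79/220), so n K^2 has order n^(62/220) and
    dominates \<open>H\<close>, of order n^(44/220). Dividing by n m^2 gives n^(-138/220) for
    \<open>\<epsilon>\<close>, and the product has order n^(-28/220).\<close>
  have \<epsilon>: "(\<lambda>n. sqrt (real n) * \<epsilon> n) \<longlonglongrightarrow> 0"
    unfolding \<epsilon>_def[abs_def] K_def m_def G_def H_def by real_asymp
  have \<delta>: "\<delta> \<longlonglongrightarrow> 0"
  proof -
    have "(\<lambda>n. 2 * sqrt (q * r n)) \<longlonglongrightarrow> 2 * sqrt (q * 0)" by (intro tendsto_intros r)
    then show ?thesis by (simp add: \<delta>_def[abs_def] r_def)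
  qed
  have \<kappa>: "\<kappa> \<longlonglongrightarrow> 0"
  proof -
    have "(\<lambda>n. real k * q / 2 * r n) \<longlonglongrightarrow> real k * q / 2 * 0" by (intro tendsto_intros r)
    then show ?thesis by (simp add: \<kappa>_def[abs_def] r_def)
  qed
  let ?B = "\<lambda>n. \<delta> n * (q + \<kappa> n) + \<kappa> n / 2 + real k * sqrt (q * real n) * \<epsilon> n + 2 * \<pi> n"
  have B: "?B \<longlonglongrightarrow> 0"
  proof -
    have "(\<lambda>n. \<delta> n * (q + \<kappa> n) + \<kappa> n / 2 + real k * sqrt q * (sqrt (real n) * \<epsilon> n) + 2 * \<pi> n)
        \<longlonglongrightarrow> 0 * (q + 0) + 0 / 2 + real k * sqrt q * 0 + 2 * 0"
      by (intro tendsto_intros \<delta> \<kappa> \<epsilon> \<pi>) simp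
    then show ?thesis by (simp add: real_sqrt_mult mult_ac)
  qed
  let ?E = "\<lambda>n. measure_pmf.expectation (binary_model n (\<theta> n)) (\<lambda>A. iexp (\<Sum>j\<in>{1..k}. t j * X n A j))"
  have "\<forall>\<^sub>F n in sequentially. \<delta> n < 1" using order_tendstoD(2)[OF \<delta>, of 1] by simp
  moreover have "\<forall>\<^sub>F n in sequentially. K n < 1/4" using order_tendstoD(2)[OF K, of "1/4"] by simp
  \<comment> \<open>n \<ge> 3 is for the stability bounds; k < n keeps the first k coordinates apart
    from the reference index \<open>n\<close>.\<close>
  moreover have "\<forall>\<^sub>F n in sequentially. max 3 (Suc k) \<le> n" by (rule eventually_ge_at_top)
  ultimately have "\<forall>\<^sub>F n in sequentially. norm (?E n - exp (- q / 2)) \<le> ?B n"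
  proof eventually_elim
    case (elim n)
    have k: "k < n" and n: "n \<ge> 3" using elim(3) by auto
    interpret edge_model n "\<theta> n" "m n"
      unfolding m_def by (rule edge_modelI[OF assms(1,2) n]) (use assms(3) n in auto)
    \<comment> \<open>The functional \<open>t\<close> of the whitened vector is the functional
      \<open>s\<close> of the raw error.\<close>
    define s where "s l = (\<Sum>i\<in>{1..k}. t i * kinvsqrt k (block k (S_mat n (\<theta> n))) i l)" for l
    have qs: "quad k s = q" unfolding s_def q_def by (rule quad_whitened[OF k])
    have sum: "(\<Sum>j\<in>{1..k}. t j * X n A j) = (\<Sum>l\<in>{1..k}. s l * (mle n A l - \<theta> n l))" for A
    proof -
      have "(\<Sum>j\<in>{1..k}. t j * X n A j) =
          (\<Sum>j\<in>{1..k}. \<Sum>l\<in>{1..k}. t j * kinvsqrt k (block k (S_mat n (\<theta> n))) j l * (mle n A l - \<theta> n l))"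
        by (intro sum.cong) (auto simp: X_def sum_distrib_left mult.assoc)
      then show ?thesis unfolding s_def sum_distrib_right by (subst (asm) sum.swap)
    qed
    have "G n > 0" "H n > 0" using n by (auto simp: G_def H_def)
    then show ?case
      using char_mle_approx[of k "\<delta> n" s "\<kappa> n" "G n" "H n" "K n" "\<epsilon> n" "\<pi> n", unfolded qs]
        k elim(1,2) unfolding binary_model_eq sum by (simp add: \<delta>_def \<kappa>_def K_def \<epsilon>_def \<pi>_def)
  qed
  then have "(\<lambda>n. ?E n - exp (- q / 2)) \<longlonglongrightarrow> 0" by (rule Lim_null_comparison[OF _ B])
  then have "?E \<longlonglongrightarrow> exp (- q / 2)" by (rule LIM_zero_cancel)
  then show "(\<lambda>n. measure_pmf.expectation (binary_model n (\<theta> n)) (\<lambda>A. iexp (\<Sum>j\<in>{1..k}. t j *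
      (\<lambda>i\<in>{1..k}. \<Sum>l\<in>{1..k}. kinvsqrt k (block k (S_mat n (\<theta> n))) i l * (mle n A l - \<theta> n l)) j)))
      \<longlonglongrightarrow> exp (- (\<Sum>j\<in>{1..k}. (t j)^2) / 2)"
    unfolding X_def q_def .
qed simp

end
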